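(* Let $\nu>0$ and $\mathbf f\in[L^2(\Omega)]^d$. There exists a unique $(\mathbf u_h,p_h)\in\mathbf V_h\times Q_h$ such that $$\mathbf a_w(\mathbf u_h,\mathbf v)-\mathbf b_w(\mathbf v,p_h)=(\mathbf f,\mathbf v)\quad\forall\,\mathbf v\in\mathbf V_h,\qquad \mathbf b_w(\mathbf u_h,q)=0\quad\forall\,q\in Q_h,$$ i.e. the modified enriched Galerkin (mEG) method for the Stokes equations has a unique solution.
   Context: Let $d\in\{2,3\}$ and let $\Omega\subset\mathbb R^d$ be a bounded domain with simply connected Lipschitz boundary. $\mathcal T_h$ is a triangulation from a shape-regular family of triangulations of $\Omega$ into triangles ($d=2$) or tetrahedra ($d=3$). $\mathcal E_h=\mathcal E_h^o\cup\mathcal E_h^b$ is the set of all edges/faces, split into interior ones $\mathcal E_h^o$ and boundary ones $\mathcal E_h^b$; $h_e=|e|^{1/(d-1)}$, where $|e|$ is the length/area of $e$. For $e\in\mathcal E_h^o$ shared by $T^+$ and $T^-$, $v^\pm$ is the trace of $v|_{T^\pm}$. $\mathbf n$ is the outward unit normal on $\partial T$. $(\cdot,\cdot)$ is the $L^2(\Omega)$ inner product. Jump: $[v]=v^+-v^-$ on $e\in\mathcal E_h^o$ and $[v]=v$ on $e\in\mathcal E_h^b$. For velocity functions put $\{\mathbf v\}_0=(\mathbf v^++\mathbf v^-)/2$ on $e\in\mathcal E_h^o$ and $\{\mathbf v\}_0=\mathbf 0$ on $e\in\mathcal E_h^b$. Spaces: $\mathbf C_h=\{\mathbf v^C\in[H^1_0(\Omega)]^d:\mathbf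 v^C|_T\in[P_1(T)]^d\ \forall T\in\mathcal T_h\}$; $\mathbf D_h=\{\mathbf v^D:\ \mathbf v^D|_T=c_T(\mathbf x-\mathbf x_T),\ c_T\in\mathbb R,\ \forall T\in\mathcal T_h\}$, where $\mathbf x_T$ is the barycenter of $T$; $\mathbf V_h=\mathbf C_h\oplus\mathbf D_h$; $Q_h=\{q\in L^2_0(\Omega):q|_T\in P_0(T)\ \forall T\in\mathcal T_h\}$, where $L^2_0(\Omega)$ is the space of $L^2$ functions with zero mean. Weak derivatives: for $\mathbf v\in\mathbf V_h$, $\nabla_w\mathbf v|_T\in[P_0(T)]^{d\times d}$ and $\nabla_w\cdot\mathbf v|_T\in P_0(T)$ are defined by $(\nabla_w\mathbf v,\aleph)_T=\langle\{\mathbf v\}_0,\aleph\,\mathbf n\rangle_{\partial T}$ for all $\aleph\in[P_0(T)]^{d\times d}$ and $(\nabla_w\cdot\mathbf v,q)_T=\langle\{\mathbf v\}_0\cdot\mathbf n,q\rangle_{\partial T}$ for all $q\in P_0(T)$. Bilinear forms: $\mathbf a_w(\mathbf w,\mathbf v)=\nu\big(\sum_{T\in\mathcal T_h}(\nabla_w\mathbf w,\nabla_w\mathbf v)_T+\sum_{e\in\mathcal E_h}h_e^{-1}\langle[\mathbf w],[\mathbf v]\rangle_e\big)$ and $\mathbf b_w(\mathbf w,q)=\sum_{T\in\mathcal T_h}(\nabla_w\cdot\mathbf w,q)_T$. *)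

theory Defs
  imports "HOL-Analysis.Analysis"
begin

text \<open>Elements of L2 are functions up to almost-everywhere equality; here they are represented by
  arbitrary representatives.\<close>

definition L2 :: "(real^'d) set \<Rightarrow> (real^'d \<Rightarrow> 'b::euclidean_space) set" where
  "L2 \<Omega> = {f. f \<in> borel_measurable (lebesgue_on \<Omega>) \<and>
              integrable (lebesgue_on \<Omega>) (\<lambda>x. (norm (f x))\<^sup>2)}"

definition L2_zero_mean :: "(real^'d) set \<Rightarrow> (real^'d \<Rightarrow> real) set" where
  "L2_zero_mean \<Omega> = {q \<in> L2 \<Omega>. (LINT x|lebesgue_on \<Omega>. q x) = 0}"

definition partial_deriv :: "'d \<Rightarrow> (real^'d \<Rightarrow> real) \<Rightarrow> real^'d \<Rightarrow> real" where
  "partial_deriv i \<phi> x = frechet_derivative \<phi> (at x) (axis i 1)"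

definition gradient :: "(real^'d \<Rightarrow> real) \<Rightarrow> real^'d \<Rightarrow> real^'d" where
  "gradient \<phi> x = (\<chi> i. partial_deriv i \<phi> x)"

primrec times_differentiable :: "nat \<Rightarrow> (real^'d \<Rightarrow> real) \<Rightarrow> bool" where
  "times_differentiable 0 \<phi> \<longleftrightarrow> continuous_on UNIV \<phi>"
| "times_differentiable (Suc k) \<phi> \<longleftrightarrow>
     (\<forall>x. \<phi> differentiable at x) \<and> (\<forall>i. times_differentiable k (partial_deriv i \<phi>))"

definition test_function :: "(real^'d) set \<Rightarrow> (real^'d \<Rightarrow> real) \<Rightarrow> bool" where
  "test_function \<Omega> \<phi> \<longleftrightarrow> (\<forall>k. times_differentiable k \<phi>) \<and>
     compact (closure {x. \<phi> x \<noteq> 0}) \<and> closure {x. \<phi> x \<noteq> 0} \<subseteq> \<Omega>"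

definition is_weak_gradient ::
  "(real^'d) set \<Rightarrow> (real^'d \<Rightarrow> real) \<Rightarrow> (real^'d \<Rightarrow> real^'d) \<Rightarrow> bool" where
  "is_weak_gradient \<Omega> u g \<longleftrightarrow> (\<forall>\<phi>. test_function \<Omega> \<phi> \<longrightarrow>
     (\<forall>i. (LINT x|lebesgue_on \<Omega>. u x * partial_deriv i \<phi> x)
        = - (LINT x|lebesgue_on \<Omega>. g x $ i * \<phi> x)))"

text \<open>The closure of the test functions in the Sobolev space of order one.\<close>

definition H1_0 :: "(real^'d) set \<Rightarrow> (real^'d \<Rightarrow> real) set" where
  "H1_0 \<Omega> = {u \<in> L2 \<Omega>. \<exists>g \<in> L2 \<Omega>. is_weak_gradient \<Omega> u g \<and>
     (\<exists>\<phi> :: nat \<Rightarrow> real^'d \<Rightarrow> real. (\<forall>n. test_function \<Omega> (\<phi> n)) \<and>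
        (\<lambda>n. LINT x|lebesgue_on \<Omega>. (\<phi> n x - u x)\<^sup>2) \<longlonglongrightarrow> 0 \<and>
        (\<lambda>n. LINT x|lebesgue_on \<Omega>. (norm (gradient (\<phi> n) x - g x))\<^sup>2) \<longlonglongrightarrow> 0)}"

text \<open>Near each boundary point the domain is, in suitable orthogonal coordinates with last axis \<open>n\<close>,
  the set above the graph of a Lipschitz function \<open>\<gamma>\<close> on the hyperplane orthogonal to \<open>n\<close>.\<close>

definition lipschitz_boundary :: "(real^'d) set \<Rightarrow> bool" where
  "lipschitz_boundary \<Omega> \<longleftrightarrow> (\<forall>x \<in> frontier \<Omega>. \<exists>r>0. \<exists>n \<gamma> L.
     norm n = 1 \<and> L-lipschitz_on {y. y \<bullet> n = 0} \<gamma> \<and>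
     \<Omega> \<inter> ball x r = {z \<in> ball x r. \<gamma> ((z - x) - ((z - x) \<bullet> n) *\<^sub>R n) < (z - x) \<bullet> n})"

definition triangulation_of :: "(real^'d) set \<Rightarrow> (real^'d) set set \<Rightarrow> bool" where
  "triangulation_of \<Omega> \<T> \<longleftrightarrow> triangulation \<T> \<and>
     (\<forall>T\<in>\<T>. int CARD('d) simplex T) \<and> \<Union>\<T> = closure \<Omega>"

definition inball_diameter :: "(real^'d) set \<Rightarrow> real" where
  "inball_diameter T = Sup {2 * r | r x. 0 \<le> r \<and> cball x r \<subseteq> T}"

definition shape_regular :: "(real^'d) set set set \<Rightarrow> bool" where
  "shape_regular \<F> \<longleftrightarrow>
     (\<exists>\<sigma>>0. \<forall>\<T>\<in>\<F>. \<forall>T\<in>\<T>. diameter T \<le> \<sigma> * inball_diameter T)"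

definition barycenter :: "(real^'d) set \<Rightarrow> real^'d" where
  "barycenter T = (\<Sum>x | x extreme_point_of T. x) /\<^sub>R real (card {x. x extreme_point_of T})"

text \<open>In what follows, \<open>face\<close> means a facet of an element: an edge for \<open>d = 2\<close> and a
  triangular face for \<open>d = 3\<close>.\<close>

definition faces :: "(real^'d) set set \<Rightarrow> (real^'d) set set" where
  "faces \<T> = {e. \<exists>T\<in>\<T>. e facet_of T}"

definition boundary_faces :: "(real^'d) set \<Rightarrow> (real^'d) set set \<Rightarrow> (real^'d) set set" where
  "boundary_faces \<Omega> \<T> = {e \<in> faces \<T>. e \<subseteq> frontier \<Omega>}"

definition interior_faces :: "(real^'d) set \<Rightarrow> (real^'d) set set \<Rightarrow> (real^'d) set set" where
  "interior_faces \<Omega> \<T> = faces \<T> - boundary_faces \<Omega> \<T>"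

text \<open>A choice, for every interior face, of which neighbour is \<open>T\<^sup>+\<close> and which is \<open>T\<^sup>-\<close>.
  On a boundary face \<open>T\<^sup>+\<close> is the element having that face, and \<open>T\<^sup>-\<close> is irrelevant.\<close>

definition face_labelling ::
  "(real^'d) set \<Rightarrow> (real^'d) set set \<Rightarrow> ((real^'d) set \<Rightarrow> (real^'d) set) \<Rightarrow>
   ((real^'d) set \<Rightarrow> (real^'d) set) \<Rightarrow> bool" where
  "face_labelling \<Omega> \<T> Tp Tm \<longleftrightarrow>
     (\<forall>e \<in> interior_faces \<Omega> \<T>. Tp e \<in> \<T> \<and> Tm e \<in> \<T> \<and> Tp e \<noteq> Tm e \<and>
        e facet_of Tp e \<and> e facet_of Tm e) \<and>
     (\<forall>e \<in> boundary_faces \<Omega> \<T>. Tp e \<in> \<T> \<and> e facet_of Tp e)"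

text \<open>For a face \<open>e\<close> this is the \<open>(d-1)\<close>-dimensional Lebesgue measure on the hyperplane
  \<open>affine hull e\<close>: since the slab around the hyperplane has thickness one, its Lebesgue measure is
  mapped to it by the orthogonal projection.\<close>

definition face_measure :: "(real^'d) set \<Rightarrow> (real^'d) measure" where
  "face_measure e =
     distr (restrict_space lborel {z. infdist z (affine hull e) \<le> 1/2}) borel
       (closest_point (affine hull e))"

definition face_h :: "(real^'d) set \<Rightarrow> real" where
  "face_h e = measure (face_measure e) e powr (1 / (real CARD('d) - 1))"

definition outer_normal :: "(real^'d) set \<Rightarrow> (real^'d) set \<Rightarrow> real^'d" where
  "outer_normal T e = (THE n. norm n = 1 \<and> (\<forall>x\<in>e. \<forall>y\<in>T. n \<bullet> (y - x) \<le> 0))"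

text \<open>A piecewise polynomial is represented by a function that is polynomial on the interior of each
  element; its values on the skeleton (a null set) are arbitrary and are never used.\<close>

definition C_space :: "(real^'d) set \<Rightarrow> (real^'d) set set \<Rightarrow> (real^'d \<Rightarrow> real^'d) set" where
  "C_space \<Omega> \<T> = {v. (\<forall>i. (\<lambda>x. v x $ i) \<in> H1_0 \<Omega>) \<and>
     (\<forall>T\<in>\<T>. \<exists>(A::real^'d^'d) b. \<forall>x\<in>interior T. v x = A *v x + b)}"

definition D_space :: "(real^'d) set set \<Rightarrow> (real^'d \<Rightarrow> real^'d) set" where
  "D_space \<T> = {v. \<forall>T\<in>\<T>. \<exists>c::real. \<forall>x\<in>interior T. v x = c *\<^sub>R (x - barycenter T)}"

definition V_space :: "(real^'d) set \<Rightarrow> (real^'d) set set \<Rightarrow> (real^'d \<Rightarrow> real^'d) set" where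
  "V_space \<Omega> \<T> = {v. \<exists>vC \<in> C_space \<Omega> \<T>. \<exists>vD \<in> D_space \<T>. v = (\<lambda>x. vC x + vD x)}"

definition Q_space :: "(real^'d) set \<Rightarrow> (real^'d) set set \<Rightarrow> (real^'d \<Rightarrow> real) set" where
  "Q_space \<Omega> \<T> = {q \<in> L2_zero_mean \<Omega>. \<forall>T\<in>\<T>. \<exists>c. \<forall>x\<in>interior T. q x = c}"

definition side_trace :: "(real^'d) set \<Rightarrow> (real^'d \<Rightarrow> real^'d) \<Rightarrow> real^'d \<Rightarrow> real^'d" where
  "side_trace T v x = Lim (at x within interior T) v"

definition jump ::
  "(real^'d) set \<Rightarrow> (real^'d) set set \<Rightarrow> ((real^'d) set \<Rightarrow> (real^'d) set) \<Rightarrow>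
   ((real^'d) set \<Rightarrow> (real^'d) set) \<Rightarrow> (real^'d \<Rightarrow> real^'d) \<Rightarrow> (real^'d) set \<Rightarrow> real^'d \<Rightarrow> real^'d" where
  "jump \<Omega> \<T> Tp Tm v e x =
     (if e \<in> interior_faces \<Omega> \<T> then side_trace (Tp e) v x - side_trace (Tm e) v x
      else side_trace (Tp e) v x)"

definition avg0 ::
  "(real^'d) set \<Rightarrow> (real^'d) set set \<Rightarrow> ((real^'d) set \<Rightarrow> (real^'d) set) \<Rightarrow>
   ((real^'d) set \<Rightarrow> (real^'d) set) \<Rightarrow> (real^'d \<Rightarrow> real^'d) \<Rightarrow> (real^'d) set \<Rightarrow> real^'d \<Rightarrow> real^'d" where
  "avg0 \<Omega> \<T> Tp Tm v e x =
     (if e \<in> interior_faces \<Omega> \<T> then (side_trace (Tp e) v x + side_trace (Tm e) v x) /\<^sub>R 2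
      else 0)"

text \<open>The constant values on \<open>T\<close> of the weak gradient and the weak divergence. The inner product of
  \<open>real^'d^'d\<close> is the Frobenius product.\<close>

definition weak_grad ::
  "(real^'d) set \<Rightarrow> (real^'d) set set \<Rightarrow> ((real^'d) set \<Rightarrow> (real^'d) set) \<Rightarrow>
   ((real^'d) set \<Rightarrow> (real^'d) set) \<Rightarrow> (real^'d \<Rightarrow> real^'d) \<Rightarrow> (real^'d) set \<Rightarrow> real^'d^'d" where
  "weak_grad \<Omega> \<T> Tp Tm v T =
     (THE G. \<forall>N::real^'d^'d. (LINT x|lebesgue_on T. G \<bullet> N) =
        (\<Sum>e | e facet_of T.
           LINT x:e|face_measure e. avg0 \<Omega> \<T> Tp Tm v e x \<bullet> (N *v outer_normal T e)))"

definition weak_div ::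
  "(real^'d) set \<Rightarrow> (real^'d) set set \<Rightarrow> ((real^'d) set \<Rightarrow> (real^'d) set) \<Rightarrow>
   ((real^'d) set \<Rightarrow> (real^'d) set) \<Rightarrow> (real^'d \<Rightarrow> real^'d) \<Rightarrow> (real^'d) set \<Rightarrow> real" where
  "weak_div \<Omega> \<T> Tp Tm v T =
     (THE c. \<forall>q::real. (LINT x|lebesgue_on T. c * q) =
        (\<Sum>e | e facet_of T.
           LINT x:e|face_measure e. (avg0 \<Omega> \<T> Tp Tm v e x \<bullet> outer_normal T e) * q))"

definition a_w ::
  "(real^'d) set \<Rightarrow> (real^'d) set set \<Rightarrow> ((real^'d) set \<Rightarrow> (real^'d) set) \<Rightarrow>
   ((real^'d) set \<Rightarrow> (real^'d) set) \<Rightarrow> real \<Rightarrow> (real^'d \<Rightarrow> real^'d) \<Rightarrow> (real^'d \<Rightarrow> real^'d) \<Rightarrow> real" where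
  "a_w \<Omega> \<T> Tp Tm \<nu> w v =
     \<nu> * ((\<Sum>T\<in>\<T>. LINT x|lebesgue_on T.
              weak_grad \<Omega> \<T> Tp Tm w T \<bullet> weak_grad \<Omega> \<T> Tp Tm v T) +
          (\<Sum>e\<in>faces \<T>. inverse (face_h e) *
              (LINT x:e|face_measure e. jump \<Omega> \<T> Tp Tm w e x \<bullet> jump \<Omega> \<T> Tp Tm v e x)))"

definition b_w ::
  "(real^'d) set \<Rightarrow> (real^'d) set set \<Rightarrow> ((real^'d) set \<Rightarrow> (real^'d) set) \<Rightarrow>
   ((real^'d) set \<Rightarrow> (real^'d) set) \<Rightarrow> (real^'d \<Rightarrow> real^'d) \<Rightarrow> (real^'d \<Rightarrow> real) \<Rightarrow> real" where
  "b_w \<Omega> \<T> Tp Tm w q =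
     (\<Sum>T\<in>\<T>. LINT x|lebesgue_on T. weak_div \<Omega> \<T> Tp Tm w T * q x)"

definition mEG_solution ::
  "(real^'d) set \<Rightarrow> (real^'d) set set \<Rightarrow> ((real^'d) set \<Rightarrow> (real^'d) set) \<Rightarrow>
   ((real^'d) set \<Rightarrow> (real^'d) set) \<Rightarrow> real \<Rightarrow> (real^'d \<Rightarrow> real^'d) \<Rightarrow>
   (real^'d \<Rightarrow> real^'d) \<Rightarrow> (real^'d \<Rightarrow> real) \<Rightarrow> bool" where
  "mEG_solution \<Omega> \<T> Tp Tm \<nu> f u p \<longleftrightarrow>
     u \<in> V_space \<Omega> \<T> \<and> p \<in> Q_space \<Omega> \<T> \<and>
     (\<forall>v \<in> V_space \<Omega> \<T>.
        a_w \<Omega> \<T> Tp Tm \<nu> u v - b_w \<Omega> \<T> Tp Tm v p = (LINT x|lebesgue_on \<Omega>. f x \<bullet> v x)) \<and>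
     (\<forall>q \<in> Q_space \<Omega> \<T>. b_w \<Omega> \<T> Tp Tm u q = 0)"

end

theory Submission
  imports Defs
begin

text \<open>The discrete problem is a square linear system in finite dimension, so it suffices to show that
  the homogeneous problem has only the trivial solution. Testing with the velocity gives zero energy,
  hence all jumps and all weak gradients vanish. Without jumps the averages are the
  traces from inside, and by the divergence theorem the weak gradient of an element is the gradient of the
  affine function there; so the velocity is constant on every element, and the jumps carry this constant through the
  connected mesh to a boundary face, where it is zero. For the pressure no inf-sup theory is needed: testing with
  \<open>x - x\<^sub>T\<close> on one element \<open>T\<close> shows that a positively weighted sum of the differences
  \<open>q\<^sub>T - q\<^sub>T\<^sub>'\<close> over its neighbours \<open>T'\<close> vanishes, because \<open>(x - x\<^sub>T) \<bullet> n\<close> is a positive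
  constant on each face. So the maximum of \<open>q\<close> spreads to all neighbours (a discrete maximum principle), and a
  constant with zero mean is zero.\<close>

section \<open>Volumes under rank one updates\<close>

text \<open>A face measure is the push-forward of Lebesgue measure on a slab, so face integrals are
  volume integrals, and the divergence theorem is wanted for affine functions only. It is therefore
  enough to change variables by affine maps that differ from the identity by a rank one term: one
  turns the slab over a facet into a prism along an edge, another exchanges two vertices. They show
  that height times area agrees for all facets of a simplex, and that the mean of an affine function
  over a facet is its vertex mean; the rest is algebra of barycentric coordinates.

  The dimension count is delicate because members of the discrete spaces are representatives with
  arbitrary values on the skeleton. Solvability takes the form of a Fredholm alternative: the
  right-hand side has to vanish on the kernel of the transposed problem. It involves the velocity
  alone, so the energy argument settles existence, and the maximum principle enters for uniqueness
  of the pressure.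

  The Lipschitz condition keeps the domain on one side of its boundary, so that a boundary face
  belongs to a single element.\<close>

text \<open>The library computes volumes of linear images in \<open>real^'n\<close> only for a well-ordered index type
  \<open>'n\<close>. A well-ordered copy of the index type transfers this to every finite index type.\<close>

typedef 'a ordered_copy = "UNIV :: 'a set"
  morphisms original copy by auto

instance ordered_copy :: (finite) finite
proof
  have "range (copy :: 'a \<Rightarrow> 'a ordered_copy) = UNIV"
    by (metis UNIV_I UNIV_eq_I original_inverse rangeI)
  then show "finite (UNIV :: 'a ordered_copy set)"
    by (metis finite finite_imageI)
qed

instantiation ordered_copy :: (finite) wellorder
begin

definition less_eq_ordered_copy :: "'a ordered_copy \<Rightarrow> 'a ordered_copy \<Rightarrow> bool" where
  "x \<le> y \<longleftrightarrow> to_nat_on (UNIV :: 'a ordered_copy set) x \<le> to_nat_on (UNIV :: 'a ordered_copy set) y"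

definition less_ordered_copy :: "'a ordered_copy \<Rightarrow> 'a ordered_copy \<Rightarrow> bool" where
  "x < y \<longleftrightarrow> to_nat_on (UNIV :: 'a ordered_copy set) x < to_nat_on (UNIV :: 'a ordered_copy set) y"

instance
proof
  have inj: "inj (to_nat_on (UNIV :: 'a ordered_copy set))"
    by (simp add: inj_on_to_nat_on countable_finite)
  fix x y z :: "'a ordered_copy"
  show "x < y \<longleftrightarrow> x \<le> y \<and> \<not> y \<le> x" "x \<le> x" "x \<le> y \<or> y \<le> x"
    "x \<le> y \<Longrightarrow> y \<le> z \<Longrightarrow> x \<le> z"
    by (auto simp: less_eq_ordered_copy_def less_ordered_copy_def)
  show "x \<le> y \<Longrightarrow> y \<le> x \<Longrightarrow> x = y"
    using inj by (auto simp: less_eq_ordered_copy_def inj_def)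
  fix P :: "'a ordered_copy \<Rightarrow> bool" and a
  assume step: "\<And>x. (\<And>y. y < x \<Longrightarrow> P y) \<Longrightarrow> P x"
  show "P a"
  proof (induction a rule: measure_induct_rule[where f = "to_nat_on (UNIV :: 'a ordered_copy set)"])
    case (less x)
    show ?case by (rule step) (rule less, simp add: less_ordered_copy_def)
  qed
qed

end

text \<open>The matrix determinant lemma. For \<open>v\<close> along a coordinate axis it is
  Cramer's rule for the identity matrix; an orthogonal \<open>Q\<close> that turns \<open>v\<close>
  onto an axis conjugates the general case to this one without changing the determinant.\<close>

lemma det_rank_one_update:
  fixes u v :: "real^'n"
  shows "det (matrix (\<lambda>x. x + (v \<bullet> x) *\<^sub>R u)) = 1 + v \<bullet> u"
proof -
  have axis: "det (matrix (\<lambda>x. x + (c * x $ k) *\<^sub>R w)) = 1 + c * w $ k" for c k and w :: "real^'n"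
  proof -
    have "matrix (\<lambda>x. x + (c * x $ k) *\<^sub>R w)
        = (\<chi> i j. if j = k then ((mat 1 :: real^'n^'n) *v (axis k 1 + c *\<^sub>R w)) $ i
            else (mat 1 :: real^'n^'n) $ i $ j)"
      unfolding matrix_vector_mul_lid by (auto simp: matrix_def vec_eq_iff mat_def axis_def)
    then show ?thesis
      by (simp add: cramer_lemma)
  qed
  define k :: 'n where "k = undefined"
  obtain Q :: "real^'n \<Rightarrow> real^'n" where Q: "orthogonal_transformation Q" "Q v = norm v *\<^sub>R axis k 1"
  proof (rule orthogonal_transformation_exists)
    show "norm v = norm (norm v *\<^sub>R axis k (1::real))" by simp
  qed
  have lin: "linear Q" and orth: "\<And>x y. Q x \<bullet> Q y = x \<bullet> y"
    using Q(1) by (auto simp: orthogonal_transformation_def)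
  define f where "f = (\<lambda>x. x + (v \<bullet> x) *\<^sub>R u)"
  define g where "g = (\<lambda>x. x + (norm v * x $ k) *\<^sub>R Q u)"
  have linf: "linear f" and ling: "linear g"
    by (auto simp: f_def g_def linear_iff algebra_simps inner_add_right scaleR_add_left)
  have "norm v * Q x $ k = v \<bullet> x" for x
    using orth[of v x] Q by (simp add: inner_axis inner_commute)
  then have "Q \<circ> f = g \<circ> Q"
    by (auto simp: f_def g_def linear_add[OF lin] linear_scale[OF lin] mult.commute)
  then have "matrix Q ** matrix f = matrix g ** matrix Q"
    using matrix_compose[OF linf lin] matrix_compose[OF lin ling] by simp
  then have "det (matrix Q) * det (matrix f) = det (matrix g) * det (matrix Q)"
    by (metis det_mul)
  moreover have "det (matrix Q) \<noteq> 0"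
    using Q(1) det_orthogonal_matrix orthogonal_transformation_matrix by fastforce
  ultimately have "det (matrix f) = det (matrix g)" by simp
  also have "\<dots> = 1 + norm v * Q u $ k" unfolding g_def by (rule axis)
  also have "norm v * Q u $ k = v \<bullet> u"
    using orth[of v u] Q by (simp add: inner_axis inner_commute)
  finally show ?thesis by (simp add: f_def)
qed

text \<open>Lebesgue measure is determined by its values on boxes. The preimage of a box is its
  image under the inverse map, whose determinant is the reciprocal of
  \<open>1 + v \<bullet> u\<close>.\<close>

lemma lborel_rank_one_update_wellorder:
  fixes u v :: "real^'n::{finite,wellorder}"
  assumes "1 + v \<bullet> u \<noteq> 0"
  shows "lborel = density (distr lborel borel (\<lambda>x. x + (v \<bullet> x) *\<^sub>R u)) (\<lambda>_. ennreal \<bar>1 + v \<bullet> u\<bar>)"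
proof (rule lborel_eqI)
  define D where "D = 1 + v \<bullet> u"
  define L where "L = (\<lambda>x. x + (v \<bullet> x) *\<^sub>R u)"
  \<comment> \<open>The Sherman-Morrison formula for the inverse of \<open>L\<close>.\<close>
  define K where "K = (\<lambda>x. x + ((- (v /\<^sub>R D)) \<bullet> x) *\<^sub>R u)"
  have D: "D \<noteq> 0" using assms by (simp add: D_def)
  have KL: "K (L x) = x" for x
  proof -
    have *: "v \<bullet> L x = D * (v \<bullet> x)"
      by (simp add: L_def D_def inner_add_right algebra_simps)
    have "K (L x) = L x - (v \<bullet> L x / D) *\<^sub>R u"
      by (simp add: K_def divide_inverse mult.commute)
    then show ?thesis
      unfolding * using D by (simp add: L_def)
  qed
  have LK: "L (K x) = x" for x
  proof -
    have K: "K x = x - (v \<bullet> x / D) *\<^sub>R u"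
      by (simp add: K_def divide_inverse mult.commute)
    have "v \<bullet> K x = (v \<bullet> x) - (v \<bullet> x) / D * (D - 1)"
      by (simp add: K D_def inner_diff_right)
    also have "\<dots> = (v \<bullet> x) / D" using D by (simp add: field_simps)
    finally have "v \<bullet> K x = (v \<bullet> x) / D" .
    then show ?thesis unfolding L_def by (simp add: K)
  qed
  have linK: "linear K"
    by (auto simp: K_def linear_iff algebra_simps inner_add_right scaleR_add_left)
  have borelL[measurable]: "L \<in> borel_measurable borel"
    unfolding L_def by measurable
  fix l w :: "(real, 'n) vec" assume lw: "\<And>b. b \<in> Basis \<Longrightarrow> l \<bullet> b \<le> w \<bullet> b"
  have pre: "L -` box l w = K ` box l w"
  proof (intro equalityI subsetI)
    fix x assume "x \<in> L -` box l w"
    then show "x \<in> K ` box l w" using KL[of x] by (metis imageI vimageD)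
  qed (use LK in auto)
  have bd: "bounded (K ` box l w)"
    by (simp add: bounded_linear_image linK linear_conv_bounded_linear[symmetric])
  have "measure lebesgue (K ` box l w) = \<bar>det (matrix K)\<bar> * measure lebesgue (box l w)"
    by (rule measure_lebesgue_linear_transformation) (auto simp: linK)
  also have "det (matrix K) = 1 / D"
    unfolding K_def det_rank_one_update using D by (simp add: D_def field_simps)
  finally have m: "measure lebesgue (K ` box l w) = measure lborel (box l w) / \<bar>D\<bar>" by simp
  have meas: "K ` box l w \<in> sets borel"
    unfolding pre[symmetric] by (metis borelL borel_open measurable_sets_borel open_box)
  have "emeasure lborel (K ` box l w) = ennreal (measure lborel (box l w) / \<bar>D\<bar>)"
    using m meas bd
    by (metis emeasure_eq_measure2 emeasure_lborel_cbox_finite bounded_set_imp_lmeasurable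
        fmeasurableD emeasure_eq_ennreal_measure emeasure_bounded_finite measure_completion
        less_top sets_lborel infinity_ennreal_def)
  then have e: "emeasure lborel (L -` box l w) = ennreal (measure lborel (box l w) / \<bar>D\<bar>)"
    using pre by simp
  have "emeasure (density (distr lborel borel L) (\<lambda>_. ennreal \<bar>D\<bar>)) (box l w)
      = ennreal \<bar>D\<bar> * emeasure lborel (L -` box l w)"
    by (subst emeasure_density_const) (auto simp: emeasure_distr)
  also have "\<dots> = ennreal (measure lborel (box l w))"
    unfolding e using D by (subst ennreal_mult[symmetric]) auto
  also have "measure lborel (box l w) = (\<Prod>b\<in>Basis. (w - l) \<bullet> b)"
    using lw by (simp add: measure_lborel_box)
  finally show "emeasure (density (distr lborel borel (\<lambda>x. x + (v \<bullet> x) *\<^sub>R u)) (\<lambda>_. ennreal \<bar>1 + v \<bullet> u\<bar>)) (box l w)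
     = (\<Prod>b\<in>Basis. (w - l) \<bullet> b)"
    by (simp add: L_def D_def)
qed simp

section \<open>Transfer of the change of variables to every finite index type\<close>

lemma prod_Basis_cart: "(\<Prod>b\<in>(Basis::(real^'n) set). f b) = (\<Prod>i\<in>UNIV. f (axis i 1))"
proof -
  have B: "(Basis::(real^'n) set) = range (\<lambda>i. axis i 1)"
    by (auto simp: Basis_vec_def)
  show ?thesis
    unfolding B by (subst prod.reindex) (auto simp: inj_def axis_eq_axis)
qed

lemma lborel_reindex:
  fixes \<sigma> :: "'m::finite \<Rightarrow> 'n::finite"
  assumes \<sigma>: "bij \<sigma>"
  shows "lborel = distr lborel borel (\<lambda>x::real^'n. (\<chi> i. x $ \<sigma> i) :: real^'m)"
proof (rule lborel_eqI)
  define \<psi> where "\<psi> = (\<lambda>x::real^'n. (\<chi> i. x $ \<sigma> i) :: real^'m)"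
  define \<tau> where "\<tau> = (\<lambda>x::real^'m. (\<chi> i. x $ inv \<sigma> i) :: real^'n)"
  have lin: "linear \<psi>" by (auto simp: \<psi>_def linear_iff vec_eq_iff)
  have [measurable]: "\<psi> \<in> borel_measurable borel"
    using lin by (simp add: borel_measurable_continuous_onI linear_continuous_on linear_conv_bounded_linear)
  fix l w :: "real^'m" assume lw: "\<And>b. b \<in> Basis \<Longrightarrow> l \<bullet> b \<le> w \<bullet> b"
  have lw': "l $ i \<le> w $ i" for i
    using lw[of "axis i 1"] by (simp add: inner_axis)
  have pre: "\<psi> -` box l w = box (\<tau> l) (\<tau> w)"
    using \<sigma> by (auto simp: mem_box_cart \<psi>_def \<tau>_def bij_is_surj surj_f_inv_f)
      (metis bij_inv_eq_iff)+
  have "emeasure (distr lborel borel \<psi>) (box l w) = emeasure lborel (box (\<tau> l) (\<tau> w))"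
    by (simp add: emeasure_distr pre)
  also have "\<dots> = ennreal (\<Prod>b\<in>Basis. (\<tau> w - \<tau> l) \<bullet> b)"
    using lw' by (subst emeasure_lborel_box) (auto simp: Basis_vec_def inner_axis \<tau>_def)
  also have "(\<Prod>b\<in>Basis. (\<tau> w - \<tau> l) \<bullet> b) = (\<Prod>b\<in>Basis. (w - l) \<bullet> b)"
    unfolding prod_Basis_cart \<tau>_def using prod.reindex_bij_betw[OF bij_imp_bij_inv[OF \<sigma>], of "\<lambda>i. w $ i - l $ i"]
    by (simp add: inner_axis)
  finally show "emeasure (distr lborel borel (\<lambda>x::real^'n. (\<chi> i. x $ \<sigma> i) :: real^'m)) (box l w)
      = (\<Prod>b\<in>Basis. (w - l) \<bullet> b)"
    by (simp add: \<psi>_def)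
qed simp

lemma lborel_integral_reindex:
  fixes \<sigma> :: "'m::finite \<Rightarrow> 'n::finite" and g :: "real^'m \<Rightarrow> real"
  assumes "bij \<sigma>" and [measurable]: "g \<in> borel_measurable borel"
  shows "(\<integral>z. g z \<partial>lborel) = (\<integral>x. g (\<chi> i. x $ \<sigma> i) \<partial>lborel)"
proof -
  have [measurable]: "(\<lambda>x::real^'n. (\<chi> i. x $ \<sigma> i) :: real^'m) \<in> borel_measurable borel"
    by (intro borel_measurable_continuous_onI continuous_intros)
  have "(\<integral>z. g z \<partial>lborel) = (\<integral>z. g z \<partial>distr lborel borel (\<lambda>x::real^'n. (\<chi> i. x $ \<sigma> i) :: real^'m))"
    using lborel_reindex[OF assms(1)] by simp
  then show ?thesis by (simp add: integral_distr)
qed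

text \<open>Every change of variables in the geometric part has this shape. Translation invariance
  absorbs the constant \<open>c\<close>, and reindexing by the ordered copy preserves the inner
  products, so the determinant carries over.\<close>

lemma lborel_integral_rank_one_update:
  fixes u v :: "real^'n" and h :: "real^'n \<Rightarrow> real"
  assumes D: "1 + v \<bullet> u \<noteq> 0" and h[measurable]: "h \<in> borel_measurable borel"
  shows "(\<integral>z. h z \<partial>lborel) = \<bar>1 + v \<bullet> u\<bar> * (\<integral>z. h (z + (v \<bullet> z + c) *\<^sub>R u) \<partial>lborel)"
proof -
  let ?\<psi> = "\<lambda>x::real^'n. (\<chi> i. x $ original i) :: real^('n ordered_copy)"
  let ?\<tau> = "\<lambda>x::real^('n ordered_copy). (\<chi> i. x $ copy i) :: real^'n"
  have bij: "bij (original :: 'n ordered_copy \<Rightarrow> 'n)" "bij (copy :: 'n \<Rightarrow> 'n ordered_copy)"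
    by (metis bijI' copy_inverse original_inverse UNIV_I)+
  have m[measurable]: "?\<tau> \<in> borel_measurable borel"
    by (intro borel_measurable_continuous_onI continuous_intros)
  have m'[measurable]: "?\<psi> \<in> borel_measurable borel"
    by (intro borel_measurable_continuous_onI continuous_intros)
  have inner: "?\<psi> v \<bullet> ?\<psi> x = v \<bullet> x" for v x
    using sum.reindex_bij_betw[OF bij(1), of "\<lambda>i. v $ i * x $ i"] by (simp add: inner_vec_def)
  have shift: "(\<integral>z. g (z + a) \<partial>lborel) = (\<integral>z. g z \<partial>lborel)"
    if [measurable]: "g \<in> borel_measurable borel" for g :: "real^'n \<Rightarrow> real" and a
  proof -
    have "(\<integral>z. g z \<partial>lborel) = (\<integral>z. g z \<partial>distr lborel borel ((+) a))"
      by (simp add: lborel_distr_plus)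
    then show ?thesis by (simp add: integral_distr add.commute)
  qed
  have "(\<integral>z. h z \<partial>lborel) = (\<integral>z. h (z + c *\<^sub>R u) \<partial>lborel)"
    by (simp add: shift)
  also have "\<dots> = (\<integral>z. h (?\<tau> z + c *\<^sub>R u) \<partial>lborel)"
    by (subst lborel_integral_reindex[OF bij(2)]) (simp_all)
  also have "\<dots> = \<bar>1 + v \<bullet> u\<bar> * (\<integral>z. h (?\<tau> (z + (?\<psi> v \<bullet> z) *\<^sub>R ?\<psi> u) + c *\<^sub>R u) \<partial>lborel)"
  proof -
    have "lborel = density (distr lborel borel (\<lambda>x. x + (?\<psi> v \<bullet> x) *\<^sub>R ?\<psi> u)) (\<lambda>_. ennreal \<bar>1 + v \<bullet> u\<bar>)"
      using lborel_rank_one_update_wellorder[of "?\<psi> v" "?\<psi> u"] D unfolding inner by simp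
    then have "(\<integral>z. h (?\<tau> z + c *\<^sub>R u) \<partial>lborel) = (\<integral>z. h (?\<tau> z + c *\<^sub>R u) 
        \<partial>density (distr lborel borel (\<lambda>x. x + (?\<psi> v \<bullet> x) *\<^sub>R ?\<psi> u)) (\<lambda>_. ennreal \<bar>1 + v \<bullet> u\<bar>))"
      by simp
    then show ?thesis by (simp add: integral_density integral_distr)
  qed
  also have "(\<integral>z. h (?\<tau> (z + (?\<psi> v \<bullet> z) *\<^sub>R ?\<psi> u) + c *\<^sub>R u) \<partial>lborel)
      = (\<integral>z. h (?\<tau> (?\<psi> z + (v \<bullet> z) *\<^sub>R ?\<psi> u) + c *\<^sub>R u) \<partial>lborel)"
    by (subst lborel_integral_reindex[OF bij(1)]) (simp_all only: inner, measurable)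
  also have "\<dots> = (\<integral>z. h (z + (v \<bullet> z + c) *\<^sub>R u) \<partial>lborel)"
  proof (rule Bochner_Integration.integral_cong[OF refl])
    fix z
    have "?\<tau> (?\<psi> z + (v \<bullet> z) *\<^sub>R ?\<psi> u) + c *\<^sub>R u = z + (v \<bullet> z + c) *\<^sub>R u"
      by (simp add: vec_eq_iff copy_inverse algebra_simps)
    then show "h (?\<tau> (?\<psi> z + (v \<bullet> z) *\<^sub>R ?\<psi> u) + c *\<^sub>R u) = h (z + (v \<bullet> z + c) *\<^sub>R u)"
      by simp
  qed
  finally show ?thesis .
qed

section \<open>Integration over faces\<close>

abbreviation face_integral :: "(real^'d) set \<Rightarrow> (real^'d \<Rightarrow> real) \<Rightarrow> real" where
  "face_integral e g \<equiv> (LINT x:e|face_measure e. g x)"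

section \<open>Distance from a hyperplane and projection onto it\<close>

lemma dist_hyperplane_ge:
  fixes n :: "'a::euclidean_space"
  assumes "norm n = 1" "n \<bullet> x = \<beta>"
  shows "\<bar>n \<bullet> z - \<beta>\<bar> \<le> dist z x"
proof -
  have "\<bar>n \<bullet> (z - x)\<bar> \<le> norm n * norm (z - x)" by (rule Cauchy_Schwarz_ineq2)
  then show ?thesis using assms by (simp add: inner_diff_right dist_norm)
qed

lemma closest_point_hyperplane:
  fixes n :: "'a::euclidean_space"
  assumes "norm n = 1"
  shows "closest_point {x. n \<bullet> x = \<beta>} z = z - (n \<bullet> z - \<beta>) *\<^sub>R n"
proof (rule closest_point_unique[symmetric])
  have nn: "n \<bullet> n = 1" using assms by (simp add: norm_eq_1)
  show "z - (n \<bullet> z - \<beta>) *\<^sub>R n \<in> {x. n \<bullet> x = \<beta>}"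
    by (simp add: inner_diff_right nn)
  show "\<forall>x\<in>{x. n \<bullet> x = \<beta>}. dist z (z - (n \<bullet> z - \<beta>) *\<^sub>R n) \<le> dist z x"
    using dist_hyperplane_ge[OF assms] assms by (auto simp: dist_norm)
qed (auto simp: convex_hyperplane closed_hyperplane)

lemma infdist_hyperplane:
  fixes n :: "'a::euclidean_space"
  assumes "norm n = 1"
  shows "infdist z {x. n \<bullet> x = \<beta>} = \<bar>n \<bullet> z - \<beta>\<bar>"
proof (rule antisym)
  have nn: "n \<bullet> n = 1" using assms by (simp add: norm_eq_1)
  have in_H: "z - (n \<bullet> z - \<beta>) *\<^sub>R n \<in> {x. n \<bullet> x = \<beta>}"
    by (simp add: inner_diff_right nn)
  have "infdist z {x. n \<bullet> x = \<beta>} \<le> dist z (z - (n \<bullet> z - \<beta>) *\<^sub>R n)"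
    by (rule infdist_le[OF in_H])
  also have "\<dots> = \<bar>n \<bullet> z - \<beta>\<bar>" using assms by (simp add: dist_norm)
  finally show "infdist z {x. n \<bullet> x = \<beta>} \<le> \<bar>n \<bullet> z - \<beta>\<bar>" .
  show "\<bar>n \<bullet> z - \<beta>\<bar> \<le> infdist z {x. n \<bullet> x = \<beta>}"
    unfolding infdist_def using in_H dist_hyperplane_ge[OF assms]
    by (auto intro!: cINF_greatest)
qed

definition hyperplane_proj :: "'a::euclidean_space \<Rightarrow> real \<Rightarrow> 'a \<Rightarrow> 'a" where
  "hyperplane_proj n \<beta> z = z - (n \<bullet> z - \<beta>) *\<^sub>R n"

lemma continuous_hyperplane_proj: "continuous_on S (hyperplane_proj n \<beta>)"
  unfolding hyperplane_proj_def by (intro continuous_intros)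

text \<open>The right prism of height one over \<open>e\<close> in the direction \<open>n\<close>.
  By \<open>emeasure_face\<close> its volume is the area of \<open>e\<close>.\<close>

definition slab :: "'a::euclidean_space \<Rightarrow> real \<Rightarrow> 'a set \<Rightarrow> 'a set" where
  "slab n \<beta> e = {z. \<bar>n \<bullet> z - \<beta>\<bar> \<le> 1/2 \<and> hyperplane_proj n \<beta> z \<in> e}"

section \<open>Area of a single face and integrals over it\<close>

locale flat_face =
  fixes e :: "(real^'d) set" and n :: "real^'d" and \<beta> :: real
  assumes compact: "compact e" and norm_n: "norm n = 1"
    and affine_hull: "affine hull e = {x. n \<bullet> x = \<beta>}"
begin

lemma inner_n: "x \<in> e \<Longrightarrow> n \<bullet> x = \<beta>"
  using hull_inc[of x e affine] affine_hull by auto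

lemma nn: "n \<bullet> n = 1"
  using norm_n by (simp add: norm_eq_1)

lemma proj_eq: "x \<in> e \<Longrightarrow> hyperplane_proj n \<beta> x = x"
  by (simp add: hyperplane_proj_def inner_n)

lemma proj_eq_closest_point: "closest_point (affine hull e) = hyperplane_proj n \<beta>"
  by (simp add: affine_hull hyperplane_proj_def closest_point_hyperplane[OF norm_n] fun_eq_iff)

lemma borel_proj [measurable]: "hyperplane_proj n \<beta> \<in> borel_measurable borel"
  by (intro borel_measurable_continuous_onI continuous_hyperplane_proj)

lemma face_borel [measurable]: "e \<in> sets borel"
  by (simp add: compact borel_compact)

definition band :: "(real^'d) set" where
  "band = {z. infdist z (affine hull e) \<le> 1/2}"

lemma band_closed: "closed band"
  unfolding band_def by (intro closed_Collect_le continuous_intros)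

lemma band_borel [measurable]: "band \<in> sets borel"
  using band_closed by simp

lemma band_eq: "band = {z. \<bar>n \<bullet> z - \<beta>\<bar> \<le> 1/2}"
  by (simp add: band_def affine_hull infdist_hyperplane[OF norm_n])

lemma face_measure_eq:
  "face_measure e = distr (restrict_space lborel band) borel (hyperplane_proj n \<beta>)"
  by (simp add: face_measure_def proj_eq_closest_point band_def)

lemma closed_slab: "closed (slab n \<beta> e)"
proof -
  have "slab n \<beta> e = band \<inter> hyperplane_proj n \<beta> -` e"
    unfolding band_eq by (auto simp: slab_def)
  moreover have "closed (hyperplane_proj n \<beta> -` e)"
    using continuous_closed_vimage[OF compact_imp_closed[OF compact]] continuous_hyperplane_proj
    by (metis continuous_on_eq_continuous_at open_UNIV UNIV_I)
  ultimately show ?thesis using band_closed by auto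
qed

lemma bounded_slab: "bounded (slab n \<beta> e)"
proof -
  obtain B where B: "\<And>x. x \<in> e \<Longrightarrow> norm x \<le> B"
    using compact_imp_bounded[OF compact] by (auto simp: bounded_iff)
  have "norm z \<le> B + 1" if "z \<in> slab n \<beta> e" for z
  proof -
    have "z = hyperplane_proj n \<beta> z + (n \<bullet> z - \<beta>) *\<^sub>R n" by (simp add: hyperplane_proj_def)
    then have "norm z \<le> norm (hyperplane_proj n \<beta> z) + norm ((n \<bullet> z - \<beta>) *\<^sub>R n)"
      by (metis norm_triangle_ineq)
    also have "\<dots> \<le> B + 1"
      using that B[of "hyperplane_proj n \<beta> z"] norm_n by (auto simp: slab_def)
    finally show ?thesis .
  qed
  then show ?thesis by (auto simp: bounded_iff)
qed

lemma sets_face_measure [measurable_cong, simp]: "sets (face_measure e) = sets borel"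
  by (simp add: face_measure_def)

lemma emeasure_face: "emeasure (face_measure e) e = emeasure lborel (slab n \<beta> e)"
proof -
  have "emeasure (face_measure e) e = emeasure (restrict_space lborel band) (hyperplane_proj n \<beta> -` e \<inter> band)"
    unfolding face_measure_eq
    by (subst emeasure_distr) (auto simp: space_restrict_space measurable_restrict_space1)
  also have "\<dots> = emeasure lborel (hyperplane_proj n \<beta> -` e \<inter> band)"
    by (subst emeasure_restrict_space) auto
  also have "hyperplane_proj n \<beta> -` e \<inter> band = slab n \<beta> e"
    unfolding band_eq by (auto simp: slab_def)
  finally show ?thesis .
qed

lemma emeasure_face_finite: "emeasure (face_measure e) e < \<infinity>"
  unfolding emeasure_face using bounded_slab emeasure_bounded_finite by auto

lemma face_integrable:
  fixes g :: "real^'d \<Rightarrow> real"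
  assumes "continuous_on e g"
  shows "set_integrable (face_measure e) e g"
proof -
  have "bounded (g ` e)"
    using compact_continuous_image[OF assms compact] compact_imp_bounded by blast
  then obtain B where B: "\<And>x. x \<in> e \<Longrightarrow> \<bar>g x\<bar> \<le> B" by (auto simp: bounded_iff)
  have "(\<lambda>x. indicator e x *\<^sub>R g x) \<in> borel_measurable (face_measure e)"
    using borel_measurable_continuous_on_indicator[OF face_borel assms] by simp
  then show ?thesis
    unfolding set_integrable_def
    by (rule integrableI_bounded_set[of e, where B=B, rotated])
      (use B emeasure_face_finite in \<open>auto simp: indicator_def\<close>)
qed

lemma face_integral_eq_slab:
  assumes "continuous_on e g"
  shows "face_integral e g = (\<integral>z. indicator (slab n \<beta> e) z * g (hyperplane_proj n \<beta> z) \<partial>lborel)"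
proof -
  have m[measurable]: "(\<lambda>x. indicator e x *\<^sub>R g x) \<in> borel_measurable borel"
    by (rule borel_measurable_continuous_on_indicator[OF face_borel assms])
  have "face_integral e g
      = (\<integral>z. indicator e (hyperplane_proj n \<beta> z) *\<^sub>R g (hyperplane_proj n \<beta> z) \<partial>restrict_space lborel band)"
    unfolding set_lebesgue_integral_def face_measure_eq
    by (rule integral_distr[OF _ m]) (simp add: measurable_restrict_space1)
  also have "\<dots> = (\<integral>z. indicator band z *\<^sub>R
      (indicator e (hyperplane_proj n \<beta> z) *\<^sub>R g (hyperplane_proj n \<beta> z)) \<partial>lborel)"
    by (rule integral_restrict_space) simp
  also have "\<dots> = (\<integral>z. indicator (slab n \<beta> e) z * g (hyperplane_proj n \<beta> z) \<partial>lborel)"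
    unfolding band_eq by (rule Bochner_Integration.integral_cong) (auto simp: slab_def indicator_def)
  finally show ?thesis .
qed

lemma face_integral_add:
  fixes f g :: "real^'d \<Rightarrow> real"
  assumes "continuous_on e f" "continuous_on e g"
  shows "face_integral e (\<lambda>x. f x + g x) = face_integral e f + face_integral e g"
  by (intro set_integral_add face_integrable assms)

lemma face_integral_cong:
  fixes f g :: "real^'d \<Rightarrow> real"
  assumes "\<And>x. x \<in> e \<Longrightarrow> f x = g x"
  shows "face_integral e f = face_integral e g"
  by (rule set_lebesgue_integral_cong) (auto simp: assms)

lemma face_integral_sum:
  fixes f :: "'i \<Rightarrow> real^'d \<Rightarrow> real"
  assumes "finite I" "\<And>i. i \<in> I \<Longrightarrow> continuous_on e (f i)"
  shows "face_integral e (\<lambda>x. \<Sum>i\<in>I. f i x) = (\<Sum>i\<in>I. face_integral e (f i))"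
  using assms
  by (induction I) (auto simp: face_integral_add continuous_on_sum)

lemma face_integral_const: "face_integral e (\<lambda>_. c) = c * face_integral e (\<lambda>_. 1)"
  using set_integral_mult_right[where a=c and f="\<lambda>_. 1"] by simp

lemma face_integral_1: "face_integral e (\<lambda>_. 1) = measure (face_measure e) e"
  using emeasure_face_finite by (simp add: set_lebesgue_integral_def)

lemma measure_face: "measure (face_measure e) e = measure lborel (slab n \<beta> e)"
  by (simp add: measure_def emeasure_face)

text \<open>A relative interior point of \<open>e\<close> has a neighbourhood \<open>U\<close> that
  meets the hyperplane only inside \<open>e\<close>. The points of the open band that project into
  \<open>U\<close> form a nonempty open subset of the slab.\<close>

lemma measure_face_pos:
  assumes "convex e" "e \<noteq> {}"
  shows "0 < measure (face_measure e) e"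
proof -
  obtain x where x: "x \<in> rel_interior e"
    using rel_interior_eq_empty[OF assms(1)] assms(2) by auto
  obtain U where U: "open U" "rel_interior e = affine hull e \<inter> U"
    using openin_rel_interior[of e] by (auto simp: openin_open)
  let ?W = "{z. \<bar>n \<bullet> z - \<beta>\<bar> < 1/2} \<inter> hyperplane_proj n \<beta> -` U"
  have xe: "x \<in> e" using x rel_interior_subset by blast
  have opW: "open ?W"
    by (intro open_Int open_Collect_less continuous_intros open_vimage U continuous_hyperplane_proj)
  have sub: "?W \<subseteq> slab n \<beta> e"
  proof
    fix z assume z: "z \<in> ?W"
    have "hyperplane_proj n \<beta> z \<in> affine hull e"
      by (simp add: affine_hull hyperplane_proj_def inner_diff_right nn)
    with z U have "hyperplane_proj n \<beta> z \<in> rel_interior e" by auto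
    then show "z \<in> slab n \<beta> e"
      using z rel_interior_subset[of e] by (auto simp: slab_def)
  qed
  have "x \<in> ?W" using x U proj_eq[OF xe] inner_n[OF xe] by auto
  then have "\<not> negligible ?W" using open_not_negligible[OF opW] by blast
  then have "\<not> negligible (slab n \<beta> e)" using negligible_subset sub by blast
  moreover have "slab n \<beta> e \<in> lmeasurable"
    using bounded_slab closed_slab by (simp add: compact_eq_bounded_closed lmeasurable_compact)
  ultimately have "measure lebesgue (slab n \<beta> e) \<noteq> 0"
    using negligible_iff_measure by blast
  then have "0 < measure lebesgue (slab n \<beta> e)" by (simp add: zero_less_measure_iff)
  then show ?thesis
    using closed_slab by (simp add: measure_face)
qed

lemma face_integral_pos:
  fixes f :: "real^'d \<Rightarrow> real"
  assumes "convex e" "e \<noteq> {}" "\<And>x. x \<in> e \<Longrightarrow> f x = c" "0 < c"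
  shows "0 < face_integral e f"
  using face_integral_cong[of f "\<lambda>_. c"] measure_face_pos assms
  by (simp add: face_integral_const[of c] face_integral_1)

end

section \<open>Simplices and the divergence theorem\<close>

lemma unit_normals_parallel:
  fixes m k :: "'a::euclidean_space"
  assumes "norm m = 1" "norm k = 1" and sub: "{x. m \<bullet> x = \<gamma>} \<subseteq> {x. k \<bullet> x = \<delta>}"
  shows "k = m \<or> k = - m"
proof -
  have mm: "m \<bullet> m = 1" and kk: "k \<bullet> k = 1" using assms by (auto simp: norm_eq_1)
  have "\<gamma> *\<^sub>R m \<in> {x. m \<bullet> x = \<gamma>}" "\<gamma> *\<^sub>R m + (k - (m \<bullet> k) *\<^sub>R m) \<in> {x. m \<bullet> x = \<gamma>}"
    by (simp_all add: mm inner_add_right inner_diff_right)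
  then have "k \<bullet> (\<gamma> *\<^sub>R m) = \<delta>" "k \<bullet> (\<gamma> *\<^sub>R m + (k - (m \<bullet> k) *\<^sub>R m)) = \<delta>"
    using sub by blast+
  then have "k \<bullet> (k - (m \<bullet> k) *\<^sub>R m) = 0" by (simp add: inner_add_right)
  then have sq: "(m \<bullet> k)^2 = 1" by (simp add: inner_diff_right kk inner_commute power2_eq_square)
  have "(k - (m \<bullet> k) *\<^sub>R m) \<bullet> (k - (m \<bullet> k) *\<^sub>R m) = 0"
    using sq by (simp add: inner_diff_right inner_diff_left kk mm inner_commute power2_eq_square)
  then have km: "k = (m \<bullet> k) *\<^sub>R m" by simp
  have "m \<bullet> k = 1 \<or> m \<bullet> k = -1" using sq by (simp add: power2_eq_1_iff)
  then show ?thesis using km by auto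
qed

text \<open>Makes the definite description in \<open>outer_normal\<close> usable. A competitor is
  constant on \<open>e\<close>, since its inequality holds in both directions between points of
  \<open>e\<close>; hence it is \<open>m\<close> or \<open>- m\<close>, and the point
  \<open>y\<close> strictly below the hyperplane excludes \<open>- m\<close>.\<close>

lemma outer_normal_eqI:
  fixes m :: "real^'d"
  assumes m: "norm m = 1" "affine hull e = {x. m \<bullet> x = \<gamma>}"
    and sub: "e \<subseteq> T" and le: "\<And>y. y \<in> T \<Longrightarrow> m \<bullet> y \<le> \<gamma>"
    and y: "y \<in> T" "m \<bullet> y < \<gamma>"
  shows "outer_normal T e = m"
  unfolding outer_normal_def
proof (rule the_equality)
  have on_e: "m \<bullet> x = \<gamma>" if "x \<in> e" for x
    using hull_inc[OF that, of affine] m by auto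
  have mm: "m \<bullet> m = 1" using m by (simp add: norm_eq_1)
  show "norm m = 1 \<and> (\<forall>x\<in>e. \<forall>y\<in>T. m \<bullet> (y - x) \<le> 0)"
    using m on_e le by (simp add: inner_diff_right)
  fix k assume k: "norm k = 1 \<and> (\<forall>x\<in>e. \<forall>y\<in>T. k \<bullet> (y - x) \<le> 0)"
  have "\<gamma> *\<^sub>R m \<in> affine hull e" unfolding m by (simp add: mm)
  then obtain x0 where x0: "x0 \<in> e" by (metis affine_hull_empty empty_iff equals0I)
  have "k \<bullet> x = k \<bullet> x0" if "x \<in> e" for x
  proof (rule antisym)
    have "k \<bullet> (x - x0) \<le> 0" "k \<bullet> (x0 - x) \<le> 0" using k x0 that sub by auto
    then show "k \<bullet> x \<le> k \<bullet> x0" "k \<bullet> x0 \<le> k \<bullet> x" by (auto simp: inner_diff_right)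
  qed
  then have "affine hull e \<subseteq> {x. k \<bullet> x = k \<bullet> x0}"
    by (intro hull_minimal) (auto simp: affine_hyperplane)
  then have "k = m \<or> k = - m"
    using k m by (intro unit_normals_parallel) auto
  moreover have False if "k = - m"
  proof -
    have "k \<bullet> (y - x0) > 0" using y on_e[OF x0] that by (simp add: inner_diff_right)
    then show False using k x0 y by fastforce
  qed
  ultimately show "k = m" by auto
qed

lemma convex_hull_affine_image:
  assumes aff: "\<And>x y t. f ((1 - t) *\<^sub>R x + t *\<^sub>R y) = (1 - t) *\<^sub>R f x + t *\<^sub>R f y"
    and "f ` X \<subseteq> Y" "x \<in> convex hull X"
  shows "f x \<in> convex hull Y"
proof -
  have "convex (f -` (convex hull Y))"
    unfolding convex_alt vimage_def mem_Collect_eq aff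
    using convex_convex_hull[of Y, unfolded convex_alt] by blast
  moreover have "X \<subseteq> f -` (convex hull Y)" using assms(2) hull_subset by fastforce
  ultimately have "convex hull X \<subseteq> f -` (convex hull Y)" by (rule hull_minimal[rotated])
  then show ?thesis using assms(3) by auto
qed

section \<open>Barycentric coordinates of a full-dimensional simplex\<close>

locale full_simplex =
  fixes C :: "(real^'d) set"
  assumes indep: "\<not> affine_dependent C" and card_C: "card C = Suc CARD('d)"
begin

definition facet :: "real^'d \<Rightarrow> (real^'d) set" where
  "facet v = convex hull (C - {v})"

abbreviation normal :: "real^'d \<Rightarrow> real^'d" where
  "normal v \<equiv> outer_normal (convex hull C) (facet v)"

abbreviation area :: "real^'d \<Rightarrow> real" where
  "area v \<equiv> measure (face_measure (facet v)) (facet v)"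

definition offset :: "real^'d \<Rightarrow> real" where
  "offset v = (SOME \<gamma>. \<forall>x\<in>facet v. normal v \<bullet> x = \<gamma>)"

definition height :: "real^'d \<Rightarrow> real" where
  "height v = offset v - normal v \<bullet> v"

text \<open>The barycentric coordinate of the vertex \<open>v\<close>, as signed distance from the
  opposite facet divided by the height. In this form it is an affine function on the whole space
  with gradient \<open>- normal v /\<^sub>R height v\<close>.\<close>

definition bary :: "real^'d \<Rightarrow> real^'d \<Rightarrow> real" where
  "bary v x = (offset v - normal v \<bullet> x) / height v"

lemma finite_C: "finite C"
  using indep aff_independent_finite by blast

lemma affine_hull_C: "affine hull C = UNIV"
  using affine_independent_span_eq[OF indep] card_C by simp

lemma card_minus: "v \<in> C \<Longrightarrow> card (C - {v}) = CARD('d)"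
  using card_C finite_C by simp

lemma convex_facet: "convex (facet v)"
  by (simp add: facet_def)

lemma compact_facet: "compact (facet v)"
  by (simp add: facet_def finite_imp_compact_convex_hull finite_C)

lemma facet_nonempty: "v \<in> C \<Longrightarrow> facet v \<noteq> {}"
  using card_minus[of v] by (metis card.empty convex_hull_eq_empty facet_def zero_less_card_finite less_irrefl)

lemma vertex_in_facet: "w \<in> C \<Longrightarrow> w \<noteq> v \<Longrightarrow> w \<in> facet v"
  by (simp add: facet_def hull_inc)

lemma facet_subset: "facet v \<subseteq> convex hull C"
  unfolding facet_def by (rule hull_mono) auto

lemma normal_facts:
  assumes v: "v \<in> C"
  shows norm_normal: "norm (normal v) = 1"
    and affine_hull_facet: "affine hull (facet v) = {x. normal v \<bullet> x = offset v}"
    and height_pos: "0 < height v"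
proof -
  have "aff_dim (C - {v}) = int DIM(real^'d) - 1"
    using aff_dim_affine_independent[OF affine_independent_subset[OF indep, of "C - {v}"]]
      card_minus[OF v] by auto
  then obtain a b where ab: "a \<noteq> 0" "affine hull (C - {v}) = {x. a \<bullet> x = b}"
    using aff_dim_eq_hyperplane[of "C - {v}"] by auto
  have ah: "affine hull (facet v) = affine hull (C - {v})"
    by (simp add: facet_def)
  have "v \<notin> affine hull (C - {v})" using indep v by (auto simp: affine_dependent_def)
  then have nz: "b - a \<bullet> v \<noteq> 0" using ab by auto
  \<comment> \<open>Scales \<open>a\<close> to unit length and orients it so that \<open>v\<close>
    lies strictly below the hyperplane.\<close>
  define s where "s = sgn (b - a \<bullet> v) / norm a"
  have s: "s \<noteq> 0" "s * (b - a \<bullet> v) > 0" "\<bar>s\<bar> * norm a = 1"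
    using nz ab(1) by (auto simp: s_def sgn_if abs_mult divide_simps)
  have hyp: "affine hull (facet v) = {x. (s *\<^sub>R a) \<bullet> x = s * b}"
    using s(1) by (simp add: ah ab(2))
  have pos: "(s *\<^sub>R a) \<bullet> v < s * b"
    using s(2) by (simp add: right_diff_distrib)
  have on: "(s *\<^sub>R a) \<bullet> x = s * b" if "x \<in> facet v" for x
    using hull_inc[OF that, of affine] hyp by blast
  have le: "(s *\<^sub>R a) \<bullet> y \<le> s * b" if "y \<in> convex hull C" for y
  proof -
    have "w \<in> {x. (s *\<^sub>R a) \<bullet> x \<le> s * b}" if "w \<in> C" for w
    proof (cases "w = v")
      case False
      then have "(s *\<^sub>R a) \<bullet> w = s * b" by (intro on vertex_in_facet that)
      then show ?thesis by (simp del: inner_scaleR_left)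
    qed (use pos in simp)
    then have "convex hull C \<subseteq> {x. (s *\<^sub>R a) \<bullet> x \<le> s * b}"
      by (intro hull_minimal convex_halfspace_le) blast
    then show ?thesis using that by blast
  qed
  have n: "normal v = s *\<^sub>R a"
    by (rule outer_normal_eqI[OF _ hyp facet_subset le _ pos]) (use s v in \<open>auto simp: hull_inc\<close>)
  obtain x0 where x0: "x0 \<in> facet v" using facet_nonempty[OF v] by blast
  have "\<forall>x\<in>facet v. normal v \<bullet> x = offset v"
    unfolding offset_def by (rule someI[where x = "s * b"]) (use on n in auto)
  then have off: "offset v = s * b" using on[OF x0] n x0 by force
  show "norm (normal v) = 1" "affine hull (facet v) = {x. normal v \<bullet> x = offset v}" "0 < height v"
    using s hyp pos by (auto simp: n off height_def)
qed

lemma flat_face_facet: "v \<in> C \<Longrightarrow> flat_face (facet v) (normal v) (offset v)"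
  by unfold_locales (auto simp: compact_facet norm_normal affine_hull_facet)

lemma normal_inner_facet: "v \<in> C \<Longrightarrow> x \<in> facet v \<Longrightarrow> normal v \<bullet> x = offset v"
  using flat_face.inner_n flat_face_facet by blast

lemma bary_vertex: "v \<in> C \<Longrightarrow> w \<in> C \<Longrightarrow> bary v w = (if v = w then 1 else 0)"
  using height_pos[of v] normal_inner_facet[OF _ vertex_in_facet, of v w]
  by (auto simp: bary_def height_def)

lemma bary_facet: "v \<in> C \<Longrightarrow> x \<in> facet v \<Longrightarrow> bary v x = 0"
  by (simp add: bary_def normal_inner_facet)

lemma bary_affine: "bary v (x + t *\<^sub>R y) = bary v x - t * (normal v \<bullet> y / height v)"
  by (simp add: bary_def inner_add_right diff_divide_distrib add_divide_distrib)

text \<open>Every point is an affine combination of the vertices with some coefficients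
  \<open>u\<close>. The affine function \<open>bary w\<close> is one at \<open>w\<close> and zero at
  the other vertices, so it reads off \<open>u w\<close>.\<close>

lemma bary_coordinates:
  shows sum_bary: "(\<Sum>v\<in>C. bary v x) = 1"
    and sum_bary_scaleR: "(\<Sum>v\<in>C. bary v x *\<^sub>R v) = x"
proof -
  obtain u where u: "sum u C = 1" "(\<Sum>v\<in>C. u v *\<^sub>R v) = x"
    using affine_hull_C affine_hull_finite[OF finite_C] by blast
  have "bary w x = u w" if w: "w \<in> C" for w
  proof -
    have "offset w - normal w \<bullet> x = (\<Sum>v\<in>C. u v * (offset w - normal w \<bullet> v))"
      using u by (simp add: right_diff_distrib sum_subtractf flip: sum_distrib_right)
        (simp add: inner_sum_right flip: u(2))
    then have "bary w x = (\<Sum>v\<in>C. u v * bary w v)"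
      by (simp add: bary_def sum_divide_distrib)
    also have "\<dots> = (\<Sum>v\<in>C. if v = w then u v else 0)"
      by (intro sum.cong) (auto simp: bary_vertex w)
    also have "\<dots> = u w" using w finite_C by simp
    finally show ?thesis .
  qed
  then show "(\<Sum>v\<in>C. bary v x) = 1" "(\<Sum>v\<in>C. bary v x *\<^sub>R v) = x"
    using u by auto
qed

text \<open>An affine involution, hence measure preserving: a rank one update of the identity with determinant
  \<open>-1\<close>.\<close>

definition swap :: "real^'d \<Rightarrow> real^'d \<Rightarrow> real^'d \<Rightarrow> real^'d" where
  "swap a b x = x + (bary a x - bary b x) *\<^sub>R (b - a)"

lemma bary_swap:
  assumes "a \<in> C" "b \<in> C" "a \<noteq> b" "v \<in> C"
  shows "bary v (swap a b x) = bary (Transposition.transpose a b v) x"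
proof -
  have *: "normal v \<bullet> (b - a) / height v = bary v a - bary v b"
    by (simp add: bary_def inner_diff_right diff_divide_distrib)
  show ?thesis
    unfolding swap_def bary_affine * using assms
    by (auto simp: bary_vertex Transposition.transpose_def)
qed

lemma swap_swap:
  assumes "a \<in> C" "b \<in> C" "a \<noteq> b"
  shows "swap a b (swap a b x) = x"
proof -
  have "swap a b (swap a b x) = swap a b x + (bary b x - bary a x) *\<^sub>R (b - a)"
    using assms by (subst swap_def) (simp add: bary_swap)
  then show ?thesis by (simp add: swap_def algebra_simps)
qed

lemma swap_commute: "swap a b = swap b a"
  by (simp add: swap_def fun_eq_iff algebra_simps)

lemma swap_affine: "swap a b ((1 - t) *\<^sub>R x + t *\<^sub>R y) = (1 - t) *\<^sub>R swap a b x + t *\<^sub>R swap a b y"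
proof -
  have *: "bary v ((1 - t) *\<^sub>R x + t *\<^sub>R y) = (1 - t) * bary v x + t * bary v y" for v
    by (simp add: bary_def inner_add_right algebra_simps diff_divide_distrib add_divide_distrib)
  show ?thesis unfolding swap_def * by (simp add: vec_eq_iff algebra_simps)
qed

lemma swap_vertex:
  "a \<in> C \<Longrightarrow> b \<in> C \<Longrightarrow> v \<in> C \<Longrightarrow> swap a b v = Transposition.transpose a b v"
  by (auto simp: swap_def bary_vertex Transposition.transpose_def)

lemma swap_facet:
  assumes "a \<in> C" "b \<in> C" "x \<in> facet v"
  shows "swap a b x \<in> facet (Transposition.transpose a b v)"
proof -
  have "swap a b ` (C - {v}) \<subseteq> C - {Transposition.transpose a b v}"
    using assms by (auto simp: swap_vertex) (auto simp: Transposition.transpose_def split: if_splits)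
  then show ?thesis
    using convex_hull_affine_image[where f = "swap a b", OF swap_affine] assms(3) by (auto simp: facet_def)
qed

text \<open>The prism over the facet opposite \<open>a\<close> generated by the edge direction
  \<open>a - b\<close> in place of the normal. This is the direction that the linear part of
  \<open>swap a b\<close> reverses.\<close>

definition sheared_prism :: "real^'d \<Rightarrow> real^'d \<Rightarrow> (real^'d) set" where
  "sheared_prism a b = (\<lambda>(y, s). y + s *\<^sub>R (a - b)) ` (facet a \<times> {-1/2..1/2})"

lemma sheared_prism_borel [measurable]: "sheared_prism a b \<in> sets borel"
proof -
  have "compact (sheared_prism a b)"
    unfolding sheared_prism_def case_prod_unfold
    by (intro compact_continuous_image compact_Times compact_facet compact_Icc continuous_intros)
  then show ?thesis by (simp add: borel_compact)
qed

text \<open>The map \<open>M\<close> keeps the projection to the facet and replaces the normal by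
  \<open>c = a - b\<close>. Its determinant is \<open>?n \<bullet> c = - height a\<close>, because
  \<open>b\<close> lies on the facet opposite \<open>a\<close>; so the slab is stretched by the
  factor \<open>height a\<close>.\<close>

lemma measure_sheared_prism:
  assumes "a \<in> C" "b \<in> C" "a \<noteq> b"
  shows "measure lborel (sheared_prism a b) = height a * area a"
proof -
  interpret flat_face "facet a" "normal a" "offset a" by (rule flat_face_facet) fact
  let ?n = "normal a"
  define c where "c = a - b"
  have nc: "?n \<bullet> c = - height a"
    using normal_inner_facet[OF assms(1) vertex_in_facet, of b] assms
    by (simp add: c_def height_def inner_diff_right)
  have h: "height a > 0" by (rule height_pos) fact
  define M where "M z = z + (?n \<bullet> z + - offset a) *\<^sub>R (c - ?n)" for z
  have Mz: "M z = hyperplane_proj ?n (offset a) z + (?n \<bullet> z - offset a) *\<^sub>R c" for z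
    by (simp add: M_def hyperplane_proj_def algebra_simps)
  have eq: "M z \<in> sheared_prism a b \<longleftrightarrow> z \<in> slab ?n (offset a) (facet a)" for z
  proof
    assume "M z \<in> sheared_prism a b"
    then obtain y s where ys: "y \<in> facet a" "- 1/2 \<le> s" "s \<le> 1/2" "M z = y + s *\<^sub>R c"
      by (auto simp: sheared_prism_def c_def)
    have "?n \<bullet> M z = offset a + (?n \<bullet> z - offset a) * (?n \<bullet> c)"
      unfolding Mz by (simp add: hyperplane_proj_def inner_add_right inner_diff_right nn)
    moreover have "?n \<bullet> M z = offset a + s * (?n \<bullet> c)"
      unfolding ys(4) using inner_n[OF ys(1)] by (simp add: inner_add_right)
    ultimately have s: "s = ?n \<bullet> z - offset a" using nc h by auto
    then have "hyperplane_proj ?n (offset a) z = y" using ys(4) unfolding Mz by simp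
    moreover have "\<bar>?n \<bullet> z - offset a\<bar> \<le> 1/2" using ys(2,3) s by linarith
    ultimately show "z \<in> slab ?n (offset a) (facet a)" using ys(1) by (simp add: slab_def)
  next
    assume z: "z \<in> slab ?n (offset a) (facet a)"
    then have "\<bar>?n \<bullet> z - offset a\<bar> \<le> 1/2" by (simp add: slab_def)
    then have "?n \<bullet> z - offset a \<in> {-1/2..1/2}" unfolding atLeastAtMost_iff by linarith
    with z show "M z \<in> sheared_prism a b"
      unfolding sheared_prism_def slab_def Mz c_def
      by (intro image_eqI[where x = "(hyperplane_proj ?n (offset a) z, ?n \<bullet> z - offset a)"]) auto
  qed
  have D: "1 + ?n \<bullet> (c - ?n) = - height a" by (simp add: inner_diff_right nn nc)
  have "measure lborel (sheared_prism a b) = (\<integral>z. indicator (sheared_prism a b) z \<partial>lborel)" by simp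
  also have "\<dots> = \<bar>1 + ?n \<bullet> (c - ?n)\<bar> * (\<integral>z. indicator (sheared_prism a b) (M z) \<partial>lborel)"
    unfolding M_def using D h by (intro lborel_integral_rank_one_update) auto
  also have "\<dots> = height a * (\<integral>z. indicator (slab ?n (offset a) (facet a)) z \<partial>lborel)"
    unfolding D using h by (simp add: indicator_def eq)
  also have "\<dots> = height a * measure lborel (slab ?n (offset a) (facet a))" by simp
  finally show ?thesis by (simp add: measure_face)
qed

section \<open>The common product of height and facet area\<close>

lemma swap_eq_rank_one:
  "swap a b x = x + ((normal b /\<^sub>R height b - normal a /\<^sub>R height a) \<bullet> x
      + (offset a / height a - offset b / height b)) *\<^sub>R (b - a)"
  by (simp add: swap_def bary_def inner_diff_left diff_divide_distrib divide_inverse algebra_simps)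

lemma swap_det:
  assumes "a \<in> C" "b \<in> C" "a \<noteq> b"
  shows "(normal b /\<^sub>R height b - normal a /\<^sub>R height a) \<bullet> (b - a) = -2"
proof -
  have *: "normal v \<bullet> (b - a) / height v = bary v a - bary v b" for v
    by (simp add: bary_def inner_diff_right diff_divide_distrib)
  have "(normal b /\<^sub>R height b - normal a /\<^sub>R height a) \<bullet> (b - a)
      = normal b \<bullet> (b - a) / height b - normal a \<bullet> (b - a) / height a"
    by (simp add: inner_diff_left divide_inverse mult.commute)
  then show ?thesis unfolding * using assms by (simp add: bary_vertex)
qed

text \<open>Two facets sheared along the edge that joins their opposite vertices sweep out prisms that
  \<open>swap\<close> maps onto each other.\<close>

lemma height_times_measure_eq:
  assumes "a \<in> C" "b \<in> C" "a \<noteq> b"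
  shows "height a * area a
    = height b * area b"
proof -
  have shift: "swap a b (y + s *\<^sub>R (a - b)) = swap a b y + s *\<^sub>R (b - a)"
    if "a \<in> C" "b \<in> C" "a \<noteq> b" for a b y s
  proof -
    have *: "normal v \<bullet> (a - b) / height v = bary v b - bary v a" for v
      by (simp add: bary_def inner_diff_right diff_divide_distrib)
    show ?thesis
      using that unfolding swap_def bary_affine * by (simp add: bary_vertex vec_eq_iff algebra_simps)
  qed
  have sub: "swap a b z \<in> sheared_prism b a"
    if ab: "a \<in> C" "b \<in> C" "a \<noteq> b" and z: "z \<in> sheared_prism a b" for a b z
  proof -
    obtain y s where ys: "y \<in> facet a" "s \<in> {-1/2..1/2}" "z = y + s *\<^sub>R (a - b)"
      using z by (auto simp: sheared_prism_def)
    have "swap a b y \<in> facet b" using swap_facet[of a b y a] ab ys by simp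
    moreover have "swap a b z = swap a b y + s *\<^sub>R (b - a)"
      unfolding ys(3) by (rule shift) (use ab in auto)
    ultimately show ?thesis using ys(2)
      unfolding sheared_prism_def by (intro image_eqI[where x = "(swap a b y, s)"]) auto
  qed
  have "swap a b z \<in> sheared_prism b a \<longleftrightarrow> z \<in> sheared_prism a b" for z
    using sub[of a b z] sub[of b a "swap a b z"] swap_swap[of a b z] assms
    by (auto simp: swap_commute[of b a])
  then have "(\<integral>z. indicat_real (sheared_prism b a) (swap a b z) \<partial>lborel) = measure lborel (sheared_prism a b)"
    by (subst Bochner_Integration.integral_cong[OF refl, where g = "indicat_real (sheared_prism a b)"])
      (auto simp: indicator_def)
  moreover have "(\<integral>z. indicat_real (sheared_prism b a) z \<partial>lborel) =
      (\<integral>z. indicat_real (sheared_prism b a) (swap a b z) \<partial>lborel)"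
    unfolding swap_eq_rank_one using swap_det[OF assms]
    by (subst lborel_integral_rank_one_update[where c = "offset a / height a - offset b / height b" and u = "b - a"
          and v = "normal b /\<^sub>R height b - normal a /\<^sub>R height a"]) auto
  ultimately have "measure lborel (sheared_prism b a) = measure lborel (sheared_prism a b)" by simp
  then show ?thesis using measure_sheared_prism assms by simp
qed

text \<open>Extending \<open>swap\<close> from the facet to the surrounding slab, constantly in the normal direction, gives
  a measure preserving map of the slab.\<close>

lemma face_integral_bary_eq:
  assumes v: "v \<in> C" and a: "a \<in> C" "a \<noteq> v" and b: "b \<in> C" "b \<noteq> v" and ab: "a \<noteq> b"
  shows "face_integral (facet v) (bary a) = face_integral (facet v) (bary b)"
proof -
  interpret flat_face "facet v" "normal v" "offset v" by (rule flat_face_facet) fact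
  let ?n = "normal v"
  let ?\<pi> = "hyperplane_proj ?n (offset v)"
  let ?w = "normal b /\<^sub>R height b - normal a /\<^sub>R height a"
  define k where "k = offset a / height a - offset b / height b"
  have cont: "continuous_on S (bary c)" if "c \<in> C" for c S
    unfolding bary_def using height_pos[OF that] by (intro continuous_intros) auto
  have nu: "?n \<bullet> (b - a) = 0"
    using normal_inner_facet[OF v vertex_in_facet] a b by (simp add: inner_diff_right)
  \<comment> \<open>The tangential part of the gradient \<open>?w\<close>: the coefficient in
    \<open>L\<close> is evaluated at the projected point, so it cannot vary in the normal
    direction.\<close>
  define w where "w = ?w - (?w \<bullet> ?n) *\<^sub>R ?n"
  define L where "L z = z + (bary a (?\<pi> z) - bary b (?\<pi> z)) *\<^sub>R (b - a)" for z
  have swap_coeff: "bary a x - bary b x = ?w \<bullet> x + k" for x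
    by (simp add: k_def bary_def inner_diff_left diff_divide_distrib divide_inverse algebra_simps)
  have L_rank: "L z = z + (w \<bullet> z + (offset v * (?w \<bullet> ?n) + k)) *\<^sub>R (b - a)" for z
    unfolding L_def swap_coeff w_def
    by (simp add: hyperplane_proj_def inner_diff_left inner_diff_right inner_commute algebra_simps)
  \<comment> \<open>The edge \<open>b - a\<close> is parallel to the facet, so discarding the normal
    part of \<open>?w\<close> does not affect the determinant found in
    \<open>swap_det\<close>.\<close>
  have D: "1 + w \<bullet> (b - a) = -1"
    unfolding w_def using swap_det[OF a(1) b(1) ab] nu by (simp add: inner_diff_left)
  have nL: "?n \<bullet> L z = ?n \<bullet> z" for z
    by (simp add: L_def inner_add_right nu)
  have \<pi>L: "?\<pi> (L z) = swap a b (?\<pi> z)" for z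
    unfolding hyperplane_proj_def nL by (simp add: L_def swap_def hyperplane_proj_def)
  have facet_iff: "swap a b x \<in> facet v \<longleftrightarrow> x \<in> facet v" for x
    using swap_facet[of a b x v] swap_facet[of a b "swap a b x" v] swap_swap[of a b x] a b ab
    by (auto simp: Transposition.transpose_def)
  define \<Phi> where "\<Phi> c z = indicator (slab ?n (offset v) (facet v)) z * bary c (?\<pi> z)" for c z
  have "\<Phi> a (L z) = \<Phi> b z" for z
    using bary_swap[of a b a] a b ab
    by (simp add: \<Phi>_def slab_def indicator_def nL \<pi>L facet_iff)
  moreover have [measurable]: "\<Phi> c \<in> borel_measurable borel" if "c \<in> C" for c
  proof -
    have [measurable]: "slab ?n (offset v) (facet v) \<in> sets borel" using closed_slab by simp
    have [measurable]: "(\<lambda>z. bary c (?\<pi> z)) \<in> borel_measurable borel"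
      by (intro borel_measurable_continuous_onI continuous_on_compose2[OF cont[OF that, of UNIV] continuous_hyperplane_proj])
        simp
    show ?thesis unfolding \<Phi>_def by measurable
  qed
  ultimately have "(\<integral>z. \<Phi> a z \<partial>lborel) = (\<integral>z. \<Phi> b z \<partial>lborel)"
    using lborel_integral_rank_one_update[of w "b - a" "\<Phi> a"
        "offset v * (?w \<bullet> ?n) + k"] D a
    by (simp flip: L_rank)
  then show ?thesis
    using face_integral_eq_slab[OF cont] a b by (simp add: \<Phi>_def)
qed

text \<open>Up to sign the summands are gradients of barycentric coordinates. The first sum
  differentiates the partition of unity, the second the affine function
  \<open>p \<bullet> x + q\<close> interpolated from its vertex values.\<close>

lemma height_normal_sum:
  shows sum_normal: "(\<Sum>v\<in>C. normal v /\<^sub>R height v) = 0"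
    and sum_normal_affine: "(\<Sum>v\<in>C. (p \<bullet> v + q) *\<^sub>R (normal v /\<^sub>R height v)) = - p"
proof -
  have diff: "bary v x - bary v 0 = - ((normal v /\<^sub>R height v) \<bullet> x)" for v x
    by (simp add: bary_def divide_inverse algebra_simps)
  have "(\<Sum>v\<in>C. normal v /\<^sub>R height v) \<bullet> x = 0" for x
  proof -
    have "(\<Sum>v\<in>C. normal v /\<^sub>R height v) \<bullet> x = (\<Sum>v\<in>C. bary v 0 - bary v x)"
      unfolding inner_sum_left
    proof (rule sum.cong[OF refl])
      fix v show "(normal v /\<^sub>R height v) \<bullet> x = bary v 0 - bary v x"
        using diff[of v x] by linarith
    qed
    then show ?thesis by (simp add: sum_subtractf sum_bary)
  qed
  then show 0: "(\<Sum>v\<in>C. normal v /\<^sub>R height v) = 0"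
    using inner_eq_zero_iff by blast
  have "(\<Sum>v\<in>C. (p \<bullet> v) *\<^sub>R (normal v /\<^sub>R height v)) \<bullet> x = - p \<bullet> x" for x
  proof -
    have "p \<bullet> x = (\<Sum>v\<in>C. (p \<bullet> v) * bary v x) - (\<Sum>v\<in>C. (p \<bullet> v) * bary v 0)"
      using arg_cong[OF sum_bary_scaleR[of x], of "(\<bullet>) p"] arg_cong[OF sum_bary_scaleR[of 0], of "(\<bullet>) p"]
      by (simp add: inner_sum_right mult.commute)
    also have "\<dots> = (\<Sum>v\<in>C. (p \<bullet> v) * (bary v x - bary v 0))"
      by (simp add: sum_subtractf right_diff_distrib)
    finally show ?thesis unfolding diff by (simp add: inner_sum_left sum_negf mult.assoc)
  qed
  then have "(\<Sum>v\<in>C. (p \<bullet> v) *\<^sub>R (normal v /\<^sub>R height v)) = - p"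
    by (rule vector_eq_rdot[THEN iffD1, OF allI])
  then show "(\<Sum>v\<in>C. (p \<bullet> v + q) *\<^sub>R (normal v /\<^sub>R height v)) = - p"
    unfolding scaleR_add_left sum.distrib scaleR_sum_right[symmetric] 0 by simp
qed

section \<open>Exact integration of affine functions over facets\<close>

lemma continuous_bary: "continuous_on S (bary c)"
  unfolding bary_def divide_inverse by (intro continuous_intros)

text \<open>On the facet the coordinate of \<open>v\<close> vanishes, the \<open>CARD('d)\<close>
  others add up to one, and by \<open>face_integral_bary_eq\<close> their integrals agree.\<close>

lemma face_integral_bary:
  assumes v: "v \<in> C" and a: "a \<in> C" "a \<noteq> v"
  shows "face_integral (facet v) (bary a) = area v / CARD('d)"
proof -
  interpret flat_face "facet v" "normal v" "offset v" by (rule flat_face_facet) fact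
  have "area v = face_integral (facet v) (\<lambda>_. 1)"
    by (simp add: face_integral_1)
  also have "\<dots> = face_integral (facet v) (\<lambda>x. \<Sum>b\<in>C - {v}. bary b x)"
  proof (rule face_integral_cong)
    fix x assume x: "x \<in> facet v"
    show "1 = (\<Sum>b\<in>C - {v}. bary b x)"
      using sum_bary[of x] bary_facet[OF v x] by (simp add: sum.remove[OF finite_C v])
  qed
  also have "\<dots> = (\<Sum>b\<in>C - {v}. face_integral (facet v) (bary b))"
    by (rule face_integral_sum) (auto simp: finite_C continuous_bary)
  also have "\<dots> = (\<Sum>b\<in>C - {v}. face_integral (facet v) (bary a))"
  proof (rule sum.cong[OF refl])
    fix b assume "b \<in> C - {v}"
    then show "face_integral (facet v) (bary b) = face_integral (facet v) (bary a)"
      using face_integral_bary_eq[OF v a, of b] by (cases "a = b") auto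
  qed
  finally show ?thesis by (simp add: card_minus[OF v])
qed

text \<open>The vertex quadrature rule is exact for affine functions, since these are interpolated
  by the barycentric coordinates.\<close>

lemma face_integral_affine:
  assumes v: "v \<in> C"
  shows "face_integral (facet v) (\<lambda>x. p \<bullet> x + q)
    = area v / CARD('d) * (\<Sum>a\<in>C - {v}. p \<bullet> a + q)"
proof -
  interpret flat_face "facet v" "normal v" "offset v" by (rule flat_face_facet) fact
  have "p \<bullet> x + q = (\<Sum>a\<in>C - {v}. (p \<bullet> a + q) * bary a x)" if x: "x \<in> facet v" for x
  proof -
    have "p \<bullet> x + q = p \<bullet> (\<Sum>a\<in>C. bary a x *\<^sub>R a) + q * (\<Sum>a\<in>C. bary a x)"
      by (simp add: sum_bary sum_bary_scaleR)
    also have "\<dots> = (\<Sum>a\<in>C. (p \<bullet> a + q) * bary a x)"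
      unfolding inner_sum_right sum_distrib_left sum.distrib[symmetric]
      by (intro sum.cong) (auto simp: algebra_simps)
    finally show ?thesis using bary_facet[OF v x] by (simp add: sum.remove[OF finite_C v])
  qed
  then have "face_integral (facet v) (\<lambda>x. p \<bullet> x + q)
      = face_integral (facet v) (\<lambda>x. \<Sum>a\<in>C - {v}. (p \<bullet> a + q) * bary a x)"
    by (rule face_integral_cong)
  also have "\<dots> = (\<Sum>a\<in>C - {v}. face_integral (facet v) (\<lambda>x. (p \<bullet> a + q) * bary a x))"
    by (rule face_integral_sum) (auto simp: finite_C intro!: continuous_on_mult_left continuous_bary)
  also have "\<dots> = (\<Sum>a\<in>C - {v}. (p \<bullet> a + q) * (area v / CARD('d)))"
    using v by (intro sum.cong refl) (simp add: face_integral_bary)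
  finally show ?thesis by (simp add: sum_distrib_left sum_distrib_right mult.commute sum_divide_distrib)
qed

lemma facets_eq: "{e. e facet_of convex hull C} = facet ` C"
  using card_C by (auto simp: facet_of_convex_hull_affine_independent_alt[OF indep] facet_def)

lemma inj_on_facet: "inj_on facet C"
proof (rule inj_onI, rule ccontr)
  fix v w assume vw: "v \<in> C" "w \<in> C" "facet v = facet w" "v \<noteq> w"
  then have "bary w w = 0" using bary_facet[of v w] vertex_in_facet[of w v]
    by (metis bary_facet vertex_in_facet)
  then show False using vw by (simp add: bary_vertex)
qed

text \<open>The factor \<open>\<kappa>\<close> is the volume of the simplex, but only its positivity matters, and this avoids
  computing volumes.\<close>

lemma divergence_theorem:
  obtains \<kappa> where "\<kappa> > 0"
    "\<And>p q. (\<Sum>e | e facet_of convex hull C.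
        face_integral e (\<lambda>x. p \<bullet> x + q) *\<^sub>R outer_normal (convex hull C) e) = \<kappa> *\<^sub>R p"
proof -
  obtain c where c: "c \<in> C" using card_C by (metis card.empty equals0I nat.distinct(1))
  \<comment> \<open>By \<open>height_times_measure_eq\<close> this product does not depend on the
    chosen vertex; it is \<open>CARD('d)\<close> times the volume.\<close>
  define K where "K = height c * area c"
  have K: "height v * area v = K" if "v \<in> C" for v
    using height_times_measure_eq[of v c] that c by (cases "v = c") (auto simp: K_def)
  have "area c > 0"
    by (rule flat_face.measure_face_pos[OF flat_face_facet])
      (use c facet_nonempty in \<open>auto simp: convex_facet\<close>)
  then have "K > 0" using height_pos[OF c] by (simp add: K_def)
  moreover have "(\<Sum>e | e facet_of convex hull C.
        face_integral e (\<lambda>x. p \<bullet> x + q) *\<^sub>R outer_normal (convex hull C) e) = (K / CARD('d)) *\<^sub>R p" for p q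
  proof -
    \<comment> \<open>The vertex rule on the facet opposite \<open>v\<close> omits only the value at
      \<open>v\<close>. The full sum \<open>S\<close> is then multiplied by the sum in
      \<open>sum_normal\<close>, which is zero, and the omitted values produce \<open>p\<close> by
      \<open>sum_normal_affine\<close>.\<close>
    define S where "S = (\<Sum>a\<in>C. p \<bullet> a + q)"
    have "face_integral (facet v) (\<lambda>x. p \<bullet> x + q) *\<^sub>R normal v
        = (K / CARD('d)) *\<^sub>R (S *\<^sub>R (normal v /\<^sub>R height v) - (p \<bullet> v + q) *\<^sub>R (normal v /\<^sub>R height v))"
      if v: "v \<in> C" for v
    proof -
      have "area v = K / height v"
        using K[OF v] height_pos[OF v] by (simp add: field_simps)
      moreover have "(\<Sum>a\<in>C - {v}. p \<bullet> a + q) = S - (p \<bullet> v + q)"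
        by (simp add: S_def sum.remove[OF finite_C v])
      ultimately show ?thesis
        unfolding face_integral_affine[OF v] scaleR_diff_left[symmetric] by (simp add: divide_inverse)
    qed
    then have "(\<Sum>v\<in>C. face_integral (facet v) (\<lambda>x. p \<bullet> x + q) *\<^sub>R normal v)
        = (K / CARD('d)) *\<^sub>R (S *\<^sub>R (\<Sum>v\<in>C. normal v /\<^sub>R height v)
            - (\<Sum>v\<in>C. (p \<bullet> v + q) *\<^sub>R (normal v /\<^sub>R height v)))"
      by (simp only: scaleR_sum_right[symmetric] sum_subtractf cong: sum.cong)
    also have "\<dots> = (K / CARD('d)) *\<^sub>R p" by (simp only: sum_normal sum_normal_affine) simp
    finally show ?thesis
      unfolding facets_eq by (simp add: sum.reindex[OF inj_on_facet])
  qed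
  ultimately show thesis using that[of "K / CARD('d)"] by simp
qed

lemma extreme_points_eq: "{x. x extreme_point_of convex hull C} = C"
  using extreme_point_of_convex_hull_affine_independent[OF indep] by auto

text \<open>At the barycenter each barycentric coordinate equals
  \<open>1 / real (Suc CARD('d))\<close>. The positivity of this distance to the facet drives the
  maximum principle for the pressure.\<close>

lemma normal_inner_barycenter:
  assumes "v \<in> C" "x \<in> facet v"
  shows "normal v \<bullet> (x - barycenter (convex hull C)) = height v / real (Suc CARD('d))"
proof -
  have "normal v \<bullet> w = offset v - height v * bary v w" for w
    using height_pos[OF assms(1)] by (simp add: bary_def)
  then have "normal v \<bullet> (\<Sum>w\<in>C. w) = (\<Sum>w\<in>C. offset v - height v * bary v w)"
    by (simp add: inner_sum_right)
  also have "\<dots> = real (card C) * offset v - height v * (\<Sum>w\<in>C. bary v w)"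
    by (simp add: sum_subtractf sum_distrib_left)
  also have "(\<Sum>w\<in>C. bary v w) = (\<Sum>w\<in>C. if w = v then 1 else 0)"
    by (intro sum.cong) (auto simp: bary_vertex assms)
  also have "\<dots> = 1" using finite_C assms by simp
  finally have "normal v \<bullet> (\<Sum>w\<in>C. w) = real (card C) * offset v - height v" by simp
  then show ?thesis
    using card_C normal_inner_facet[OF assms]
    by (simp add: barycenter_def extreme_points_eq inner_diff_right divide_simps del: of_nat_Suc)
qed

end

section \<open>Mesh topology\<close>

context full_simplex
begin

section \<open>A simplex near the centre of a facet\<close>

lemma mem_hull_iff_bary: "x \<in> convex hull C \<longleftrightarrow> (\<forall>v\<in>C. 0 \<le> bary v x)"
proof
  assume "\<forall>v\<in>C. 0 \<le> bary v x"
  then show "x \<in> convex hull C"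
    using sum_bary[of x] sum_bary_scaleR[of x] by (auto simp: convex_hull_finite[OF finite_C])
next
  have conv: "convex {x. 0 \<le> bary v x}" if "v \<in> C" for v
  proof -
    have "{x. 0 \<le> bary v x} = {x. normal v \<bullet> x \<le> offset v}"
      using height_pos[OF that] by (auto simp: bary_def zero_le_divide_iff)
    then show ?thesis by (simp add: convex_halfspace_le)
  qed
  have "convex hull C \<subseteq> {x. 0 \<le> bary v x}" if "v \<in> C" for v
    using that by (intro hull_minimal conv) (auto simp: bary_vertex)
  moreover assume "x \<in> convex hull C"
  ultimately show "\<forall>v\<in>C. 0 \<le> bary v x" by blast
qed

text \<open>The barycenter of a facet serves as an explicit point of its relative interior: all
  coordinates but that of \<open>w\<close> have the value \<open>1 / real CARD('d)\<close>
  there.\<close>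

lemma facet_center:
  assumes w: "w \<in> C"
  shows facet_center_in: "barycenter (facet w) \<in> facet w"
    and bary_facet_center: "v \<in> C \<Longrightarrow> v \<noteq> w \<Longrightarrow> 0 < bary v (barycenter (facet w))"
proof -
  have "{x. x extreme_point_of facet w} = C - {w}"
    using extreme_point_of_convex_hull_affine_independent[OF affine_independent_subset[OF indep, of "C - {w}"]]
    by (auto simp: facet_def)
  then have bc: "barycenter (facet w) = (\<Sum>x\<in>C - {w}. (1 / real CARD('d)) *\<^sub>R x)"
    by (simp add: barycenter_def card_minus[OF w] scaleR_sum_right inverse_eq_divide)
  have one: "(\<Sum>x\<in>C - {w}. 1 / real CARD('d)) = 1"
    by (simp add: card_minus[OF w])
  show "barycenter (facet w) \<in> facet w"
    unfolding bc unfolding facet_def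
    by (rule convex_sum[OF _ convex_convex_hull one]) (use finite_C in \<open>auto simp: hull_inc\<close>)
  show "0 < bary v (barycenter (facet w))" if v: "v \<in> C" "v \<noteq> w"
  proof -
    have "bary v (barycenter (facet w)) = (\<Sum>x\<in>C - {w}. (1 / real CARD('d)) * bary v x)"
    proof -
      have "offset v - normal v \<bullet> barycenter (facet w)
          = (\<Sum>x\<in>C - {w}. (1 / real CARD('d)) * (offset v - normal v \<bullet> x))"
        unfolding bc inner_sum_right right_diff_distrib sum_subtractf
        by (simp add: card_minus[OF w])
      then show ?thesis by (simp add: bary_def sum_divide_distrib)
    qed
    also have "\<dots> = (\<Sum>x\<in>C - {w}. if x = v then 1 / real CARD('d) else 0)"
      by (intro sum.cong) (auto simp: bary_vertex v)
    also have "\<dots> = 1 / real CARD('d)" using v finite_C by simp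
    finally show ?thesis by simp
  qed
qed

text \<open>At the centre of the facet all constraints except that of \<open>w\<close> are strict,
  so nearby a single half-space decides membership. Later, two half balls at a common facet either
  overlap or fill a ball.\<close>

lemma half_ball_subset:
  assumes w: "w \<in> C"
  obtains r where "0 < r"
    "\<And>z. z \<in> ball (barycenter (facet w)) r \<Longrightarrow> normal w \<bullet> z \<le> offset w \<Longrightarrow> z \<in> convex hull C"
proof -
  define U where "U = (\<Inter>v\<in>C - {w}. {z. 0 < bary v z})"
  have "open U"
    unfolding U_def using finite_C
    by (intro open_INT ballI open_Collect_less continuous_bary continuous_on_const) auto
  moreover have "barycenter (facet w) \<in> U"
    using bary_facet_center[OF w] by (auto simp: U_def)
  ultimately obtain r where r: "0 < r" "ball (barycenter (facet w)) r \<subseteq> U"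
    using open_contains_ball by blast
  show thesis
  proof (rule that[OF r(1)])
    fix z assume "z \<in> ball (barycenter (facet w)) r" and n: "normal w \<bullet> z \<le> offset w"
    then have "0 < bary v z" if "v \<in> C" "v \<noteq> w" for v
      using r(2) that by (auto simp: U_def)
    moreover have "0 \<le> bary w z" using n height_pos[OF w] by (simp add: bary_def)
    ultimately show "z \<in> convex hull C"
      unfolding mem_hull_iff_bary by (metis less_imp_le)
  qed
qed

end

lemma full_simplexE:
  assumes "int CARD('d) simplex (T :: (real^'d) set)"
  obtains C where "full_simplex C" "T = convex hull C"
  using assms unfolding simplex_def full_simplex_def by force

text \<open>Gathers the facts about a facet that the mesh arguments use, without reference to the
  vertex set.\<close>

lemma facet_of_simplex:
  assumes T: "int CARD('d) simplex (T :: (real^'d) set)" and e: "e facet_of T"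
  obtains \<beta> r c where "flat_face e (outer_normal T e) \<beta>" "barycenter e \<in> e"
    "0 < r" "\<forall>z\<in>ball (barycenter e) r. outer_normal T e \<bullet> z \<le> \<beta> \<longrightarrow> z \<in> T"
    "0 < c" "\<forall>x\<in>e. outer_normal T e \<bullet> (x - barycenter T) = c"
proof -
  obtain C where C: "full_simplex C" "T = convex hull C" using full_simplexE[OF T] .
  interpret full_simplex C by fact
  obtain w where w: "w \<in> C" "e = facet w" using facets_eq e unfolding C(2) by auto
  obtain r where r: "0 < r" "\<And>z. z \<in> ball (barycenter (facet w)) r \<Longrightarrow> normal w \<bullet> z \<le> offset w
      \<Longrightarrow> z \<in> convex hull C"
    using half_ball_subset[OF w(1)] by blast
  show thesis
    by (rule that[of "offset w" r "height w / real (Suc CARD('d))"])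
      (use flat_face_facet[OF w(1)] facet_center_in[OF w(1)] r normal_inner_barycenter[OF w(1)] height_pos[OF w(1)]
        in \<open>auto simp: C(2) w(2)\<close>)
qed

text \<open>The points below the graph form an open set disjoint from \<Omega>, hence from its
  closure, and they come arbitrarily close to \<open>x\<close>. This excludes slits, whose faces
  would have elements on both sides.\<close>

lemma lipschitz_boundary_exterior:
  fixes \<Omega> :: "(real^'d) set"
  assumes lip: "lipschitz_boundary \<Omega>" and op: "open \<Omega>" and x: "x \<in> frontier \<Omega>"
  shows "x \<notin> interior (closure \<Omega>)"
proof
  assume int: "x \<in> interior (closure \<Omega>)"
  obtain r n \<gamma> L where r: "r > 0" and n: "norm n = 1" and \<gamma>: "L-lipschitz_on {y. y \<bullet> n = 0} \<gamma>"
    and \<Omega>: "\<Omega> \<inter> ball x r = {z \<in> ball x r. \<gamma> ((z - x) - ((z - x) \<bullet> n) *\<^sub>R n) < (z - x) \<bullet> n}"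
    using lip x unfolding lipschitz_boundary_def by blast
  have nn: "n \<bullet> n = 1" using n by (simp add: norm_eq_1)
  have "x \<notin> \<Omega>" using x op by (simp add: frontier_def interior_open)
  have mem: "z \<in> \<Omega> \<longleftrightarrow> \<gamma> ((z - x) - ((z - x) \<bullet> n) *\<^sub>R n) < (z - x) \<bullet> n" if "z \<in> ball x r" for z
    using \<Omega> that by blast
  have \<gamma>0: "0 \<le> \<gamma> 0" using mem[of x] r \<open>x \<notin> \<Omega>\<close> by simp
  obtain s where s: "s > 0" "ball x s \<subseteq> closure \<Omega>" using int mem_interior by blast
  define t where "t = min r s / 2"
  have t: "0 < t" "t < r" "t < s" using r s by (auto simp: t_def)
  \<comment> \<open>Moving against \<open>n\<close> keeps the tangential part zero, so
    \<open>\<psi> y\<close> is \<open>\<gamma> 0 + t\<close>; and \<open>\<gamma> 0\<close> is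
    nonnegative because \<open>x\<close> is not in \<Omega>.\<close>
  define y where "y = x - t *\<^sub>R n"
  define \<psi> where "\<psi> z = \<gamma> ((z - x) - ((z - x) \<bullet> n) *\<^sub>R n) - (z - x) \<bullet> n" for z
  have "continuous_on UNIV (\<lambda>z. \<gamma> ((z - x) - ((z - x) \<bullet> n) *\<^sub>R n))"
    by (rule continuous_on_compose2[OF lipschitz_on_continuous_on[OF \<gamma>]])
      (auto intro!: continuous_intros simp: inner_diff_left nn)
  then have "continuous_on UNIV \<psi>" unfolding \<psi>_def by (intro continuous_intros)
  then have "open (ball x r \<inter> {z. 0 < \<psi> z})"
    by (intro open_Int open_ball open_Collect_less continuous_on_const)
  moreover have "(ball x r \<inter> {z. 0 < \<psi> z}) \<inter> \<Omega> = {}"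
    using mem by (force simp: \<psi>_def)
  ultimately have "(ball x r \<inter> {z. 0 < \<psi> z}) \<inter> closure \<Omega> = {}"
    by (simp add: open_Int_closure_eq_empty)
  moreover have "y \<in> ball x r" "0 < \<psi> y"
    using t \<gamma>0 n by (auto simp: y_def \<psi>_def dist_norm nn)
  moreover have "y \<in> closure \<Omega>"
    using s(2) t n by (auto simp: y_def dist_norm)
  ultimately show False by auto
qed

lemma negligible_aff_dim:
  fixes S :: "'a::euclidean_space set"
  assumes "aff_dim S < DIM('a)"
  shows "negligible S"
  using aff_lowdim_subset_hyperplane[OF assms] negligible_hyperplane negligible_subset by metis

section \<open>Elements, their common facets and normals\<close>

locale mesh =
  fixes \<Omega> :: "(real^'d) set" and \<T> :: "(real^'d) set set"
  assumes open_\<Omega>: "open \<Omega>" and connected_\<Omega>: "connected \<Omega>" and nonempty_\<Omega>: "\<Omega> \<noteq> {}"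
    and bounded_\<Omega>: "bounded \<Omega>" and lipschitz_\<Omega>: "lipschitz_boundary \<Omega>"
    and triangulation_of: "triangulation_of \<Omega> \<T>"
begin

lemma finite_mesh: "finite \<T>"
  and simplex: "T \<in> \<T> \<Longrightarrow> int CARD('d) simplex T"
  and Union_mesh: "\<Union>\<T> = closure \<Omega>"
  and Int_face_of: "T \<in> \<T> \<Longrightarrow> T' \<in> \<T> \<Longrightarrow> (T \<inter> T') face_of T"
  using triangulation_of by (auto simp: triangulation_of_def triangulation_def)

lemma compact_mesh: "T \<in> \<T> \<Longrightarrow> compact T"
  and convex_mesh: "T \<in> \<T> \<Longrightarrow> convex T"
  using simplex compact_simplex convex_simplex by blast+

lemma aff_dim_mesh: "T \<in> \<T> \<Longrightarrow> aff_dim T = int CARD('d)"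
  using simplex aff_dim_simplex by blast

lemma interior_nonempty: "T \<in> \<T> \<Longrightarrow> interior T \<noteq> {}"
  using interior_rel_interior[of T] aff_dim_mesh[of T] rel_interior_eq_empty[OF convex_mesh, of T]
  by auto

lemma closure_interior: "T \<in> \<T> \<Longrightarrow> closure (interior T) = T"
  using convex_closure_interior[OF convex_mesh interior_nonempty] compact_mesh
  by (simp add: compact_imp_closed)

text \<open>A proper face has strictly smaller dimension, whereas all elements have full dimension;
  so no element is a face of another one.\<close>

lemma Int_neq:
  assumes "T \<in> \<T>" "T' \<in> \<T>" "T \<noteq> T'"
  shows "T \<inter> T' \<noteq> T" "aff_dim (T \<inter> T') < int CARD('d)"
proof -
  show *: "T \<inter> T' \<noteq> T"
  proof
    assume eq: "T \<inter> T' = T"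
    then have "T face_of T'" using Int_face_of[OF assms(2,1)] by (simp add: Int_commute)
    then show False
      using face_of_aff_dim_lt[OF convex_mesh, of T' T] assms aff_dim_mesh by auto
  qed
  show "aff_dim (T \<inter> T') < int CARD('d)"
    using face_of_aff_dim_lt[OF convex_mesh Int_face_of *] assms aff_dim_mesh by auto
qed

lemma interior_disjoint:
  assumes "T \<in> \<T>" "T' \<in> \<T>" "T \<noteq> T'"
  shows "interior T \<inter> T' = {}"
  using face_of_disjoint_interior[OF Int_face_of Int_neq(1)] assms interior_subset[of T] by blast

lemma aff_dim_facet: "T \<in> \<T> \<Longrightarrow> e facet_of T \<Longrightarrow> aff_dim e = int CARD('d) - 1"
  by (simp add: facet_of_def aff_dim_mesh)

text \<open>Equal normals would put a common half ball at the centre of \<open>e\<close> into both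
  elements. Then \<open>e\<close>, of codimension one, would be a proper face of
  \<open>T \<inter> T'\<close>, which would have full dimension.\<close>

lemma outer_normal_opposite:
  assumes T: "T \<in> \<T>" "T' \<in> \<T>" "T \<noteq> T'" and e: "e facet_of T" "e facet_of T'"
  shows "outer_normal T' e = - outer_normal T e"
proof -
  let ?n = "outer_normal T e" and ?n' = "outer_normal T' e" and ?x = "barycenter e"
  obtain \<beta> r c where 1: "flat_face e ?n \<beta>" "?x \<in> e"
    and r: "0 < r" "\<forall>z\<in>ball ?x r. ?n \<bullet> z \<le> \<beta> \<longrightarrow> z \<in> T"
    and "0 < c" "\<forall>x\<in>e. ?n \<bullet> (x - barycenter T) = c"
    by (rule facet_of_simplex[OF simplex[OF T(1)] e(1)])
  obtain \<beta>' r' c' where 2: "flat_face e ?n' \<beta>'" and "?x \<in> e"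
    and r': "0 < r'" "\<forall>z\<in>ball ?x r'. ?n' \<bullet> z \<le> \<beta>' \<longrightarrow> z \<in> T'"
    and "0 < c'" "\<forall>x\<in>e. ?n' \<bullet> (x - barycenter T') = c'"
    by (rule facet_of_simplex[OF simplex[OF T(2)] e(2)])
  interpret f: flat_face e ?n \<beta> by fact
  interpret f': flat_face e ?n' \<beta>' by fact
  have "?n' = ?n \<or> ?n' = - ?n"
    using unit_normals_parallel[OF f.norm_n f'.norm_n, of \<beta> \<beta>'] f.affine_hull f'.affine_hull by simp
  moreover have False if eq: "?n' = ?n"
  proof -
    have \<beta>: "\<beta>' = \<beta>" using f.inner_n f'.inner_n 1(2) eq by metis
    define s where "s = min r r' / 2"
    define z where "z = ?x - s *\<^sub>R ?n"
    have s: "0 < s" "s < r" "s < r'" using r(1) r'(1) by (auto simp: s_def)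
    have nz: "?n \<bullet> z = \<beta> - s" by (simp add: z_def inner_diff_right f.inner_n[OF 1(2)] f.nn)
    have "z \<in> T" "z \<in> T'"
      using s nz f.norm_n by (auto intro!: r(2)[rule_format] r'(2)[rule_format] simp: eq \<beta> z_def dist_norm)
    moreover have "z \<notin> e" using f.inner_n nz s by fastforce
    ultimately have ne: "e \<noteq> T \<inter> T'" by auto
    have "e face_of (T \<inter> T')"
      by (rule face_of_subset[of e T]) (use e facet_of_imp_subset facet_of_imp_face_of in blast)+
    then have "aff_dim e < aff_dim (T \<inter> T')"
      using ne by (intro face_of_aff_dim_lt) (auto simp: convex_Int convex_mesh T)
    then show False using Int_neq(2)[OF T] aff_dim_facet[OF T(1) e(1)] by linarith
  qed
  ultimately show ?thesis by blast
qed

lemma norm_outer_normal: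
  assumes "T \<in> \<T>" "e facet_of T"
  shows "norm (outer_normal T e) = 1"
  by (rule facet_of_simplex[OF simplex[OF assms(1)] assms(2)]) (rule flat_face.norm_n)

text \<open>Three elements at one facet would have pairwise opposite unit normals, which is
  impossible.\<close>

lemma at_most_two_neighbours:
  assumes "T \<in> \<T>" "T' \<in> \<T>" "T'' \<in> \<T>" "e facet_of T" "e facet_of T'" "e facet_of T''"
    "T' \<noteq> T''"
  shows "T = T' \<or> T = T''"
proof (rule ccontr)
  assume "\<not> (T = T' \<or> T = T'')"
  then have "outer_normal T' e = - outer_normal T e" "outer_normal T'' e = - outer_normal T e"
    "outer_normal T'' e = - outer_normal T' e"
    using assms by (intro outer_normal_opposite; simp)+
  then have "outer_normal T e + outer_normal T e = 0" by simp
  then have "outer_normal T e = 0" by (metis scaleR_2 scaleR_eq_0_iff zero_neq_numeral)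
  then show False using norm_outer_normal[of T e] assms by simp
qed

text \<open>With opposite normals the half balls of two elements fill a ball around the centre of
  \<open>e\<close>. This ball lies in the closure of \<Omega>, against
  \<open>lipschitz_boundary_exterior\<close>.\<close>

lemma boundary_face_unique:
  assumes T: "T \<in> \<T>" "T' \<in> \<T>" and e: "e facet_of T" "e facet_of T'" and fr: "e \<subseteq> frontier \<Omega>"
  shows "T = T'"
proof (rule ccontr)
  let ?n = "outer_normal T e" and ?n' = "outer_normal T' e" and ?x = "barycenter e"
  assume ne: "T \<noteq> T'"
  obtain \<beta> r c where 1: "flat_face e ?n \<beta>" "?x \<in> e"
    and r: "0 < r" "\<forall>z\<in>ball ?x r. ?n \<bullet> z \<le> \<beta> \<longrightarrow> z \<in> T"
    and "0 < c" "\<forall>x\<in>e. ?n \<bullet> (x - barycenter T) = c"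
    by (rule facet_of_simplex[OF simplex[OF T(1)] e(1)])
  obtain \<beta>' r' c' where 2: "flat_face e ?n' \<beta>'" and "?x \<in> e"
    and r': "0 < r'" "\<forall>z\<in>ball ?x r'. ?n' \<bullet> z \<le> \<beta>' \<longrightarrow> z \<in> T'"
    and "0 < c'" "\<forall>x\<in>e. ?n' \<bullet> (x - barycenter T') = c'"
    by (rule facet_of_simplex[OF simplex[OF T(2)] e(2)])
  have opp: "?n' = - ?n" by (rule outer_normal_opposite) fact+
  have \<beta>: "\<beta>' = - \<beta>"
    using flat_face.inner_n[OF 1(1) 1(2)] flat_face.inner_n[OF 2 1(2)] opp by simp
  have "ball ?x (min r r') \<subseteq> closure \<Omega>"
  proof
    fix z assume z: "z \<in> ball ?x (min r r')"
    have "z \<in> T \<or> z \<in> T'"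
    proof (cases "?n \<bullet> z \<le> \<beta>")
      case True
      then show ?thesis using r(2) z by auto
    next
      case False
      then show ?thesis using r'(2)[rule_format, of z] z unfolding opp \<beta> by auto
    qed
    then show "z \<in> closure \<Omega>" using T Union_mesh by blast
  qed
  then have "?x \<in> interior (closure \<Omega>)" using r(1) r'(1) by (auto simp: mem_interior intro!: exI[of _ "min r r'"])
  then show False
    using lipschitz_boundary_exterior[OF lipschitz_\<Omega> open_\<Omega>, of ?x] fr 1(2) by blast
qed

text \<open>A generic segment from an element of \<open>\<A>\<close> to an element outside \<open>\<A>\<close> avoids all faces of
  codimension two, so it leaves \<open>\<Union>\<A>\<close> through a common facet.\<close>

lemma common_interior_face:
  assumes sub: "\<A> \<subseteq> \<T>" and ne: "\<A> \<noteq> {}" "\<A> \<noteq> \<T>"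
  obtains T T' e where "T \<in> \<A>" "T' \<in> \<T> - \<A>" "e \<in> interior_faces \<Omega> \<T>" "e facet_of T" "e facet_of T'"
proof -
  define \<B> where "\<B> = \<T> - \<A>"
  have fin: "finite \<A>" "finite \<B>" using sub finite_mesh finite_subset by (auto simp: \<B>_def)
  have \<B>: "\<B> \<subseteq> \<T>" "\<B> \<noteq> {}" using ne sub by (auto simp: \<B>_def)
  have closed: "closed (\<Union>\<A>)" "closed (\<Union>\<B>)"
    by (intro closed_Union fin ballI compact_imp_closed compact_mesh; use sub \<B> in blast)+
  have cover: "\<Omega> \<subseteq> \<Union>\<A> \<union> \<Union>\<B>"
  proof -
    have "\<Union>\<A> \<union> \<Union>\<B> = closure \<Omega>" using sub unfolding Union_mesh[symmetric] \<B>_def by blast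
    then show ?thesis using closure_subset by metis
  qed
  have meets: "T \<inter> \<Omega> \<noteq> {}" if "T \<in> \<T>" for T
  proof -
    have "interior T \<inter> closure \<Omega> \<noteq> {}"
      using interior_nonempty[OF that] interior_subset[of T] Union_mesh that by blast
    then have "interior T \<inter> \<Omega> \<noteq> {}" using open_Int_closure_eq_empty[of "interior T" \<Omega>] by auto
    then show ?thesis using interior_subset by blast
  qed
  have "\<Union>\<A> \<inter> \<Omega> \<noteq> {}" "\<Union>\<B> \<inter> \<Omega> \<noteq> {}"
    using meets ne(1) sub \<B> by blast+
  then have "\<Union>\<A> \<inter> \<Union>\<B> \<inter> \<Omega> \<noteq> {}"
    using connected_closedD[OF connected_\<Omega> _ cover closed] by blast
  then obtain z TA TB where z: "z \<in> \<Omega>" "TA \<in> \<A>" "z \<in> TA" "TB \<in> \<B>" "z \<in> TB" by blast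
  \<comment> \<open>As \<Omega> may fail to be convex, both ends of the segment are chosen in this
    ball, which keeps the segment inside \<Omega>. Connectedness supplied the point \<open>z\<close>
    where the two parts of the mesh meet.\<close>
  obtain r where r: "0 < r" "ball z r \<subseteq> \<Omega>" using open_\<Omega> z(1) open_contains_ball by blast
  have near: "interior T \<inter> ball z r \<noteq> {}" if "T \<in> \<T>" "z \<in> T" for T
  proof -
    have "z \<in> closure (interior T)" using that closure_interior by simp
    then show ?thesis
      using centre_in_ball[THEN iffD2, OF r(1), of z] open_Int_closure_eq_empty[OF open_ball, of z r "interior T"]
      by blast
  qed
  obtain x where x: "x \<in> interior TA" "x \<in> ball z r" using near[of TA] z sub by blast
  \<comment> \<open>The intersections too small to be facets. Adjoining \<open>x\<close> raises
    their dimension by at most one, so the affine hulls remain null sets and \<open>y\<close> can be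
    chosen off all of them.\<close>
  define \<F> where "\<F> = (\<lambda>(T, T'). T \<inter> T') ` (\<A> \<times> \<B>) \<inter> {F. aff_dim F < int CARD('d) - 1}"
  have "negligible (affine hull (insert x F))" if "F \<in> \<F>" for F
  proof (rule negligible_aff_dim)
    have "aff_dim (insert x F) \<le> aff_dim F + 1" by (simp add: aff_dim_insert)
    then show "aff_dim (affine hull (insert x F)) < int DIM(real^'d)"
      using that by (simp add: \<F>_def)
  qed
  moreover have "finite \<F>" using fin by (auto simp: \<F>_def)
  ultimately have "negligible (\<Union>F\<in>\<F>. affine hull (insert x F))"
    by (intro negligible_Union) auto
  moreover have "\<not> negligible (interior TB \<inter> ball z r)"
    using near[of TB] z \<B> by (intro open_not_negligible open_Int) auto
  ultimately have "\<not> interior TB \<inter> ball z r \<subseteq> (\<Union>F\<in>\<F>. affine hull (insert x F))"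
    using negligible_subset by blast
  then obtain y where y: "y \<in> interior TB" "y \<in> ball z r"
    and generic: "\<And>F. F \<in> \<F> \<Longrightarrow> y \<notin> affine hull (insert x F)"
    by blast
  define \<gamma> where "\<gamma> t = x + t *\<^sub>R (y - x)" for t
  have cont: "continuous_on S \<gamma>" for S unfolding \<gamma>_def by (intro continuous_intros)
  have \<gamma>_in: "\<gamma> t \<in> \<Omega>" if "t \<in> {0..1}" for t
  proof -
    have "\<gamma> t = (1 - t) *\<^sub>R x + t *\<^sub>R y" by (simp add: \<gamma>_def algebra_simps)
    then show ?thesis
      using convexD_alt[OF convex_ball x(2) y(2), of t] that r(2) by auto
  qed
  \<comment> \<open>The parameters at which the segment is in \<Union>\<A>. Points after the last
    such parameter \<open>s\<close> are in the closed set \<Union>\<B>, so \<open>\<gamma> s\<close>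
    belongs to both.\<close>
  define S where "S = {0..1} \<inter> \<gamma> -` (\<Union>\<A>)"
  have "compact S"
    unfolding S_def using continuous_closed_preimage[OF cont closed_atLeastAtMost closed(1)]
    by (simp add: compact_eq_bounded_closed bounded_Int)
  moreover have "0 \<in> S" using x(1) z(2) interior_subset by (auto simp: S_def \<gamma>_def)
  ultimately obtain s where s: "s \<in> S" "\<And>t. t \<in> S \<Longrightarrow> t \<le> s"
    using compact_attains_sup[of S] by blast
  have "\<gamma> 1 \<notin> \<Union>\<A>"
    using interior_disjoint[of TB] y(1) z(4) sub by (auto simp: \<gamma>_def \<B>_def)
  then have s01: "0 \<le> s" "s < 1" using s(1) by (auto simp: S_def less_le)
  have "\<gamma> s \<in> \<Union>\<B>"
  proof -
    have "\<gamma> t \<in> \<Union>\<B>" if "t \<in> {s<..<1}" for t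
    proof -
      have "t \<notin> S" using s(2)[of t] that by auto
      then show ?thesis using \<gamma>_in[of t] that cover s01 by (auto simp: S_def)
    qed
    moreover have "s \<in> closure {s<..<1}" using s01 by simp
    ultimately show ?thesis
      using image_closure_subset[OF cont closed(2), of "{s<..<1}"] by blast
  qed
  then obtain T T' where T: "T \<in> \<A>" "T' \<in> \<B>" "\<gamma> s \<in> T \<inter> T'" using s(1) by (auto simp: S_def)
  have TT': "T \<in> \<T>" "T' \<in> \<T>" "T \<noteq> T'" using T sub by (auto simp: \<B>_def)
  let ?e = "T \<inter> T'"
  have "s \<noteq> 0"
  proof
    have "TA \<in> \<T>" "TA \<noteq> T'" using z(2) sub T(2) by (auto simp: \<B>_def)
    moreover assume "s = 0"
    then have "x \<in> T'" using T(3) by (simp add: \<gamma>_def)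
    ultimately show False using interior_disjoint[of TA T'] TT'(2) x(1) by blast
  qed
  have "\<not> aff_dim ?e < int CARD('d) - 1"
  proof
    assume "aff_dim ?e < int CARD('d) - 1"
    then have "?e \<in> \<F>" using T by (auto simp: \<F>_def)
    \<comment> \<open>The line from \<open>x\<close> through \<open>\<gamma> s\<close> reaches
      \<open>y\<close>, so an intersection of too small dimension would contradict the choice of
      \<open>y\<close>.\<close>
    moreover have "y \<in> affine hull (insert x ?e)"
    proof -
      have "y = (1 - 1 / s) *\<^sub>R x + (1 / s) *\<^sub>R \<gamma> s"
        using \<open>s \<noteq> 0\<close> by (simp add: \<gamma>_def algebra_simps)
      then show ?thesis
        using mem_affine[OF affine_affine_hull, of x "insert x ?e" "\<gamma> s" "1 - 1 / s" "1 / s"] T(3)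
        by (simp add: hull_inc)
    qed
    ultimately show False using generic by blast
  qed
  then have dim: "aff_dim ?e = int CARD('d) - 1"
    using Int_neq(2)[OF TT'] by linarith
  have facet: "?e facet_of T" "?e facet_of T'"
    using T(3) dim TT' Int_face_of[OF TT'(1,2)] Int_face_of[OF TT'(2,1)]
    by (auto simp: facet_of_def aff_dim_mesh Int_commute)
  have "\<gamma> s \<in> \<Omega>" using \<gamma>_in s01 by auto
  then have "\<not> ?e \<subseteq> frontier \<Omega>"
    using T(3) open_\<Omega> by (auto simp: frontier_def interior_open)
  then have "?e \<in> interior_faces \<Omega> \<T>"
    using facet TT' by (auto simp: interior_faces_def boundary_faces_def faces_def)
  then show thesis using that[of T T' ?e] T facet by (auto simp: \<B>_def)
qed

end

section \<open>Linear algebra in function spaces\<close>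

definition linear_space :: "('a \<Rightarrow> 'b::real_vector) set \<Rightarrow> bool" where
  "linear_space X \<longleftrightarrow> (\<lambda>_. 0) \<in> X \<and> (\<forall>f\<in>X. \<forall>g\<in>X. \<forall>a b. (\<lambda>x. a *\<^sub>R f x + b *\<^sub>R g x) \<in> X)"

definition linear_form :: "('a \<Rightarrow> 'b::real_vector) set \<Rightarrow> (('a \<Rightarrow> 'b) \<Rightarrow> real) \<Rightarrow> bool" where
  "linear_form X l \<longleftrightarrow> (\<forall>f\<in>X. \<forall>g\<in>X. \<forall>a b. l (\<lambda>x. a *\<^sub>R f x + b *\<^sub>R g x) = a * l f + b * l g)"

lemma linear_spaceD:
  assumes "linear_space X"
  shows linear_space_zero: "(\<lambda>_. 0) \<in> X"
    and linear_space_comb: "f \<in> X \<Longrightarrow> g \<in> X \<Longrightarrow> (\<lambda>x. a *\<^sub>R f x + b *\<^sub>R g x) \<in> X"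
  using assms by (auto simp: linear_space_def)

lemma linear_formD:
  "linear_form X l \<Longrightarrow> f \<in> X \<Longrightarrow> g \<in> X \<Longrightarrow> l (\<lambda>x. a *\<^sub>R f x + b *\<^sub>R g x) = a * l f + b * l g"
  by (auto simp: linear_form_def)

lemma linear_form_zero:
  assumes "linear_space X" "linear_form X l"
  shows "l (\<lambda>_. 0) = 0"
  using linear_formD[OF assms(2) linear_space_zero linear_space_zero, OF assms(1,1), of 0 0] by simp

lemma linear_space_sum:
  assumes X: "linear_space X" and "finite I" "\<And>i. i \<in> I \<Longrightarrow> f i \<in> X"
  shows linear_space_sum_in: "(\<lambda>x. \<Sum>i\<in>I. c i *\<^sub>R f i x) \<in> X"
    and linear_form_sum: "linear_form X l \<Longrightarrow> l (\<lambda>x. \<Sum>i\<in>I. c i *\<^sub>R f i x) = (\<Sum>i\<in>I. c i * l (f i))"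
proof -
  have "(\<lambda>x. \<Sum>i\<in>I. c i *\<^sub>R f i x) \<in> X \<and>
      (linear_form X l \<longrightarrow> l (\<lambda>x. \<Sum>i\<in>I. c i *\<^sub>R f i x) = (\<Sum>i\<in>I. c i * l (f i)))"
    using assms(2,3)
  proof (induction I)
    case empty
    then show ?case using linear_space_zero[OF X] linear_form_zero[OF X] by simp
  next
    case (insert j I)
    then have IH: "(\<lambda>x. \<Sum>i\<in>I. c i *\<^sub>R f i x) \<in> X"
      "linear_form X l \<Longrightarrow> l (\<lambda>x. \<Sum>i\<in>I. c i *\<^sub>R f i x) = (\<Sum>i\<in>I. c i * l (f i))" by auto
    have j: "f j \<in> X" using insert by auto
    show ?case
      using linear_space_comb[OF X j IH(1), of "c j" 1] insert(1,2) IH(2)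
        linear_formD[OF _ j IH(1), of l "c j" 1]
      by simp
  qed
  then show "(\<lambda>x. \<Sum>i\<in>I. c i *\<^sub>R f i x) \<in> X"
    "linear_form X l \<Longrightarrow> l (\<lambda>x. \<Sum>i\<in>I. c i *\<^sub>R f i x) = (\<Sum>i\<in>I. c i * l (f i))" by auto
qed

lemma linear_space_kernel:
  assumes "linear_space X" "linear_form X l"
  shows "linear_space {f \<in> X. l f = 0}"
  using assms linear_form_zero[OF assms] by (auto simp: linear_space_def linear_form_def)

lemma linear_form_subset: "linear_form X l \<Longrightarrow> Y \<subseteq> X \<Longrightarrow> linear_form Y l"
  by (auto simp: linear_form_def)

text \<open>A nonzero form splits \<open>X\<close> into its kernel and the line spanned by a
  normalised \<open>h\<close>. The two inductions below remove one form at a time in this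
  way.\<close>

lemma linear_form_split:
  assumes X: "linear_space X" and l: "linear_form X l" and f: "f \<in> X" "l f \<noteq> 0"
  obtains h where "h \<in> X" "l h = 1"
    "\<And>g. g \<in> X \<Longrightarrow> (\<lambda>x. 1 *\<^sub>R g x + (- l g) *\<^sub>R h x) \<in> {f \<in> X. l f = 0}"
proof -
  define h where "h = (\<lambda>x. (1 / l f) *\<^sub>R f x + 0 *\<^sub>R f x)"
  have h: "h \<in> X" "l h = 1"
    using linear_space_comb[OF X f(1) f(1), of "1 / l f" 0] linear_formD[OF l f(1) f(1), of "1 / l f" 0] f(2)
    by (auto simp: h_def)
  moreover have "(\<lambda>x. 1 *\<^sub>R g x + (- l g) *\<^sub>R h x) \<in> {f \<in> X. l f = 0}" if g: "g \<in> X" for g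
    using linear_space_comb[OF X g h(1), of 1 "- l g"] linear_formD[OF l g h(1), of 1 "- l g"] h(2) by auto
  ultimately show thesis by (rule that)
qed

text \<open>Induction on \<open>I\<close> with \<open>X\<close> arbitrary: on the kernel of
  \<open>l j\<close> the form is a combination of the remaining ones, and its value at
  \<open>h\<close> then fixes the coefficient of \<open>l j\<close>.\<close>

lemma linear_form_in_span:
  assumes "finite I" "linear_space X" "\<And>i. i \<in> I \<Longrightarrow> linear_form X (l i)" "linear_form X F"
    and "\<And>f. f \<in> X \<Longrightarrow> (\<And>i. i \<in> I \<Longrightarrow> l i f = 0) \<Longrightarrow> F f = 0"
  obtains c where "\<And>f. f \<in> X \<Longrightarrow> F f = (\<Sum>i\<in>I. c i * l i f)"
proof -
  have "\<exists>c. \<forall>f\<in>X. F f = (\<Sum>i\<in>I. c i * l i f)"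
    using assms
  proof (induction I arbitrary: X)
    case empty
    then show ?case by simp
  next
    case (insert j I)
    note X = insert.prems(1)
    let ?K = "{f \<in> X. l j f = 0}"
    have lj: "linear_form X (l j)" and li: "i \<in> I \<Longrightarrow> linear_form X (l i)" for i
      using insert.prems(2) by auto
    have "\<exists>c. \<forall>f\<in>?K. F f = (\<Sum>i\<in>I. c i * l i f)"
    proof (rule insert.IH[OF linear_space_kernel[OF X lj]])
      show "i \<in> I \<Longrightarrow> linear_form ?K (l i)" for i
        by (rule linear_form_subset[OF li]) auto
      show "linear_form ?K F" by (rule linear_form_subset[OF insert.prems(3)]) auto
      show "F f = 0" if "f \<in> ?K" "\<And>i. i \<in> I \<Longrightarrow> l i f = 0" for f
        using that by (intro insert.prems(4)) auto
    qed
    then obtain c where c: "\<And>f. f \<in> ?K \<Longrightarrow> F f = (\<Sum>i\<in>I. c i * l i f)" by blast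
    show ?case
    proof (cases "\<exists>f\<in>X. l j f \<noteq> 0")
      case False
      then have "F f = (\<Sum>i\<in>insert j I. c i * l i f)" if "f \<in> X" for f
        using c[of f] that insert.hyps by simp
      then show ?thesis by blast
    next
      case True
      then obtain h where h: "h \<in> X" "l j h = 1"
        and split: "\<And>g. g \<in> X \<Longrightarrow> (\<lambda>x. 1 *\<^sub>R g x + (- l j g) *\<^sub>R h x) \<in> ?K"
        using linear_form_split[OF X lj] by blast
      define d where "d = F h - (\<Sum>i\<in>I. c i * l i h)"
      have "F f = (\<Sum>i\<in>insert j I. (c(j := d)) i * l i f)" if f: "f \<in> X" for f
      proof -
        have "F (\<lambda>x. 1 *\<^sub>R f x + (- l j f) *\<^sub>R h x) = F f - l j f * F h"
          by (subst linear_formD[OF insert.prems(3) f h(1)]) simp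
        moreover have "F (\<lambda>x. 1 *\<^sub>R f x + (- l j f) *\<^sub>R h x)
            = (\<Sum>i\<in>I. c i * (l i f - l j f * l i h))"
          unfolding c[OF split[OF f]]
          by (rule sum.cong) (simp_all only: linear_formD[OF li f h(1)], simp)
        ultimately have "F f = l j f * d + (\<Sum>i\<in>I. c i * l i f)"
          by (simp add: d_def right_diff_distrib sum_subtractf sum_distrib_left algebra_simps)
        moreover have "(\<Sum>i\<in>I. (c(j := d)) i * l i f) = (\<Sum>i\<in>I. c i * l i f)"
          using insert.hyps by (intro sum.cong) auto
        ultimately show ?thesis using insert.hyps by simp
      qed
      then show ?thesis by blast
    qed
  qed
  then show thesis using that by blast
qed

text \<open>A finite substitute for a basis: \<open>G\<close> spans \<open>X\<close> modulo the
  functions on which all forms in \<open>J\<close> vanish.\<close>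

lemma finite_generators:
  assumes "finite J" "linear_space X" "\<And>l. l \<in> J \<Longrightarrow> linear_form X l"
  obtains G where "finite G" "G \<subseteq> X" "\<And>f. f \<in> X \<Longrightarrow> \<exists>c. \<forall>l\<in>J. l f = (\<Sum>g\<in>G. c g * l g)"
proof -
  have "\<exists>G. finite G \<and> G \<subseteq> X \<and> (\<forall>f\<in>X. \<exists>c. \<forall>l\<in>J. l f = (\<Sum>g\<in>G. c g * l g))"
    using assms
  proof (induction J arbitrary: X)
    case empty
    then show ?case by auto
  next
    case (insert j J)
    note X = insert.prems(1)
    let ?K = "{f \<in> X. j f = 0}"
    have lj: "linear_form X j" and li: "l \<in> J \<Longrightarrow> linear_form X l" for l
      using insert.prems(2) by auto
    have "\<exists>G. finite G \<and> G \<subseteq> ?K \<and> (\<forall>f\<in>?K. \<exists>c. \<forall>l\<in>J. l f = (\<Sum>g\<in>G. c g * l g))"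
    proof (rule insert.IH[OF linear_space_kernel[OF X lj]])
      show "l \<in> J \<Longrightarrow> linear_form ?K l" for l
        by (rule linear_form_subset[OF li]) auto
    qed
    then obtain G where G: "finite G" "G \<subseteq> ?K"
      and gen: "\<And>f. f \<in> ?K \<Longrightarrow> \<exists>c. \<forall>l\<in>J. l f = (\<Sum>g\<in>G. c g * l g)" by blast
    have jG: "(\<Sum>g\<in>G. c g * j g) = 0" for c using G(2) by (intro sum.neutral) auto
    show ?case
    proof (cases "\<exists>f\<in>X. j f \<noteq> 0")
      case False
      then have "\<exists>c. \<forall>l\<in>insert j J. l f = (\<Sum>g\<in>G. c g * l g)" if "f \<in> X" for f
        using gen[of f] that jG by simp
      then show ?thesis using G by blast
    next
      case True
      then obtain h where h: "h \<in> X" "j h = 1"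
        and split: "\<And>g. g \<in> X \<Longrightarrow> (\<lambda>x. 1 *\<^sub>R g x + (- j g) *\<^sub>R h x) \<in> ?K"
        using linear_form_split[OF X lj] by blast
      have hG: "h \<notin> G" using G(2) h(2) by auto
      have "\<exists>c. \<forall>l\<in>insert j J. l f = (\<Sum>g\<in>insert h G. c g * l g)" if f: "f \<in> X" for f
      proof -
        obtain c where c: "\<And>l. l \<in> J \<Longrightarrow> l (\<lambda>x. 1 *\<^sub>R f x + (- j f) *\<^sub>R h x) = (\<Sum>g\<in>G. c g * l g)"
          using gen[OF split[OF f]] by blast
        have upd: "(\<Sum>g\<in>G. (c(h := j f)) g * l g) = (\<Sum>g\<in>G. c g * l g)" for l
          using hG by (intro sum.cong) auto
        have "l f = (\<Sum>g\<in>insert h G. (c(h := j f)) g * l g)" if "l \<in> insert j J" for l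
        proof (cases "l = j")
          case True
          then show ?thesis using G(1) hG upd[of j] jG[of c] h(2) by simp
        next
          case False
          then have lJ: "l \<in> J" using that by simp
          then have "l f - j f * l h = (\<Sum>g\<in>G. c g * l g)"
            using c[OF lJ] by (subst (asm) linear_formD[OF li[OF lJ] f h(1)]) auto
          then show ?thesis using G(1) hG upd[of l] by simp
        qed
        then show ?thesis by blast
      qed
      then show ?thesis using G h(1) by (intro exI[of _ "insert h G"]) auto
    qed
  qed
  then show thesis using that by blast
qed

text \<open>\<open>X\<close> may be infinite-dimensional, since piecewise polynomials have arbitrary values on the skeleton; the
  bilinear form only sees the values at the finitely many points \<open>P\<close>.\<close>

lemma bilinear_form_solvable:
  fixes X :: "('a \<Rightarrow> 'b::euclidean_space) set"
  assumes X: "linear_space X" and P: "finite P"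
    and B1: "\<And>y. y \<in> X \<Longrightarrow> linear_form X (\<lambda>x. B x y)"
    and B2: "\<And>x. x \<in> X \<Longrightarrow> linear_form X (B x)"
    and F: "linear_form X F"
    and null: "\<And>x y. x \<in> X \<Longrightarrow> y \<in> X \<Longrightarrow> (\<And>p. p \<in> P \<Longrightarrow> x p = 0) \<Longrightarrow> B x y = 0"
    and nondeg: "\<And>y. y \<in> X \<Longrightarrow> (\<And>x. x \<in> X \<Longrightarrow> B x y = 0) \<Longrightarrow> F y = 0"
  obtains x where "x \<in> X" "\<And>y. y \<in> X \<Longrightarrow> B x y = F y"
proof -
  define J where "J = (\<lambda>(p, b) f. f p \<bullet> b) ` (P \<times> (Basis :: 'b set))"
  have J: "finite J" using P by (simp add: J_def)
  have "linear_form X l" if "l \<in> J" for l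
    using that by (auto simp: J_def linear_form_def inner_add_left)
  then obtain G where G: "finite G" "G \<subseteq> X"
    and gen: "\<And>f. f \<in> X \<Longrightarrow> \<exists>c. \<forall>l\<in>J. l f = (\<Sum>g\<in>G. c g * l g)"
    using finite_generators[OF J X] by blast
  have GX: "g \<in> G \<Longrightarrow> g \<in> X" for g using G by auto
  \<comment> \<open>Testing against the finite set \<open>G\<close> is as good as testing against
    \<open>X\<close>: the combination \<open>s\<close> has the same values on \<open>P\<close> as
    \<open>x\<close>, and by \<open>null\<close> the difference does not count.\<close>
  have "F y = 0" if y: "y \<in> X" and 0: "\<And>g. g \<in> G \<Longrightarrow> B g y = 0" for y
  proof (rule nondeg[OF y])
    fix x assume x: "x \<in> X"
    obtain c where c: "\<And>l. l \<in> J \<Longrightarrow> l x = (\<Sum>g\<in>G. c g * l g)" using gen[OF x] by blast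
    define s where "s = (\<lambda>q. \<Sum>g\<in>G. c g *\<^sub>R g q)"
    have s: "s \<in> X" unfolding s_def by (rule linear_space_sum_in[OF X G(1) GX])
    have Bs: "B s y = 0"
      unfolding s_def using 0 by (subst linear_form_sum[OF X G(1) GX B1[OF y]]) auto
    have "1 *\<^sub>R x p + (- 1) *\<^sub>R s p = 0" if p: "p \<in> P" for p
    proof -
      have "x p \<bullet> b = s p \<bullet> b" if "b \<in> Basis" for b
      proof -
        have "(\<lambda>f. f p \<bullet> b) \<in> J" using p that by (force simp: J_def)
        then show ?thesis using c by (auto simp: s_def inner_sum_left)
      qed
      then have "x p = s p" by (rule euclidean_eqI)
      then show ?thesis by simp
    qed
    then have "B (\<lambda>p. 1 *\<^sub>R x p + (- 1) *\<^sub>R s p) y = 0"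
      by (intro null linear_space_comb[OF X] x s y)
    then show "B x y = 0"
      using Bs by (subst (asm) linear_formD[OF B1[OF y] x s]) simp
  qed
  \<comment> \<open>\<open>F\<close> vanishes on the common kernel of the forms \<open>B g\<close>,
    so it is a combination of them, and its coefficients are those of the solution.\<close>
  then obtain c where c: "\<And>y. y \<in> X \<Longrightarrow> F y = (\<Sum>g\<in>G. c g * B g y)"
    using linear_form_in_span[OF G(1) X _ F, of "\<lambda>g. B g"] B2 GX by blast
  show thesis
  proof (rule that)
    show "(\<lambda>q. \<Sum>g\<in>G. c g *\<^sub>R g q) \<in> X" by (rule linear_space_sum_in[OF X G(1) GX])
    fix y assume y: "y \<in> X"
    show "B (\<lambda>q. \<Sum>g\<in>G. c g *\<^sub>R g q) y = F y"
      unfolding c[OF y] by (subst linear_form_sum[OF X G(1) GX B1[OF y]]) auto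
  qed
qed

section \<open>Function spaces\<close>

lemma norm_comb_square_le:
  fixes x y :: "'a::real_inner"
  shows "(norm (a *\<^sub>R x + b *\<^sub>R y))\<^sup>2 \<le> 2 * a\<^sup>2 * (norm x)\<^sup>2 + 2 * b\<^sup>2 * (norm y)\<^sup>2"
proof -
  have "(norm (a *\<^sub>R x + b *\<^sub>R y))\<^sup>2 \<le> (\<bar>a\<bar> * norm x + \<bar>b\<bar> * norm y)\<^sup>2"
    using norm_triangle_ineq[of "a *\<^sub>R x" "b *\<^sub>R y"] by (intro power_mono) auto
  also have "\<dots> \<le> 2 * (\<bar>a\<bar> * norm x)\<^sup>2 + 2 * (\<bar>b\<bar> * norm y)\<^sup>2"
    using sum_squares_bound[of "\<bar>a\<bar> * norm x" "\<bar>b\<bar> * norm y"]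
    by (simp add: power2_sum)
  finally show ?thesis by (simp add: power_mult_distrib)
qed

lemma L2_comb:
  fixes f g :: "real^'d \<Rightarrow> 'b::euclidean_space"
  assumes "f \<in> L2 \<Omega>" "g \<in> L2 \<Omega>"
  shows L2_comb_in: "(\<lambda>x. a *\<^sub>R f x + b *\<^sub>R g x) \<in> L2 \<Omega>"
    and L2_comb_le: "(LINT x|lebesgue_on \<Omega>. (norm (a *\<^sub>R f x + b *\<^sub>R g x))\<^sup>2)
      \<le> 2 * a\<^sup>2 * (LINT x|lebesgue_on \<Omega>. (norm (f x))\<^sup>2) + 2 * b\<^sup>2 * (LINT x|lebesgue_on \<Omega>. (norm (g x))\<^sup>2)"
proof -
  have [measurable]: "f \<in> borel_measurable (lebesgue_on \<Omega>)" "g \<in> borel_measurable (lebesgue_on \<Omega>)"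
    and int: "integrable (lebesgue_on \<Omega>) (\<lambda>x. (norm (f x))\<^sup>2)" "integrable (lebesgue_on \<Omega>) (\<lambda>x. (norm (g x))\<^sup>2)"
    using assms by (auto simp: L2_def)
  let ?R = "\<lambda>x. 2 * a\<^sup>2 * (norm (f x))\<^sup>2 + 2 * b\<^sup>2 * (norm (g x))\<^sup>2"
  have R: "integrable (lebesgue_on \<Omega>) ?R" using int by auto
  have m: "(\<lambda>x. a *\<^sub>R f x + b *\<^sub>R g x) \<in> borel_measurable (lebesgue_on \<Omega>)" by measurable
  have L: "integrable (lebesgue_on \<Omega>) (\<lambda>x. (norm (a *\<^sub>R f x + b *\<^sub>R g x))\<^sup>2)"
  proof (rule Bochner_Integration.integrable_bound[OF R])
    show "(\<lambda>x. (norm (a *\<^sub>R f x + b *\<^sub>R g x))\<^sup>2) \<in> borel_measurable (lebesgue_on \<Omega>)" using m by measurable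
    show "AE x in lebesgue_on \<Omega>. norm ((norm (a *\<^sub>R f x + b *\<^sub>R g x))\<^sup>2) \<le> norm (?R x)"
      using norm_comb_square_le by (intro AE_I2) (auto intro: order_trans)
  qed
  show "(\<lambda>x. a *\<^sub>R f x + b *\<^sub>R g x) \<in> L2 \<Omega>" using m L by (simp add: L2_def)
  have "(LINT x|lebesgue_on \<Omega>. (norm (a *\<^sub>R f x + b *\<^sub>R g x))\<^sup>2) \<le> (LINT x|lebesgue_on \<Omega>. ?R x)"
    by (intro integral_mono L R norm_comb_square_le)
  also have "\<dots> = 2 * a\<^sup>2 * (LINT x|lebesgue_on \<Omega>. (norm (f x))\<^sup>2) + 2 * b\<^sup>2 * (LINT x|lebesgue_on \<Omega>. (norm (g x))\<^sup>2)"
    using int by simp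
  finally show "(LINT x|lebesgue_on \<Omega>. (norm (a *\<^sub>R f x + b *\<^sub>R g x))\<^sup>2) \<le> \<dots>" .
qed

lemma L2_integrable:
  fixes f :: "real^'d \<Rightarrow> 'b::euclidean_space"
  assumes "\<Omega> \<in> lmeasurable" "f \<in> L2 \<Omega>"
  shows "integrable (lebesgue_on \<Omega>) f"
proof -
  have m: "f \<in> borel_measurable (lebesgue_on \<Omega>)" and i: "integrable (lebesgue_on \<Omega>) (\<lambda>x. (norm (f x))\<^sup>2)"
    using assms by (auto simp: L2_def)
  have "integrable (lebesgue_on \<Omega>) (\<lambda>_. 1::real)"
    using assms(1) by (simp add: finite_measure.integrable_const finite_measure_lebesgue_on)
  then have R: "integrable (lebesgue_on \<Omega>) (\<lambda>x. 1 + (norm (f x))\<^sup>2)" using i by auto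
  show ?thesis
  proof (rule Bochner_Integration.integrable_bound[OF R m], rule AE_I2)
    fix x
    have "norm (f x) \<le> 1 + (norm (f x))\<^sup>2"
      using zero_le_power2[of "norm (f x) - 1"] by (simp add: power2_diff) (smt (verit) norm_ge_zero)
    then show "norm (f x) \<le> norm (1 + (norm (f x))\<^sup>2)" by simp
  qed
qed

lemma continuous_bounded_on:
  fixes \<phi> :: "real^'d \<Rightarrow> 'b::euclidean_space"
  assumes "bounded \<Omega>" "continuous_on UNIV \<phi>"
  obtains K where "\<And>x. x \<in> \<Omega> \<Longrightarrow> norm (\<phi> x) \<le> K"
proof -
  have "compact (\<phi> ` closure \<Omega>)"
    using assms by (intro compact_continuous_image) (auto intro: continuous_on_subset)
  then obtain K where "\<And>y. y \<in> \<phi> ` closure \<Omega> \<Longrightarrow> norm y \<le> K"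
    using compact_imp_bounded by (metis bounded_iff)
  then show thesis using that closure_subset by blast
qed

lemma integrable_times_continuous:
  fixes f :: "real^'d \<Rightarrow> real"
  assumes \<Omega>: "bounded \<Omega>" "open \<Omega>" and f: "f \<in> L2 \<Omega>" and \<phi>: "continuous_on UNIV \<phi>"
  shows "integrable (lebesgue_on \<Omega>) (\<lambda>x. f x * \<phi> x)"
proof -
  obtain K where K: "\<And>x. x \<in> \<Omega> \<Longrightarrow> norm (\<phi> x) \<le> K" using continuous_bounded_on[OF \<Omega>(1) \<phi>] by blast
  have [measurable]: "\<phi> \<in> borel_measurable (lebesgue_on \<Omega>)"
    using \<phi> \<Omega> by (intro continuous_imp_measurable_on_sets_lebesgue) (auto intro: continuous_on_subset)
  have [measurable]: "f \<in> borel_measurable (lebesgue_on \<Omega>)" using f by (simp add: L2_def)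
  have R: "integrable (lebesgue_on \<Omega>) (\<lambda>x. K * f x)"
    using L2_integrable[OF _ f] \<Omega> by (simp add: lmeasurable_open)
  show ?thesis
  proof (rule Bochner_Integration.integrable_bound[OF R])
    show "AE x in lebesgue_on \<Omega>. norm (f x * \<phi> x) \<le> norm (K * f x)"
    proof (rule AE_I2)
      fix x assume "x \<in> space (lebesgue_on \<Omega>)"
      then have "\<bar>\<phi> x\<bar> \<le> \<bar>K\<bar>" using K[of x] by simp
      then show "norm (f x * \<phi> x) \<le> norm (K * f x)"
        using mult_right_mono[of "\<bar>\<phi> x\<bar>" "\<bar>K\<bar>" "\<bar>f x\<bar>"] by (simp add: abs_mult mult.commute)
    qed
  qed measurable
qed

lemma continuous_in_L2:
  fixes \<phi> :: "real^'d \<Rightarrow> 'b::euclidean_space"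
  assumes \<Omega>: "bounded \<Omega>" "open \<Omega>" and \<phi>: "continuous_on UNIV \<phi>"
  shows "\<phi> \<in> L2 \<Omega>"
proof -
  obtain K where K: "\<And>x. x \<in> \<Omega> \<Longrightarrow> norm (\<phi> x) \<le> K" using continuous_bounded_on[OF \<Omega>(1) \<phi>] by blast
  have m[measurable]: "\<phi> \<in> borel_measurable (lebesgue_on \<Omega>)"
    using \<phi> \<Omega> by (intro continuous_imp_measurable_on_sets_lebesgue) (auto intro: continuous_on_subset)
  interpret finite_measure "lebesgue_on \<Omega>"
    using \<Omega> by (simp add: finite_measure_lebesgue_on lmeasurable_open)
  have "integrable (lebesgue_on \<Omega>) (\<lambda>x. (norm (\<phi> x))\<^sup>2)"
  proof (rule integrable_const_bound[of _ "K\<^sup>2"])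
    show "AE x in lebesgue_on \<Omega>. norm ((norm (\<phi> x))\<^sup>2) \<le> K\<^sup>2"
      using K by (intro AE_I2) (auto intro!: power_mono)
  qed measurable
  then show ?thesis using m by (simp add: L2_def)
qed

section \<open>Linearity of test functions, weak gradients and \<open>H1_0\<close>\<close>

lemma partial_deriv_comb:
  assumes "\<phi> differentiable at x" "\<psi> differentiable at x"
  shows "partial_deriv i (\<lambda>x. a * \<phi> x + b * \<psi> x) x = a * partial_deriv i \<phi> x + b * partial_deriv i \<psi> x"
proof -
  have "((\<lambda>x. a * \<phi> x + b * \<psi> x) has_derivative
      (\<lambda>h. a * frechet_derivative \<phi> (at x) h + b * frechet_derivative \<psi> (at x) h)) (at x)"
    using assms by (intro derivative_intros) (auto simp: frechet_derivative_works)
  from frechet_derivative_at[OF this] show ?thesis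
    by (simp add: partial_deriv_def fun_eq_iff)
qed

lemma times_differentiable_comb:
  "times_differentiable k \<phi> \<Longrightarrow> times_differentiable k \<psi> \<Longrightarrow>
    times_differentiable k (\<lambda>x. a * \<phi> x + b * \<psi> x)"
proof (induction k arbitrary: \<phi> \<psi>)
  case 0
  then show ?case by (auto intro!: continuous_intros)
next
  case (Suc k)
  have "partial_deriv i (\<lambda>x. a * \<phi> x + b * \<psi> x) = (\<lambda>x. a * partial_deriv i \<phi> x + b * partial_deriv i \<psi> x)" for i
    using Suc.prems by (intro ext partial_deriv_comb) auto
  then show ?case using Suc by (auto intro!: derivative_intros)
qed

lemma test_function_times_differentiable:
  "test_function \<Omega> \<phi> \<Longrightarrow> times_differentiable k \<phi>"
  by (simp add: test_function_def)

lemma test_function_differentiable: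
  assumes "test_function \<Omega> \<phi>"
  shows "\<phi> differentiable at x"
  using test_function_times_differentiable[OF assms, of "Suc 0"] by simp

lemma test_function_continuous:
  assumes "test_function \<Omega> \<phi>"
  shows "continuous_on UNIV \<phi>" "continuous_on UNIV (partial_deriv i \<phi>)"
  using test_function_times_differentiable[OF assms, of 0]
    test_function_times_differentiable[OF assms, of "Suc 0"] by auto

lemma gradient_continuous:
  assumes "test_function \<Omega> \<phi>"
  shows "continuous_on UNIV (gradient \<phi>)"
  unfolding gradient_def
  by (intro continuous_on_vec_lambda) (use test_function_continuous(2)[OF assms] in auto)

lemma test_function_comb:
  assumes "test_function \<Omega> \<phi>" "test_function \<Omega> \<psi>"
  shows "test_function \<Omega> (\<lambda>x. a * \<phi> x + b * \<psi> x)"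
proof -
  let ?S = "closure {x. \<phi> x \<noteq> 0} \<union> closure {x. \<psi> x \<noteq> 0}"
  have "{x. a * \<phi> x + b * \<psi> x \<noteq> 0} \<subseteq> ?S"
  proof
    fix x assume "x \<in> {x. a * \<phi> x + b * \<psi> x \<noteq> 0}"
    then have "x \<in> {x. \<phi> x \<noteq> 0} \<or> x \<in> {x. \<psi> x \<noteq> 0}" by auto
    then show "x \<in> ?S"
      by (elim disjE) (simp_all only: Un_iff closure_subset[THEN subsetD] simp_thms)
  qed
  then have sub: "closure {x. a * \<phi> x + b * \<psi> x \<noteq> 0} \<subseteq> ?S"
    by (intro closure_minimal) auto
  have S: "compact ?S" "?S \<subseteq> \<Omega>" using assms by (auto simp: test_function_def)
  have comp: "compact (closure {x. a * \<phi> x + b * \<psi> x \<noteq> 0})"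
    unfolding compact_eq_bounded_closed
    by (rule conjI[OF bounded_subset[OF compact_imp_bounded[OF S(1)] sub] closed_closure])
  have "times_differentiable k (\<lambda>x. a * \<phi> x + b * \<psi> x)" for k
    by (rule times_differentiable_comb; rule test_function_times_differentiable; fact)
  then show ?thesis
    unfolding test_function_def by (intro conjI allI comp order_trans[OF sub S(2)])
qed

lemma gradient_comb:
  assumes "test_function \<Omega> \<phi>" "test_function \<Omega> \<psi>"
  shows "gradient (\<lambda>x. a * \<phi> x + b * \<psi> x) x = a *\<^sub>R gradient \<phi> x + b *\<^sub>R gradient \<psi> x"
  using test_function_differentiable[OF assms(1)] test_function_differentiable[OF assms(2)]
  by (simp add: gradient_def vec_eq_iff partial_deriv_comb)

lemma test_function_zero: "test_function (\<Omega> :: (real^'d) set) (\<lambda>_. 0)"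
proof -
  have "partial_deriv i (\<lambda>_::real^'d. 0) = (\<lambda>_. 0)" for i
    by (auto simp: partial_deriv_def fun_eq_iff)
  then have "times_differentiable k (\<lambda>_::real^'d. 0)" for k
    by (induction k) auto
  then show ?thesis by (simp add: test_function_def)
qed

text \<open>Splitting the integrals requires integrability, which comes from \<open>L2\<close>: on a
  bounded open set a square integrable function times a continuous one is integrable.\<close>

lemma is_weak_gradient_comb:
  fixes \<Omega> :: "(real^'d) set"
  assumes \<Omega>: "bounded \<Omega>" "open \<Omega>"
    and "u \<in> L2 \<Omega>" "w \<in> L2 \<Omega>" "g \<in> L2 \<Omega>" "h \<in> L2 \<Omega>" "is_weak_gradient \<Omega> u g" "is_weak_gradient \<Omega> w h"
  shows "is_weak_gradient \<Omega> (\<lambda>x. a *\<^sub>R u x + b *\<^sub>R w x) (\<lambda>x. a *\<^sub>R g x + b *\<^sub>R h x)"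
  unfolding is_weak_gradient_def
proof (intro allI impI)
  fix \<phi> i assume \<phi>: "test_function \<Omega> \<phi>"
  note cont = test_function_continuous[OF \<phi>]
  have comp: "(\<lambda>x. k x $ i) \<in> L2 \<Omega>" if "k \<in> L2 \<Omega>" for k :: "real^'d \<Rightarrow> real^'d"
  proof -
    have m: "(\<lambda>x. k x $ i) \<in> borel_measurable (lebesgue_on \<Omega>)"
      and k: "integrable (lebesgue_on \<Omega>) (\<lambda>x. (norm (k x))\<^sup>2)"
      using that by (auto simp: L2_def cart_eq_inner_axis)
    have "integrable (lebesgue_on \<Omega>) (\<lambda>x. (norm (k x $ i))\<^sup>2)"
    proof (rule Bochner_Integration.integrable_bound[OF k])
      show "(\<lambda>x. (norm (k x $ i))\<^sup>2) \<in> borel_measurable (lebesgue_on \<Omega>)" using m by measurable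
      show "AE x in lebesgue_on \<Omega>. norm ((norm (k x $ i))\<^sup>2) \<le> norm ((norm (k x))\<^sup>2)"
      proof (rule AE_I2)
        fix x
        have "(norm (k x $ i))\<^sup>2 \<le> (norm (k x))\<^sup>2"
          unfolding real_norm_def by (rule power_mono[OF component_le_norm_cart]) simp
        then show "norm ((norm (k x $ i))\<^sup>2) \<le> norm ((norm (k x))\<^sup>2)"
          by (simp add: norm_power)
      qed
    qed
    then show ?thesis using m by (simp add: L2_def)
  qed
  note I = integrable_times_continuous[OF \<Omega>]
  have "(LINT x|lebesgue_on \<Omega>. (a *\<^sub>R u x + b *\<^sub>R w x) * partial_deriv i \<phi> x)
      = (LINT x|lebesgue_on \<Omega>. a * (u x * partial_deriv i \<phi> x) + b * (w x * partial_deriv i \<phi> x))"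
    by (simp add: algebra_simps)
  also have "\<dots> = a * (LINT x|lebesgue_on \<Omega>. u x * partial_deriv i \<phi> x)
      + b * (LINT x|lebesgue_on \<Omega>. w x * partial_deriv i \<phi> x)"
    using I[OF assms(3) cont(2)] I[OF assms(4) cont(2)] by simp
  also have "\<dots> = - (a * (LINT x|lebesgue_on \<Omega>. g x $ i * \<phi> x) + b * (LINT x|lebesgue_on \<Omega>. h x $ i * \<phi> x))"
    using assms(7,8) \<phi> by (simp add: is_weak_gradient_def)
  also have "\<dots> = - (LINT x|lebesgue_on \<Omega>. a * (g x $ i * \<phi> x) + b * (h x $ i * \<phi> x))"
    using I[OF comp[OF assms(5)] cont(1)] I[OF comp[OF assms(6)] cont(1)] by simp
  finally show "(LINT x|lebesgue_on \<Omega>. (a *\<^sub>R u x + b *\<^sub>R w x) * partial_deriv i \<phi> x)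
      = - (LINT x|lebesgue_on \<Omega>. (a *\<^sub>R g x + b *\<^sub>R h x) $ i * \<phi> x)"
    by (simp add: algebra_simps)
qed

lemma L2_convergence_comb:
  fixes \<phi> \<psi> :: "nat \<Rightarrow> real^'d \<Rightarrow> 'b::euclidean_space"
  assumes "\<And>n. \<phi> n \<in> L2 \<Omega>" "\<And>n. \<psi> n \<in> L2 \<Omega>" "u \<in> L2 \<Omega>" "w \<in> L2 \<Omega>"
    and \<phi>: "(\<lambda>n. LINT x|lebesgue_on \<Omega>. (norm (\<phi> n x - u x))\<^sup>2) \<longlonglongrightarrow> 0"
    and \<psi>: "(\<lambda>n. LINT x|lebesgue_on \<Omega>. (norm (\<psi> n x - w x))\<^sup>2) \<longlonglongrightarrow> 0"
  shows "(\<lambda>n. LINT x|lebesgue_on \<Omega>. (norm ((a *\<^sub>R \<phi> n x + b *\<^sub>R \<psi> n x) - (a *\<^sub>R u x + b *\<^sub>R w x)))\<^sup>2) \<longlonglongrightarrow> 0"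
proof (rule tendsto_sandwich[OF _ _ tendsto_const])
  let ?B = "\<lambda>n. 2 * a\<^sup>2 * (LINT x|lebesgue_on \<Omega>. (norm (\<phi> n x - u x))\<^sup>2)
      + 2 * b\<^sup>2 * (LINT x|lebesgue_on \<Omega>. (norm (\<psi> n x - w x))\<^sup>2)"
  show "?B \<longlonglongrightarrow> 0"
    using tendsto_add[OF tendsto_mult_left[OF \<phi>, of "2 * a\<^sup>2"] tendsto_mult_left[OF \<psi>, of "2 * b\<^sup>2"]] by simp
  have diff: "(\<lambda>x. \<phi> n x - u x) \<in> L2 \<Omega>" "(\<lambda>x. \<psi> n x - w x) \<in> L2 \<Omega>" for n
    using L2_comb_in[OF assms(1,3), where a = 1 and b = "-1"]
      L2_comb_in[OF assms(2,4), where a = 1 and b = "-1"] by auto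
  show "\<forall>\<^sub>F n in sequentially. (LINT x|lebesgue_on \<Omega>. (norm ((a *\<^sub>R \<phi> n x + b *\<^sub>R \<psi> n x) - (a *\<^sub>R u x + b *\<^sub>R w x)))\<^sup>2) \<le> ?B n"
  proof (rule always_eventually, rule allI)
    fix n
    have "(a *\<^sub>R \<phi> n x + b *\<^sub>R \<psi> n x) - (a *\<^sub>R u x + b *\<^sub>R w x)
        = a *\<^sub>R (\<phi> n x - u x) + b *\<^sub>R (\<psi> n x - w x)" for x
      by (simp add: algebra_simps)
    then show "(LINT x|lebesgue_on \<Omega>. (norm ((a *\<^sub>R \<phi> n x + b *\<^sub>R \<psi> n x) - (a *\<^sub>R u x + b *\<^sub>R w x)))\<^sup>2) \<le> ?B n"
      using L2_comb_le[OF diff, of a n b n] by simp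
  qed
qed simp

lemma H1_0_comb:
  assumes \<Omega>: "bounded \<Omega>" "open \<Omega>" and "u \<in> H1_0 \<Omega>" "w \<in> H1_0 \<Omega>"
  shows "(\<lambda>x. a *\<^sub>R u x + b *\<^sub>R w x) \<in> H1_0 \<Omega>"
proof -
  obtain g \<phi> where u: "u \<in> L2 \<Omega>" "g \<in> L2 \<Omega>" "is_weak_gradient \<Omega> u g" "\<And>n. test_function \<Omega> (\<phi> n)"
    "(\<lambda>n. LINT x|lebesgue_on \<Omega>. (norm (\<phi> n x - u x))\<^sup>2) \<longlonglongrightarrow> 0"
    "(\<lambda>n. LINT x|lebesgue_on \<Omega>. (norm (gradient (\<phi> n) x - g x))\<^sup>2) \<longlonglongrightarrow> 0"
    using assms(3) by (auto simp: H1_0_def)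
  obtain h \<psi> where w: "w \<in> L2 \<Omega>" "h \<in> L2 \<Omega>" "is_weak_gradient \<Omega> w h" "\<And>n. test_function \<Omega> (\<psi> n)"
    "(\<lambda>n. LINT x|lebesgue_on \<Omega>. (norm (\<psi> n x - w x))\<^sup>2) \<longlonglongrightarrow> 0"
    "(\<lambda>n. LINT x|lebesgue_on \<Omega>. (norm (gradient (\<psi> n) x - h x))\<^sup>2) \<longlonglongrightarrow> 0"
    using assms(4) by (auto simp: H1_0_def)
  note L2 = continuous_in_L2[OF \<Omega> test_function_continuous(1)] continuous_in_L2[OF \<Omega> gradient_continuous]
  have "(\<lambda>n. LINT x|lebesgue_on \<Omega>. (a * \<phi> n x + b * \<psi> n x - (a * u x + b * w x))\<^sup>2) \<longlonglongrightarrow> 0"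
    using L2_convergence_comb[OF L2(1)[OF u(4)] L2(1)[OF w(4)] u(1) w(1) u(5) w(5), of a b] by simp
  moreover have "(\<lambda>n. LINT x|lebesgue_on \<Omega>. (norm (gradient (\<lambda>x. a * \<phi> n x + b * \<psi> n x) x
      - (a *\<^sub>R g x + b *\<^sub>R h x)))\<^sup>2) \<longlonglongrightarrow> 0"
    using L2_convergence_comb[OF L2(2)[OF u(4)] L2(2)[OF w(4)] u(2) w(2) u(6) w(6), of a b]
    by (simp add: gradient_comb[OF u(4) w(4)])
  ultimately show ?thesis
    unfolding H1_0_def mem_Collect_eq
    using L2_comb_in[OF u(1) w(1)] L2_comb_in[OF u(2) w(2)]
      is_weak_gradient_comb[OF \<Omega> u(1) w(1) u(2) w(2) u(3) w(3), of a b] test_function_comb[OF u(4) w(4)]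
    by (intro conjI bexI[of _ "\<lambda>x. a *\<^sub>R g x + b *\<^sub>R h x"] exI[of _ "\<lambda>n x. a * \<phi> n x + b * \<psi> n x"]) auto
qed

lemma H1_0_zero: "(\<lambda>_. 0) \<in> H1_0 (\<Omega> :: (real^'d) set)"
proof -
  have "gradient (\<lambda>_. 0) x = 0" for x :: "real^'d"
    by (simp add: gradient_def partial_deriv_def vec_eq_iff)
  then show ?thesis
    unfolding H1_0_def
    by (intro CollectI conjI bexI[of _ "\<lambda>_. 0"] exI[of _ "\<lambda>_ _. 0"])
      (auto simp: L2_def is_weak_gradient_def test_function_zero)
qed

section \<open>The discrete spaces\<close>

lemma C_space_affine:
  "v \<in> C_space \<Omega> \<T> \<Longrightarrow> T \<in> \<T> \<Longrightarrow> \<exists>(A::real^'d^'d) b. \<forall>x\<in>interior T. v x = A *v x + b"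
  by (simp add: C_space_def)

lemma D_space_affine:
  "v \<in> D_space \<T> \<Longrightarrow> T \<in> \<T> \<Longrightarrow> \<exists>c. \<forall>x\<in>interior T. v x = c *\<^sub>R (x - barycenter T)"
  by (simp add: D_space_def)

lemma linear_space_C_space:
  assumes \<Omega>: "bounded \<Omega>" "open \<Omega>"
  shows "linear_space (C_space \<Omega> \<T>)"
  unfolding linear_space_def
proof (intro conjI ballI allI)
  show "(\<lambda>_. 0) \<in> C_space \<Omega> \<T>"
    using H1_0_zero by (auto simp: C_space_def intro!: exI[of _ 0])
  fix v w a b assume v: "v \<in> C_space \<Omega> \<T>" and w: "w \<in> C_space \<Omega> \<T>"
  have "\<exists>A c. \<forall>x\<in>interior T. a *\<^sub>R v x + b *\<^sub>R w x = A *v x + c" if "T \<in> \<T>" for T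
  proof -
    note T = that
    obtain A c A' c' where "\<forall>x\<in>interior T. v x = A *v x + c" "\<forall>x\<in>interior T. w x = A' *v x + c'"
      using C_space_affine[OF v T] C_space_affine[OF w T] by blast
    then show ?thesis
      by (intro exI[of _ "a *\<^sub>R A + b *\<^sub>R A'"] exI[of _ "a *\<^sub>R c + b *\<^sub>R c'"])
        (simp add: matrix_vector_mult_add_rdistrib scaleR_matrix_vector_assoc[symmetric] algebra_simps)
  qed
  then show "(\<lambda>x. a *\<^sub>R v x + b *\<^sub>R w x) \<in> C_space \<Omega> \<T>"
    using v w H1_0_comb[OF \<Omega>] by (auto simp: C_space_def)
qed

lemma linear_space_D_space: "linear_space (D_space \<T>)"
  unfolding linear_space_def
proof (intro conjI ballI allI)
  show "(\<lambda>_. 0) \<in> D_space \<T>" by (auto simp: D_space_def intro!: exI[of _ 0])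
  fix v w a b assume v: "v \<in> D_space \<T>" and w: "w \<in> D_space \<T>"
  have "\<exists>c. \<forall>x\<in>interior T. a *\<^sub>R v x + b *\<^sub>R w x = c *\<^sub>R (x - barycenter T)" if "T \<in> \<T>" for T
  proof -
    note T = that
    obtain c c' where "\<forall>x\<in>interior T. v x = c *\<^sub>R (x - barycenter T)"
        "\<forall>x\<in>interior T. w x = c' *\<^sub>R (x - barycenter T)"
      using D_space_affine[OF v T] D_space_affine[OF w T] by blast
    then show ?thesis
      by (intro exI[of _ "a * c + b * c'"]) (simp add: scaleR_add_left)
  qed
  then show "(\<lambda>x. a *\<^sub>R v x + b *\<^sub>R w x) \<in> D_space \<T>" by (simp add: D_space_def)
qed

lemma linear_space_V_space:
  assumes \<Omega>: "bounded \<Omega>" "open \<Omega>"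
  shows "linear_space (V_space \<Omega> \<T>)"
  unfolding linear_space_def
proof (intro conjI ballI allI)
  note C = linear_space_C_space[OF \<Omega>, of \<T>] and D = linear_space_D_space[of \<T>]
  show "(\<lambda>_. 0) \<in> V_space \<Omega> \<T>"
    using linear_space_zero[OF C] linear_space_zero[OF D] unfolding V_space_def by force
  fix v w a b assume "v \<in> V_space \<Omega> \<T>" "w \<in> V_space \<Omega> \<T>"
  then obtain vC vD wC wD where C_in: "vC \<in> C_space \<Omega> \<T>" "wC \<in> C_space \<Omega> \<T>"
    and D_in: "vD \<in> D_space \<T>" "wD \<in> D_space \<T>"
    and vw: "v = (\<lambda>x. vC x + vD x)" "w = (\<lambda>x. wC x + wD x)"
    by (auto simp: V_space_def)
  show "(\<lambda>x. a *\<^sub>R v x + b *\<^sub>R w x) \<in> V_space \<Omega> \<T>"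
    unfolding V_space_def mem_Collect_eq vw
    by (rule bexI[OF bexI[OF _ linear_space_comb[OF D D_in, of a b]] linear_space_comb[OF C C_in, of a b]])
      (simp add: fun_eq_iff algebra_simps)
qed

lemma V_space_affine:
  assumes "v \<in> V_space \<Omega> \<T>" "T \<in> \<T>"
  obtains A :: "real^'d^'d" and b where "\<And>x. x \<in> interior T \<Longrightarrow> v x = A *v x + b"
proof -
  obtain vC vD where vCD: "vC \<in> C_space \<Omega> \<T>" "vD \<in> D_space \<T>" and v: "v = (\<lambda>x. vC x + vD x)"
    using assms(1) by (auto simp: V_space_def)
  obtain A :: "real^'d^'d" and b c where *: "\<forall>x\<in>interior T. vC x = A *v x + b"
    "\<forall>x\<in>interior T. vD x = c *\<^sub>R (x - barycenter T)"
    using C_space_affine[OF vCD(1) assms(2)] D_space_affine[OF vCD(2) assms(2)] by blast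
  show thesis
    by (rule that[of "A + c *\<^sub>R mat 1" "b - c *\<^sub>R barycenter T"])
      (use * in \<open>simp add: v matrix_vector_mult_add_rdistrib scaleR_matrix_vector_assoc[symmetric] algebra_simps\<close>)
qed

lemma D_space_subset_V_space:
  assumes "bounded \<Omega>" "open \<Omega>" "v \<in> D_space \<T>"
  shows "v \<in> V_space \<Omega> \<T>"
  unfolding V_space_def mem_Collect_eq
  by (rule bexI[OF bexI[OF _ assms(3)] linear_space_zero[OF linear_space_C_space[OF assms(1,2)]]]) simp

lemma Q_space_const:
  "q \<in> Q_space \<Omega> \<T> \<Longrightarrow> T \<in> \<T> \<Longrightarrow> \<exists>c. \<forall>x\<in>interior T. q x = c"
  by (simp add: Q_space_def)

lemma linear_space_Q_space:
  assumes \<Omega>: "bounded \<Omega>" "open \<Omega>"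
  shows "linear_space (Q_space \<Omega> \<T>)"
  unfolding linear_space_def
proof (intro conjI ballI allI)
  show "(\<lambda>_. 0) \<in> Q_space \<Omega> \<T>" by (auto simp: Q_space_def L2_zero_mean_def L2_def)
  fix p q a b assume pq: "p \<in> Q_space \<Omega> \<T>" "q \<in> Q_space \<Omega> \<T>"
  then have L2: "p \<in> L2 \<Omega>" "q \<in> L2 \<Omega>"
    and zero: "(LINT x|lebesgue_on \<Omega>. p x) = 0" "(LINT x|lebesgue_on \<Omega>. q x) = 0"
    by (auto simp: Q_space_def L2_zero_mean_def)
  have "\<Omega> \<in> lmeasurable" using \<Omega> by (simp add: lmeasurable_open)
  from L2_integrable[OF this L2(1)] L2_integrable[OF this L2(2)]
  have "(LINT x|lebesgue_on \<Omega>. a *\<^sub>R p x + b *\<^sub>R q x) = 0" using zero by simp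
  moreover have "\<exists>c. \<forall>x\<in>interior T. a *\<^sub>R p x + b *\<^sub>R q x = c" if T: "T \<in> \<T>" for T
  proof -
    obtain c c' where "\<forall>x\<in>interior T. p x = c" "\<forall>x\<in>interior T. q x = c'"
      using Q_space_const[OF pq(1) T] Q_space_const[OF pq(2) T] by blast
    then show ?thesis by auto
  qed
  ultimately show "(\<lambda>x. a *\<^sub>R p x + b *\<^sub>R q x) \<in> Q_space \<Omega> \<T>"
    using L2_comb_in[OF L2] by (simp add: Q_space_def L2_zero_mean_def)
qed

section \<open>Weak derivatives and the bilinear forms\<close>

text \<open>Serves to discard the arbitrary values on element boundaries. Measurability of
  \<open>g\<close> is part of the conclusion, by completeness of Lebesgue measure.\<close>

lemma lebesgue_on_spike:
  fixes f g :: "'a::euclidean_space \<Rightarrow> real"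
  assumes S: "S \<in> sets lebesgue" and N: "negligible N"
    and f: "integrable (lebesgue_on S) f" and eq: "\<And>x. x \<in> S - N \<Longrightarrow> g x = f x"
  shows integrable_lebesgue_on_spike: "integrable (lebesgue_on S) g"
    and integral_lebesgue_on_spike: "(LINT x|lebesgue_on S. g x) = (LINT x|lebesgue_on S. f x)"
proof -
  have "f absolutely_integrable_on S"
    using f S by (simp add: integrable_restrict_space set_integrable_def)
  then have "g absolutely_integrable_on S"
    by (rule absolutely_integrable_spike[OF _ N]) (use eq in auto)
  then show g: "integrable (lebesgue_on S) g"
    using S by (simp add: integrable_restrict_space set_integrable_def)
  have "AE x in lebesgue_on S. g x = f x"
  proof (rule AE_I')
    have "N \<inter> S \<in> null_sets lebesgue"
      using N negligible_subset[OF N, of "N \<inter> S"] negligible_iff_null_sets by auto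
    then show "N \<inter> S \<in> null_sets (lebesgue_on S)"
      using S by (subst null_sets_restrict_space) auto
    show "{x \<in> space (lebesgue_on S). g x \<noteq> f x} \<subseteq> N \<inter> S" using eq by auto
  qed
  then show "(LINT x|lebesgue_on S. g x) = (LINT x|lebesgue_on S. f x)"
    using f g by (intro integral_cong_AE) auto
qed

text \<open>Riesz representation on a space of constants. It shows that the definite description in
  \<open>weak_grad\<close> denotes, with \<open>m\<close> the volume of the element.\<close>

lemma the_riesz_representer:
  fixes R :: "'a::euclidean_space \<Rightarrow> real"
  assumes "linear R" "m \<noteq> 0"
  shows "m * ((THE G. \<forall>N. m * (G \<bullet> N) = R N) \<bullet> N) = R N"
proof -
  define G where "G = (\<Sum>b\<in>Basis. (R b / m) *\<^sub>R b)"
  have G: "m * (G \<bullet> N) = R N" for N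
  proof -
    have "R N = R (\<Sum>b\<in>Basis. (N \<bullet> b) *\<^sub>R b)" by (simp add: euclidean_representation)
    also have "\<dots> = (\<Sum>b\<in>Basis. (N \<bullet> b) * R b)"
      by (simp add: linear_sum[OF assms(1)] linear_scale[OF assms(1)])
    also have "\<dots> = (\<Sum>b\<in>Basis. m * (R b / m * (b \<bullet> N)))"
      using assms(2) by (intro sum.cong) (auto simp: inner_commute)
    also have "\<dots> = m * (G \<bullet> N)"
      by (simp add: G_def inner_sum_left sum_distrib_left)
    finally show ?thesis ..
  qed
  have "(THE G. \<forall>N. m * (G \<bullet> N) = R N) = G"
  proof (rule the_equality)
    fix H assume "\<forall>N. m * (H \<bullet> N) = R N"
    then have "\<forall>N. H \<bullet> N = G \<bullet> N" using G assms(2) by (metis mult_left_cancel)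
    then show "H = G" by (rule vector_eq_rdot[THEN iffD1])
  qed (use G in simp)
  then show ?thesis using G by simp
qed

text \<open>A point \<open>a\<close> of the open set together with small steps from it along the
  axes: the value at \<open>a\<close> and the differences fix the constant and the columns of the
  matrix.\<close>

lemma affine_determining_points:
  fixes U :: "(real^'d) set"
  assumes "open U" "U \<noteq> {}"
  shows "\<exists>P. finite P \<and> P \<subseteq> U \<and> P \<noteq> {} \<and>
    (\<forall>(A::real^'d^'e) b. (\<forall>x\<in>P. A *v x + b = 0) \<longrightarrow> (\<forall>x. A *v x + b = 0))"
proof -
  obtain a r where r: "0 < r" "ball a r \<subseteq> U" using assms open_contains_ball by (metis ex_in_conv)
  define P where "P = insert a (range (\<lambda>i. a + (r / 2) *\<^sub>R axis i 1))"
  show ?thesis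
  proof (intro exI[of _ P] conjI allI impI)
    show "finite P" "P \<noteq> {}" by (auto simp: P_def)
    have "P \<subseteq> ball a r" using r(1) by (auto simp: P_def dist_norm)
    then show "P \<subseteq> U" using r(2) by simp
    fix A :: "real^'d^'e" and b x
    assume "\<forall>x\<in>P. A *v x + b = 0"
    then have 0: "A *v x + b = 0" if "x \<in> P" for x using that by blast
    have a: "A *v a + b = 0" using 0 by (simp add: P_def)
    have "column i A = 0" for i
    proof -
      have "A *v (a + (r / 2) *\<^sub>R axis i 1) + b = 0" by (rule 0) (unfold P_def, blast)
      then have "(A *v a + b) + (r / 2) *\<^sub>R (A *v axis i 1) = 0"
        by (simp add: matrix_vector_right_distrib matrix_vector_mult_scaleR add_ac)
      then have "(r / 2) *\<^sub>R (A *v axis i 1) = 0" unfolding a by simp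
      then show ?thesis using r(1) by (simp add: matrix_vector_mult_basis)
    qed
    then have "A = 0" by (simp add: vec_eq_iff column_def)
    then show "A *v x + b = 0" using a by simp
  qed
qed

section \<open>Integration over the elements of the mesh\<close>

context mesh
begin

lemma closed_mesh: "T \<in> \<T> \<Longrightarrow> closed T"
  using compact_mesh compact_imp_closed by blast

lemma sets_mesh: "T \<in> \<T> \<Longrightarrow> T \<in> sets lebesgue"
  using closed_mesh by auto

lemma lmeasurable_mesh: "T \<in> \<T> \<Longrightarrow> T \<in> lmeasurable"
  using compact_mesh lmeasurable_compact by blast

lemma negligible_frontier_mesh: "T \<in> \<T> \<Longrightarrow> negligible (frontier T)"
  using convex_mesh negligible_convex_frontier by blast

lemma measure_mesh_pos:
  assumes "T \<in> \<T>"
  shows "0 < measure lebesgue T"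
proof -
  have "\<not> negligible T"
    using open_not_negligible[OF open_interior interior_nonempty[OF assms]] negligible_subset interior_subset
    by blast
  then show ?thesis
    using negligible_iff_measure0[OF lmeasurable_mesh[OF assms]] by (simp add: zero_less_measure_iff)
qed

lemma integral_mesh_const:
  assumes T: "T \<in> \<T>" and c: "\<And>x. x \<in> interior T \<Longrightarrow> h x = (c::real)"
  shows "(LINT x|lebesgue_on T. h x) = measure lebesgue T * c"
proof -
  interpret finite_measure "lebesgue_on T"
    using lmeasurable_mesh[OF T] by (simp add: finite_measure_lebesgue_on)
  have "(LINT x|lebesgue_on T. h x) = (LINT x|lebesgue_on T. c)"
  proof (rule integral_lebesgue_on_spike[OF sets_mesh[OF T] negligible_frontier_mesh[OF T]])
    show "x \<in> T - frontier T \<Longrightarrow> h x = c" for x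
      using c closed_mesh[OF T] by (simp add: frontier_def)
  qed (rule integrable_const)
  then show ?thesis using sets_mesh[OF T] by (simp add: measure_restrict_space)
qed

definition skeleton :: "(real^'d) set" where
  "skeleton = (\<Union>T\<in>\<T>. frontier T)"

lemma negligible_skeleton: "negligible skeleton"
  unfolding skeleton_def using finite_mesh negligible_frontier_mesh by (intro negligible_Union) auto

lemma in_some_interior:
  assumes "x \<in> \<Omega>" "x \<notin> skeleton"
  obtains T where "T \<in> \<T>" "x \<in> interior T"
proof -
  obtain T where "T \<in> \<T>" "x \<in> T" using assms(1) Union_mesh closure_subset by blast
  then show thesis using that assms(2) closed_mesh by (auto simp: skeleton_def frontier_def)
qed

lemma AE_mesh:
  assumes "\<And>T x. T \<in> \<T> \<Longrightarrow> x \<in> interior T \<Longrightarrow> P x"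
  shows "AE x in lebesgue_on \<Omega>. P x"
proof (rule AE_I')
  have "skeleton \<inter> \<Omega> \<in> null_sets lebesgue"
    using negligible_subset[OF negligible_skeleton, of "skeleton \<inter> \<Omega>"] negligible_iff_null_sets by auto
  then show "skeleton \<inter> \<Omega> \<in> null_sets (lebesgue_on \<Omega>)"
    using open_\<Omega> by (subst null_sets_restrict_space) auto
  show "{x \<in> space (lebesgue_on \<Omega>). \<not> P x} \<subseteq> skeleton \<inter> \<Omega>"
  proof
    fix x assume "x \<in> {x \<in> space (lebesgue_on \<Omega>). \<not> P x}"
    then have x: "x \<in> \<Omega>" "\<not> P x" by auto
    have "x \<in> skeleton"
    proof (rule ccontr)
      assume "x \<notin> skeleton"
      then obtain T where "T \<in> \<T>" "x \<in> interior T" using in_some_interior[OF x(1)] by blast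
      then show False using assms x(2) by blast
    qed
    then show "x \<in> skeleton \<inter> \<Omega>" using x(1) by blast
  qed
qed

text \<open>Off the skeleton \<open>v\<close> equals the finite sum \<open>g\<close> of measurable
  pieces that are bounded on \<Omega>, and \<open>f\<close> is integrable because \<Omega> has
  finite measure.\<close>

lemma integrable_L2_inner_piecewise_affine:
  fixes f v :: "real^'d \<Rightarrow> real^'d"
  assumes f: "f \<in> L2 \<Omega>"
    and v: "\<And>T. T \<in> \<T> \<Longrightarrow> \<exists>(A::real^'d^'d) b. \<forall>x\<in>interior T. v x = A *v x + b"
  shows "integrable (lebesgue_on \<Omega>) (\<lambda>x. f x \<bullet> v x)"
proof -
  obtain A :: "(real^'d) set \<Rightarrow> real^'d^'d" and b
    where Ab: "\<And>T x. T \<in> \<T> \<Longrightarrow> x \<in> interior T \<Longrightarrow> v x = A T *v x + b T"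
    using v by metis
  define \<phi> where "\<phi> T x = indicat_real (interior T) x *\<^sub>R (A T *v x + b T)" for T x
  define g where "g x = (\<Sum>T\<in>\<T>. \<phi> T x)" for x
  have \<Omega>: "\<Omega> \<in> lmeasurable" using open_\<Omega> bounded_\<Omega> by (simp add: lmeasurable_open)
  have cont: "continuous_on UNIV (\<lambda>x. A T *v x + b T)" for T
    by (intro continuous_intros matrix_vector_mult_linear_continuous_on)
  have fg: "integrable (lebesgue_on \<Omega>) (\<lambda>x. f x \<bullet> g x)"
  proof -
    have "integrable (lebesgue_on \<Omega>) (\<lambda>x. f x \<bullet> \<phi> T x)" for T
    proof -
      obtain K where K: "\<And>x. x \<in> \<Omega> \<Longrightarrow> norm (A T *v x + b T) \<le> K"
        using continuous_bounded_on[OF bounded_\<Omega> cont] by blast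
      have [measurable]: "(\<lambda>x. A T *v x + b T) \<in> borel_measurable borel"
        by (rule borel_measurable_continuous_onI[OF cont])
      have [measurable]: "f \<in> borel_measurable (lebesgue_on \<Omega>)" using f by (simp add: L2_def)
      have m: "\<phi> T \<in> borel_measurable borel"
        unfolding \<phi>_def by measurable
      have [measurable]: "\<phi> T \<in> borel_measurable (lebesgue_on \<Omega>)"
        using m by (intro measurable_restrict_space1) (auto intro: measurable_completion)
      have R: "integrable (lebesgue_on \<Omega>) (\<lambda>x. K *\<^sub>R f x)"
        using L2_integrable[OF \<Omega> f] by simp
      show ?thesis
      proof (rule Bochner_Integration.integrable_bound[OF R])
        show "AE x in lebesgue_on \<Omega>. norm (f x \<bullet> \<phi> T x) \<le> norm (K *\<^sub>R f x)"
        proof (rule AE_I2)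
          fix x assume "x \<in> space (lebesgue_on \<Omega>)"
          then have "norm (\<phi> T x) \<le> \<bar>K\<bar>"
            using K[of x] by (auto simp: \<phi>_def indicator_def)
          then have "norm (f x) * norm (\<phi> T x) \<le> norm (f x) * \<bar>K\<bar>"
            by (intro mult_left_mono) auto
          then show "norm (f x \<bullet> \<phi> T x) \<le> norm (K *\<^sub>R f x)"
            using Cauchy_Schwarz_ineq2[of "f x" "\<phi> T x"]
            unfolding norm_scaleR real_norm_def by (simp only: mult.commute)
        qed
      qed measurable
    qed
    then show ?thesis unfolding g_def inner_sum_right by (intro Bochner_Integration.integrable_sum)
  qed
  have eq: "f x \<bullet> v x = f x \<bullet> g x" if x: "x \<in> \<Omega> - skeleton" for x
  proof -
    obtain T where T: "T \<in> \<T>" "x \<in> interior T" using in_some_interior[of x] x by auto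
    have "x \<notin> interior T'" if T': "T' \<in> \<T> - {T}" for T'
      using interior_disjoint[of T' T] T T' subsetD[OF interior_subset T(2)] by auto
    then have "g x = (\<Sum>T'\<in>\<T>. if T' = T then A T *v x + b T else 0)"
      unfolding g_def \<phi>_def using T by (intro sum.cong) (auto simp: indicator_def)
    then show ?thesis using T Ab finite_mesh by simp
  qed
  have "\<Omega> \<in> sets lebesgue" using open_\<Omega> by auto
  then show ?thesis by (rule integrable_lebesgue_on_spike[OF _ negligible_skeleton fg eq])
qed

lemma islimpt_interior: "T \<in> \<T> \<Longrightarrow> x \<in> T \<Longrightarrow> x islimpt interior T"
  using closure_interior[of T] interior_limit_point[of x "interior T"]
  by (metis closure_def UnE interior_interior mem_Collect_eq)

lemma side_trace_eq:
  assumes T: "T \<in> \<T>" "x \<in> T" and v: "\<And>y. y \<in> interior T \<Longrightarrow> v y = g y" and g: "continuous_on UNIV g"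
  shows "side_trace T v x = g x"
  unfolding side_trace_def
proof (rule tendsto_Lim)
  show "\<not> trivial_limit (at x within interior T)"
    using islimpt_interior[OF T] by (simp add: trivial_limit_within)
  have "(g \<longlongrightarrow> g x) (at x within interior T)"
    using g by (metis UNIV_I continuous_on_def subset_UNIV tendsto_within_subset)
  then show "(v \<longlongrightarrow> g x) (at x within interior T)"
    by (rule Lim_transform_eventually) (simp add: eventually_at_filter v)
qed

lemma finite_faces: "finite (faces \<T>)"
proof -
  have "finite {e. e facet_of T}" if "T \<in> \<T>" for T
    using simplex_imp_polytope[OF simplex[OF that]] by (rule finite_polytope_facets)
  moreover have "faces \<T> = (\<Union>T\<in>\<T>. {e. e facet_of T})" by (auto simp: faces_def)
  ultimately show ?thesis using finite_mesh by simp
qed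

lemma facets_subset_faces: "T \<in> \<T> \<Longrightarrow> {e. e facet_of T} = {e \<in> faces \<T>. e facet_of T}"
  by (auto simp: faces_def)

text \<open>Regroups boundary sums of elements by faces, where the contributions from both sides can
  be compared.\<close>

lemma sum_facets_swap:
  fixes h :: "(real^'d) set \<Rightarrow> (real^'d) set \<Rightarrow> real"
  shows "(\<Sum>T\<in>\<T>. \<Sum>e | e facet_of T. h T e) = (\<Sum>e\<in>faces \<T>. \<Sum>T | T \<in> \<T> \<and> e facet_of T. h T e)"
proof -
  have "(\<Sum>T\<in>\<T>. \<Sum>e | e facet_of T. h T e) = (\<Sum>T\<in>\<T>. \<Sum>e | e \<in> faces \<T> \<and> e facet_of T. h T e)"
    by (intro sum.cong refl) (simp add: facets_subset_faces)
  also have "\<dots> = (\<Sum>e\<in>faces \<T>. \<Sum>T | T \<in> \<T> \<and> e facet_of T. h T e)"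
    by (rule sum.swap_restrict[OF finite_mesh finite_faces])
  finally show ?thesis .
qed

lemma face_flat:
  assumes "e \<in> faces \<T>"
  obtains n \<beta> where "flat_face e n \<beta>"
proof -
  obtain T where T: "T \<in> \<T>" "e facet_of T" using assms by (auto simp: faces_def)
  show thesis by (rule facet_of_simplex[OF simplex[OF T(1)] T(2)], rule that)
qed

lemma face_convex: "e \<in> faces \<T> \<Longrightarrow> convex e"
  and face_nonempty: "e \<in> faces \<T> \<Longrightarrow> e \<noteq> {}"
  by (auto simp: faces_def facet_of_def dest: face_of_imp_convex)

lemma simplex_divergence:
  assumes "T \<in> \<T>"
  obtains \<kappa> where "\<kappa> > 0"
    "\<And>p q. (\<Sum>e | e facet_of T. face_integral e (\<lambda>x. p \<bullet> x + q) *\<^sub>R outer_normal T e) = \<kappa> *\<^sub>R p"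
proof -
  obtain C where C: "full_simplex C" "T = convex hull C" using full_simplexE[OF simplex[OF assms]] .
  show thesis using full_simplex.divergence_theorem[OF C(1)] that unfolding C(2) by blast
qed

end

section \<open>Traces, jumps and averages\<close>

locale labelled_mesh = mesh \<Omega> \<T> for \<Omega> :: "(real^'d) set" and \<T> +
  fixes Tp Tm :: "(real^'d) set \<Rightarrow> (real^'d) set"
  assumes face_labelling: "face_labelling \<Omega> \<T> Tp Tm"
begin

abbreviation "V \<equiv> V_space \<Omega> \<T>"
abbreviation "Q \<equiv> Q_space \<Omega> \<T>"
abbreviation "J \<equiv> jump \<Omega> \<T> Tp Tm"
abbreviation "Av \<equiv> avg0 \<Omega> \<T> Tp Tm"
abbreviation "grad\<^sub>w \<equiv> weak_grad \<Omega> \<T> Tp Tm"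
abbreviation "div\<^sub>w \<equiv> weak_div \<Omega> \<T> Tp Tm"
abbreviation "a_form \<equiv> a_w \<Omega> \<T> Tp Tm"
abbreviation "b_form \<equiv> b_w \<Omega> \<T> Tp Tm"
abbreviation "interior_face \<equiv> interior_faces \<Omega> \<T>"

lemmas linear_V = linear_space_V_space[OF bounded_\<Omega> open_\<Omega>, of \<T>]
lemmas linear_Q = linear_space_Q_space[OF bounded_\<Omega> open_\<Omega>, of \<T>]

lemma labelled_plus:
  assumes "e \<in> faces \<T>"
  shows "Tp e \<in> \<T>" "e facet_of Tp e" "e \<subseteq> Tp e"
proof -
  have "e \<in> interior_face \<or> e \<in> boundary_faces \<Omega> \<T>" using assms by (simp add: interior_faces_def)
  then show "Tp e \<in> \<T>" "e facet_of Tp e" using face_labelling unfolding face_labelling_def by blast+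
  then show "e \<subseteq> Tp e" by (simp add: facet_of_imp_subset)
qed

lemma labelled_minus:
  assumes "e \<in> interior_face"
  shows "Tm e \<in> \<T>" "e facet_of Tm e" "e \<subseteq> Tm e" "Tp e \<noteq> Tm e"
proof -
  show "Tm e \<in> \<T>" "e facet_of Tm e" "Tp e \<noteq> Tm e"
    using face_labelling assms unfolding face_labelling_def by blast+
  then show "e \<subseteq> Tm e" by (simp add: facet_of_imp_subset)
qed

lemma interior_face_in_faces: "e \<in> interior_face \<Longrightarrow> e \<in> faces \<T>"
  by (simp add: interior_faces_def)

lemma facet_in_faces: "T \<in> \<T> \<Longrightarrow> e facet_of T \<Longrightarrow> e \<in> faces \<T>"
  by (auto simp: faces_def)

lemma neighbours_interior:
  assumes e: "e \<in> interior_face"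
  shows "{T \<in> \<T>. e facet_of T} = {Tp e, Tm e}"
  using at_most_two_neighbours[OF _ labelled_plus(1) labelled_minus(1) _ labelled_plus(2) labelled_minus(2)]
    labelled_plus[OF interior_face_in_faces[OF e]] labelled_minus[OF e] e interior_face_in_faces[OF e]
  by blast

lemma neighbour_boundary:
  assumes T: "T \<in> \<T>" "e facet_of T" and e: "e \<notin> interior_face"
  shows "T = Tp e"
proof (rule boundary_face_unique[OF T(1) _ T(2)])
  have f: "e \<in> faces \<T>" using T by (rule facet_in_faces)
  then show "Tp e \<in> \<T>" "e facet_of Tp e" using labelled_plus by auto
  show "e \<subseteq> frontier \<Omega>" using e f by (simp add: interior_faces_def boundary_faces_def)
qed

lemma V_trace:
  assumes "v \<in> V" "T \<in> \<T>"
  shows "\<exists>(A::real^'d^'d) b. (\<forall>x\<in>interior T. v x = A *v x + b) \<and> (\<forall>x\<in>T. side_trace T v x = A *v x + b)"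
proof -
  obtain A :: "real^'d^'d" and b where Ab: "\<And>x. x \<in> interior T \<Longrightarrow> v x = A *v x + b"
    using V_space_affine[OF assms] by blast
  have cont: "continuous_on UNIV (\<lambda>x. A *v x + b)"
    by (intro continuous_intros matrix_vector_mult_linear_continuous_on)
  have "side_trace T v x = A *v x + b" if "x \<in> T" for x
    by (rule side_trace_eq[where g = "\<lambda>x. A *v x + b", OF assms(2) that Ab cont])
  then show ?thesis using Ab by blast
qed

lemma side_trace_continuous:
  assumes "v \<in> V" "T \<in> \<T>" "S \<subseteq> T"
  shows "continuous_on S (side_trace T v)"
proof -
  obtain A :: "real^'d^'d" and b where Ab: "\<And>x. x \<in> T \<Longrightarrow> side_trace T v x = A *v x + b"
    using V_trace[OF assms(1,2)] by blast
  have "continuous_on S (\<lambda>x. A *v x + b)"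
    by (intro continuous_intros matrix_vector_mult_linear_continuous_on)
  then show ?thesis using Ab assms(3) by (subst continuous_on_cong[OF refl]) auto
qed

lemma side_trace_comb:
  assumes v: "v \<in> V" and w: "w \<in> V" and T: "T \<in> \<T>" "x \<in> T"
  shows "side_trace T (\<lambda>x. a *\<^sub>R v x + b *\<^sub>R w x) x = a *\<^sub>R side_trace T v x + b *\<^sub>R side_trace T w x"
proof -
  obtain A :: "real^'d^'d" and c where v: "\<And>x. x \<in> interior T \<Longrightarrow> v x = A *v x + c"
    "\<And>x. x \<in> T \<Longrightarrow> side_trace T v x = A *v x + c" using V_trace[OF v T(1)] by blast
  obtain A' :: "real^'d^'d" and c' where w: "\<And>x. x \<in> interior T \<Longrightarrow> w x = A' *v x + c'"
    "\<And>x. x \<in> T \<Longrightarrow> side_trace T w x = A' *v x + c'" using V_trace[OF w T(1)] by blast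
  have "side_trace T (\<lambda>x. a *\<^sub>R v x + b *\<^sub>R w x) x = a *\<^sub>R (A *v x + c) + b *\<^sub>R (A' *v x + c')"
    by (rule side_trace_eq[OF T])
      (auto simp: v w intro!: continuous_intros matrix_vector_mult_linear_continuous_on)
  then show ?thesis by (simp add: v(2) w(2) T)
qed

lemma side_trace_zero:
  assumes "T \<in> \<T>" "x \<in> T" "\<And>y. y \<in> interior T \<Longrightarrow> v y = 0"
  shows "side_trace T v x = 0"
  by (rule side_trace_eq[OF assms(1,2)]) (use assms(3) in auto)

lemma jump_comb:
  assumes "v \<in> V" "w \<in> V" "e \<in> faces \<T>" "x \<in> e"
  shows "J (\<lambda>x. a *\<^sub>R v x + b *\<^sub>R w x) e x = a *\<^sub>R J v e x + b *\<^sub>R J w e x"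
  using assms labelled_plus[OF assms(3)] labelled_minus[of e] side_trace_comb[OF assms(1,2)]
  by (auto simp: jump_def subset_iff algebra_simps)

lemma avg_comb:
  assumes "v \<in> V" "w \<in> V" "e \<in> faces \<T>" "x \<in> e"
  shows "Av (\<lambda>x. a *\<^sub>R v x + b *\<^sub>R w x) e x = a *\<^sub>R Av v e x + b *\<^sub>R Av w e x"
  using assms labelled_plus[OF assms(3)] labelled_minus[of e] side_trace_comb[OF assms(1,2)]
  by (auto simp: avg0_def subset_iff algebra_simps)

lemma jump_continuous:
  assumes "v \<in> V" "e \<in> faces \<T>"
  shows "continuous_on e (J v e)"
  using side_trace_continuous[OF assms(1)] labelled_plus[OF assms(2)] labelled_minus[of e]
  by (cases "e \<in> interior_face") (auto simp: jump_def[abs_def] intro!: continuous_intros)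

lemma avg_continuous:
  assumes "v \<in> V" "e \<in> faces \<T>"
  shows "continuous_on e (Av v e)"
  using side_trace_continuous[OF assms(1)] labelled_plus[OF assms(2)] labelled_minus[of e]
  by (cases "e \<in> interior_face") (auto simp: avg0_def[abs_def] intro!: continuous_intros)

lemma face_integral_comb:
  fixes f g :: "real^'d \<Rightarrow> real"
  assumes e: "e \<in> faces \<T>" and f: "continuous_on e f" and g: "continuous_on e g"
    and h: "\<And>x. x \<in> e \<Longrightarrow> h x = a * f x + b * g x"
  shows "face_integral e h = a * face_integral e f + b * face_integral e g"
proof -
  obtain n \<beta> where "flat_face e n \<beta>" using face_flat[OF e] .
  then interpret flat_face e n \<beta> .
  have "face_integral e h = face_integral e (\<lambda>x. a * f x + b * g x)"
    by (rule face_integral_cong[OF h])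
  also have "\<dots> = face_integral e (\<lambda>x. a * f x) + face_integral e (\<lambda>x. b * g x)"
    by (intro face_integral_add continuous_on_mult_left f g)
  finally show ?thesis by (simp only: set_integral_mult_right)
qed

lemma face_integral_cong_face:
  fixes f g :: "real^'d \<Rightarrow> real"
  assumes "e \<in> faces \<T>" "\<And>x. x \<in> e \<Longrightarrow> f x = g x"
  shows "face_integral e f = face_integral e g"
proof -
  obtain n \<beta> where "flat_face e n \<beta>" using face_flat[OF assms(1)] .
  then show ?thesis using assms(2) by (rule flat_face.face_integral_cong)
qed

lemma face_integral_zero:
  assumes "e \<in> faces \<T>" "\<And>x. x \<in> e \<Longrightarrow> f x = (0::real)"
  shows "face_integral e f = 0"
  using face_integral_comb[OF assms(1), of "\<lambda>_. 0" "\<lambda>_. 0" f 0 0] assms(2) by simp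

section \<open>Weak derivatives and linearity of the forms\<close>

lemma weak_grad_char:
  assumes v: "v \<in> V" and T: "T \<in> \<T>"
  shows "measure lebesgue T * (grad\<^sub>w v T \<bullet> N)
    = (\<Sum>e | e facet_of T. face_integral e (\<lambda>x. Av v e x \<bullet> (N *v outer_normal T e)))"
proof -
  let ?R = "\<lambda>N::real^'d^'d. \<Sum>e | e facet_of T. face_integral e (\<lambda>x. Av v e x \<bullet> (N *v outer_normal T e))"
  have comb: "?R (a *\<^sub>R M + b *\<^sub>R N) = a * ?R M + b * ?R N" for a b M N
  proof -
    have "?R (a *\<^sub>R M + b *\<^sub>R N) = (\<Sum>e | e facet_of T.
        a * face_integral e (\<lambda>x. Av v e x \<bullet> (M *v outer_normal T e))
        + b * face_integral e (\<lambda>x. Av v e x \<bullet> (N *v outer_normal T e)))"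
      by (intro sum.cong refl face_integral_comb continuous_intros avg_continuous v)
        (auto intro: facet_in_faces[OF T]
          simp: matrix_vector_mult_add_rdistrib scaleR_matrix_vector_assoc[symmetric] inner_add_right)
    then show ?thesis by (simp add: sum.distrib sum_distrib_left)
  qed
  have "linear ?R"
  proof (rule linearI)
    show "?R (M + N) = ?R M + ?R N" for M N using comb[of 1 M 1 N] by simp
    show "?R (c *\<^sub>R M) = c *\<^sub>R ?R M" for c M using comb[of c M 0 M] by simp
  qed
  then have "measure lebesgue T * ((THE G. \<forall>N. measure lebesgue T * (G \<bullet> N) = ?R N) \<bullet> N) = ?R N"
    by (rule the_riesz_representer) (use measure_mesh_pos[OF T] in simp)
  moreover have "(LINT x|lebesgue_on T. G \<bullet> N) = measure lebesgue T * (G \<bullet> N)" for G N :: "real^'d^'d"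
    by (rule integral_mesh_const[OF T]) simp
  ultimately show ?thesis unfolding weak_grad_def by (simp only:)
qed

lemma weak_div_char:
  assumes T: "T \<in> \<T>"
  shows "measure lebesgue T * div\<^sub>w v T = (\<Sum>e | e facet_of T. face_integral e (\<lambda>x. Av v e x \<bullet> outer_normal T e))"
proof -
  let ?S = "\<Sum>e | e facet_of T. face_integral e (\<lambda>x. Av v e x \<bullet> outer_normal T e)"
  let ?m = "measure lebesgue T"
  have int: "(LINT x|lebesgue_on T. c * q) = ?m * (c * q)" for c q
    by (rule integral_mesh_const[OF T]) simp
  have "div\<^sub>w v T = (THE c. \<forall>q. ?m * (c * q) = ?S * q)"
    unfolding weak_div_def int by (simp add: sum_distrib_right)
  also have "\<dots> = ?S / ?m"
  proof (rule the_equality)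
    show "\<forall>q. ?m * (?S / ?m * q) = ?S * q" using measure_mesh_pos[OF T] by simp
    fix c assume "\<forall>q. ?m * (c * q) = ?S * q"
    from this[rule_format, of 1] show "c = ?S / ?m" using measure_mesh_pos[OF T] by (simp add: field_simps)
  qed
  finally show ?thesis using measure_mesh_pos[OF T] by simp
qed

lemma weak_grad_comb:
  assumes v: "v \<in> V" and w: "w \<in> V" and T: "T \<in> \<T>"
  shows "grad\<^sub>w (\<lambda>x. a *\<^sub>R v x + b *\<^sub>R w x) T = a *\<^sub>R grad\<^sub>w v T + b *\<^sub>R grad\<^sub>w w T"
proof -
  have "grad\<^sub>w (\<lambda>x. a *\<^sub>R v x + b *\<^sub>R w x) T \<bullet> N = (a *\<^sub>R grad\<^sub>w v T + b *\<^sub>R grad\<^sub>w w T) \<bullet> N" for N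
  proof -
    have "measure lebesgue T * (grad\<^sub>w (\<lambda>x. a *\<^sub>R v x + b *\<^sub>R w x) T \<bullet> N)
        = a * (measure lebesgue T * (grad\<^sub>w v T \<bullet> N)) + b * (measure lebesgue T * (grad\<^sub>w w T \<bullet> N))"
      unfolding weak_grad_char[OF linear_space_comb[OF linear_V v w] T] weak_grad_char[OF v T]
        weak_grad_char[OF w T] sum_distrib_left sum.distrib[symmetric]
      by (intro sum.cong refl face_integral_comb continuous_intros avg_continuous v w)
        (auto intro: facet_in_faces[OF T] simp: avg_comb[OF v w facet_in_faces[OF T]] inner_add_left)
    also have "\<dots> = measure lebesgue T * ((a *\<^sub>R grad\<^sub>w v T + b *\<^sub>R grad\<^sub>w w T) \<bullet> N)"
      by (simp add: inner_add_left algebra_simps)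
    finally show ?thesis using measure_mesh_pos[OF T] by simp
  qed
  then show ?thesis by (rule vector_eq_rdot[THEN iffD1, OF allI])
qed

lemma a_w_eq:
  "a_form \<nu> w v = \<nu> * ((\<Sum>T\<in>\<T>. measure lebesgue T * (grad\<^sub>w w T \<bullet> grad\<^sub>w v T))
    + (\<Sum>e\<in>faces \<T>. inverse (face_h e) * face_integral e (\<lambda>x. J w e x \<bullet> J v e x)))"
proof -
  have "(\<Sum>T\<in>\<T>. LINT x|lebesgue_on T. grad\<^sub>w w T \<bullet> grad\<^sub>w v T)
      = (\<Sum>T\<in>\<T>. measure lebesgue T * (grad\<^sub>w w T \<bullet> grad\<^sub>w v T))"
    by (intro sum.cong refl integral_mesh_const)
  then show ?thesis unfolding a_w_def by (simp only:)
qed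

lemma a_w_commute: "a_form \<nu> w v = a_form \<nu> v w"
  unfolding a_w_eq by (simp only: inner_commute)

lemma a_w_comb:
  assumes v: "v \<in> V" and w: "w \<in> V" and z: "z \<in> V"
  shows "a_form \<nu> (\<lambda>x. a *\<^sub>R v x + b *\<^sub>R w x) z
    = a * a_form \<nu> v z + b * a_form \<nu> w z"
proof -
  have 1: "(\<Sum>T\<in>\<T>. measure lebesgue T * (grad\<^sub>w (\<lambda>x. a *\<^sub>R v x + b *\<^sub>R w x) T \<bullet> grad\<^sub>w z T))
      = a * (\<Sum>T\<in>\<T>. measure lebesgue T * (grad\<^sub>w v T \<bullet> grad\<^sub>w z T))
      + b * (\<Sum>T\<in>\<T>. measure lebesgue T * (grad\<^sub>w w T \<bullet> grad\<^sub>w z T))"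
    unfolding sum_distrib_left sum.distrib[symmetric]
    by (rule sum.cong) (simp_all add: weak_grad_comb[OF v w] inner_add_left algebra_simps)
  have 2: "face_integral e (\<lambda>x. J (\<lambda>x. a *\<^sub>R v x + b *\<^sub>R w x) e x \<bullet> J z e x)
      = a * face_integral e (\<lambda>x. J v e x \<bullet> J z e x) + b * face_integral e (\<lambda>x. J w e x \<bullet> J z e x)"
    if e: "e \<in> faces \<T>" for e
    by (intro face_integral_comb[OF e] continuous_intros jump_continuous[OF _ e] v w z)
      (simp add: jump_comb[OF v w e] inner_add_left)
  have 3: "(\<Sum>e\<in>faces \<T>. inverse (face_h e) * face_integral e (\<lambda>x. J (\<lambda>x. a *\<^sub>R v x + b *\<^sub>R w x) e x \<bullet> J z e x))
      = a * (\<Sum>e\<in>faces \<T>. inverse (face_h e) * face_integral e (\<lambda>x. J v e x \<bullet> J z e x))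
      + b * (\<Sum>e\<in>faces \<T>. inverse (face_h e) * face_integral e (\<lambda>x. J w e x \<bullet> J z e x))"
    unfolding sum_distrib_left sum.distrib[symmetric]
    by (rule sum.cong) (simp_all add: 2 algebra_simps)
  show ?thesis unfolding a_w_eq 1 3 by (simp add: algebra_simps)
qed

text \<open>The point at which the constant value of a pressure on \<open>T\<close> is read off, as
  \<open>Q_sample\<close> justifies.\<close>

definition sample :: "(real^'d) set \<Rightarrow> real^'d" where
  "sample T = (SOME x. x \<in> interior T)"

lemma sample_in: "T \<in> \<T> \<Longrightarrow> sample T \<in> interior T"
  unfolding sample_def using interior_nonempty[of T] by (simp add: some_in_eq)

lemma Q_sample:
  assumes "q \<in> Q" "T \<in> \<T>" "x \<in> interior T"
  shows "q x = q (sample T)"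
  using Q_space_const[OF assms(1,2)] assms(3) sample_in[OF assms(2)] by auto

lemma b_w_eq:
  assumes q: "q \<in> Q"
  shows "b_form v q
    = (\<Sum>T\<in>\<T>. (\<Sum>e | e facet_of T. face_integral e (\<lambda>x. Av v e x \<bullet> outer_normal T e)) * q (sample T))"
  unfolding b_w_def
proof (rule sum.cong[OF refl])
  fix T assume T: "T \<in> \<T>"
  have "(LINT x|lebesgue_on T. div\<^sub>w v T * q x) = measure lebesgue T * (div\<^sub>w v T * q (sample T))"
    by (rule integral_mesh_const[OF T]) (simp add: Q_sample[OF q T])
  then show "(LINT x|lebesgue_on T. div\<^sub>w v T * q x)
      = (\<Sum>e | e facet_of T. face_integral e (\<lambda>x. Av v e x \<bullet> outer_normal T e)) * q (sample T)"
    by (simp flip: weak_div_char[OF T])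
qed

lemma b_w_comb_left:
  assumes v: "v \<in> V" and w: "w \<in> V" and q: "q \<in> Q"
  shows "b_form (\<lambda>x. a *\<^sub>R v x + b *\<^sub>R w x) q = a * b_form v q + b * b_form w q"
proof -
  have eq: "(\<Sum>e | e facet_of T. face_integral e (\<lambda>x. Av (\<lambda>x. a *\<^sub>R v x + b *\<^sub>R w x) e x \<bullet> outer_normal T e))
      = a * (\<Sum>e | e facet_of T. face_integral e (\<lambda>x. Av v e x \<bullet> outer_normal T e))
      + b * (\<Sum>e | e facet_of T. face_integral e (\<lambda>x. Av w e x \<bullet> outer_normal T e))" if T: "T \<in> \<T>" for T
    unfolding sum_distrib_left sum.distrib[symmetric]
    by (intro sum.cong refl face_integral_comb continuous_intros avg_continuous v w)
      (auto intro: facet_in_faces[OF T] simp: avg_comb[OF v w facet_in_faces[OF T]] inner_add_left)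
  show ?thesis
    unfolding b_w_eq[OF q] sum_distrib_left sum.distrib[symmetric]
    by (rule sum.cong[OF refl]) (simp only: eq distrib_right mult.assoc)
qed

lemma b_w_comb_right:
  assumes "p \<in> Q" "q \<in> Q"
  shows "b_form v (\<lambda>x. a *\<^sub>R p x + b *\<^sub>R q x) = a * b_form v p + b * b_form v q"
  unfolding b_w_eq[OF linear_space_comb[OF linear_Q assms]] b_w_eq[OF assms(1)] b_w_eq[OF assms(2)]
    sum_distrib_left sum.distrib[symmetric]
  by (rule sum.cong) (simp_all add: algebra_simps)

lemma b_w_zero_left:
  assumes q: "q \<in> Q" and v: "\<And>T x. T \<in> \<T> \<Longrightarrow> x \<in> interior T \<Longrightarrow> v x = 0"
  shows "b_form v q = 0"
proof -
  have "Av v e x = 0" if "e \<in> faces \<T>" "x \<in> e" for e x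
    using side_trace_zero[OF _ _ v] labelled_plus[OF that(1)] labelled_minus[of e] that(2)
    by (auto simp: avg0_def subset_iff)
  then have "face_integral e (\<lambda>x. Av v e x \<bullet> outer_normal T e) = 0" if "T \<in> \<T>" "e facet_of T" for T e
    using facet_in_faces[OF that] by (intro face_integral_zero) auto
  then show ?thesis unfolding b_w_eq[OF q] by simp
qed

lemma a_w_zero_left:
  assumes v: "v \<in> V" and 0: "\<And>T x. T \<in> \<T> \<Longrightarrow> x \<in> interior T \<Longrightarrow> v x = 0"
  shows "a_form \<nu> v w = 0"
proof -
  have z: "side_trace T v x = 0" if "T \<in> \<T>" "x \<in> T" for T x
    using that 0 by (intro side_trace_zero) auto
  have "Av v e x = 0" "J v e x = 0" if "e \<in> faces \<T>" "x \<in> e" for e x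
    using z labelled_plus[OF that(1)] labelled_minus[of e] that(2)
    by (auto simp: avg0_def jump_def subset_iff)
  then have av: "face_integral e (\<lambda>x. Av v e x \<bullet> n) = 0" "face_integral e (\<lambda>x. J v e x \<bullet> J w e x) = 0"
    if "e \<in> faces \<T>" for e n
    using that by (auto intro!: face_integral_zero)
  have "grad\<^sub>w v T \<bullet> N = 0" if T: "T \<in> \<T>" for T N
  proof -
    have "(\<Sum>e | e facet_of T. face_integral e (\<lambda>x. Av v e x \<bullet> (N *v outer_normal T e))) = 0"
      using av(1) facet_in_faces[OF T] by (intro sum.neutral) auto
    then show ?thesis using weak_grad_char[OF v T, of N] measure_mesh_pos[OF T] by simp
  qed
  then show ?thesis unfolding a_w_eq using av by simp
qed

section \<open>Definiteness of the energy\<close>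

lemma face_h_pos: "e \<in> faces \<T> \<Longrightarrow> 0 < face_h e"
  using face_flat[of e] flat_face.measure_face_pos[OF _ face_convex face_nonempty]
  by (metis face_h_def powr_gt_zero less_irrefl)

lemma measure_face_pos: "e \<in> faces \<T> \<Longrightarrow> 0 < measure (face_measure e) e"
  using face_flat[of e] flat_face.measure_face_pos[OF _ face_convex face_nonempty] by metis

lemma face_integral_nonneg:
  assumes "\<And>x. x \<in> e \<Longrightarrow> 0 \<le> f x"
  shows "0 \<le> face_integral e f"
  unfolding set_lebesgue_integral_def
  by (rule integral_nonneg_AE) (use assms in \<open>auto simp: indicator_def\<close>)

lemma face_integral_const_face:
  assumes "e \<in> faces \<T>"
  shows "face_integral e (\<lambda>_. c) = c * measure (face_measure e) e"
proof -
  obtain n \<beta> where "flat_face e n \<beta>" using face_flat[OF assms] .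
  then interpret flat_face e n \<beta> .
  show ?thesis by (subst face_integral_const) (simp only: face_integral_1)
qed

text \<open>The integrand \<open>g x \<bullet> g x\<close> is nonnegative with zero integral, so
  \<open>g\<close> vanishes almost everywhere on \<open>e\<close>, and with it the product with any
  \<open>h\<close>.\<close>

lemma face_integral_orthogonal:
  fixes g h :: "real^'d \<Rightarrow> real^'d"
  assumes e: "e \<in> faces \<T>" and g: "continuous_on e g" and 0: "face_integral e (\<lambda>x. g x \<bullet> g x) = 0"
  shows "face_integral e (\<lambda>x. g x \<bullet> h x) = 0"
proof -
  obtain n \<beta> where "flat_face e n \<beta>" using face_flat[OF e] .
  then interpret flat_face e n \<beta> .
  have "set_integrable (face_measure e) e (\<lambda>x. g x \<bullet> g x)"
    by (intro face_integrable continuous_intros g)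
  then have "AE x in face_measure e. indicator e x *\<^sub>R (g x \<bullet> g x) = 0"
    using 0 unfolding set_integrable_def set_lebesgue_integral_def
    by (subst (asm) integral_nonneg_eq_0_iff_AE) (auto simp: indicator_def)
  then have "AE x in face_measure e. indicator e x *\<^sub>R (g x \<bullet> h x) = 0"
    by eventually_elim (auto simp: indicator_def)
  then show ?thesis unfolding set_lebesgue_integral_def by (rule integral_eq_zero_AE)
qed

lemma a_w_self_zero:
  assumes v: "v \<in> V" and \<nu>: "\<nu> > 0" and 0: "a_form \<nu> v v = 0"
  shows weak_grad_zero: "T \<in> \<T> \<Longrightarrow> grad\<^sub>w v T = 0"
    and jump_zero: "e \<in> faces \<T> \<Longrightarrow> face_integral e (\<lambda>x. J v e x \<bullet> J v e x) = 0"
proof -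
  let ?G = "\<lambda>T. measure lebesgue T * (grad\<^sub>w v T \<bullet> grad\<^sub>w v T)"
  let ?J = "\<lambda>e. inverse (face_h e) * face_integral e (\<lambda>x. J v e x \<bullet> J v e x)"
  have G: "0 \<le> ?G T" for T by simp
  have J: "0 \<le> ?J e" if "e \<in> faces \<T>" for e
    using face_h_pos[OF that] face_integral_nonneg[of e "\<lambda>x. J v e x \<bullet> J v e x"] by simp
  have "sum ?G \<T> + sum ?J (faces \<T>) = 0"
    using 0 \<nu> unfolding a_w_eq by simp
  moreover have "0 \<le> sum ?G \<T>" by (intro sum_nonneg G)
  moreover have "0 \<le> sum ?J (faces \<T>)" by (intro sum_nonneg J)
  ultimately have s: "sum ?G \<T> = 0" "sum ?J (faces \<T>) = 0" by linarith+
  show "grad\<^sub>w v T = 0" if T: "T \<in> \<T>"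
  proof -
    have "?G T = 0" using s(1) G T sum_nonneg_eq_0_iff[OF finite_mesh, of ?G] by blast
    then show ?thesis using measure_mesh_pos[OF T] by simp
  qed
  show "face_integral e (\<lambda>x. J v e x \<bullet> J v e x) = 0" if e: "e \<in> faces \<T>"
  proof -
    have "?J e = 0" using s(2) J e sum_nonneg_eq_0_iff[OF finite_faces, of ?J] by blast
    then show ?thesis using face_h_pos[OF e] by simp
  qed
qed

end

section \<open>Uniqueness and existence\<close>

context labelled_mesh
begin

lemma face_integral_avg_eq_trace:
  assumes v: "v \<in> V" and T: "T \<in> \<T>" "e facet_of T"
    and 0: "face_integral e (\<lambda>x. J v e x \<bullet> J v e x) = 0"
  shows "face_integral e (\<lambda>x. Av v e x \<bullet> w) = face_integral e (\<lambda>x. side_trace T v x \<bullet> w)"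
proof -
  have e: "e \<in> faces \<T>" using T by (rule facet_in_faces)
  have sub: "e \<subseteq> T" using T(2) by (rule facet_of_imp_subset)
  \<comment> \<open>The trace from \<open>Tp e\<close> is the average plus half the jump, that from
    \<open>Tm e\<close> the average minus half the jump. On a boundary face the average is zero and
    the jump is the whole trace.\<close>
  define s :: real where "s = (if e \<notin> interior_face then 1 else if T = Tp e then 1/2 else - 1/2)"
  have "side_trace T v x = Av v e x + s *\<^sub>R J v e x" if "x \<in> e" for x
  proof (cases "e \<in> interior_face")
    case True
    then have "T = Tp e \<or> T = Tm e" using neighbours_interior T by blast
    then show ?thesis
      using True labelled_minus(4)[OF True] by (auto simp: s_def jump_def avg0_def vec_eq_iff field_simps)
  next
    case False
    then show ?thesis using neighbour_boundary[OF T False] by (simp add: s_def jump_def avg0_def)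
  qed
  then have "face_integral e (\<lambda>x. side_trace T v x \<bullet> w)
      = 1 * face_integral e (\<lambda>x. Av v e x \<bullet> w) + s * face_integral e (\<lambda>x. J v e x \<bullet> w)"
    by (intro face_integral_comb[OF e] continuous_intros jump_continuous[OF v e] avg_continuous[OF v e])
      (simp add: inner_add_left)
  also have "face_integral e (\<lambda>x. J v e x \<bullet> w) = 0"
    by (rule face_integral_orthogonal[OF e jump_continuous[OF v e] 0])
  finally show ?thesis by simp
qed

text \<open>Testing the weak gradient with \<open>w \<otimes> c\<close> turns it into the boundary term of the divergence
  theorem for the affine function \<open>side_trace T v \<bullet> w\<close>.\<close>

lemma energy_zero_imp_const:
  assumes v: "v \<in> V" and \<nu>: "\<nu> > 0" and 0: "a_form \<nu> v v = 0" and T: "T \<in> \<T>"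
  shows "\<exists>b. (\<forall>x\<in>interior T. v x = b) \<and> (\<forall>x\<in>T. side_trace T v x = b)"
proof -
  obtain A :: "real^'d^'d" and b where Ab: "\<And>x. x \<in> interior T \<Longrightarrow> v x = A *v x + b"
    "\<And>x. x \<in> T \<Longrightarrow> side_trace T v x = A *v x + b"
    using V_trace[OF v T] by blast
  obtain \<kappa> where \<kappa>: "\<kappa> > 0"
    "\<And>p q. (\<Sum>e | e facet_of T. face_integral e (\<lambda>x. p \<bullet> x + q) *\<^sub>R outer_normal T e) = \<kappa> *\<^sub>R p"
    using simplex_divergence[OF T] by blast
  have zero: "w v* A = 0" for w
  proof -
    let ?p = "w v* A"
    have tr: "side_trace T v x \<bullet> w = ?p \<bullet> x + b \<bullet> w" if "x \<in> T" for x
      using Ab(2)[OF that] dot_lmul_matrix[of w A x] by (simp add: inner_add_left inner_commute[of "A *v x" w])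
    have "?p \<bullet> c = 0" for c
    proof -
      define N where "N = (\<chi> i j. w $ i * c $ j)"
      have N: "N *v n = (c \<bullet> n) *\<^sub>R w" for n
        by (simp add: N_def matrix_vector_mult_def vec_eq_iff inner_vec_def sum_distrib_left mult_ac)
      have "face_integral e (\<lambda>x. Av v e x \<bullet> (N *v outer_normal T e))
          = (face_integral e (\<lambda>x. ?p \<bullet> x + b \<bullet> w) *\<^sub>R outer_normal T e) \<bullet> c" if e: "e facet_of T" for e
      proof -
        have ef: "e \<in> faces \<T>" using T e by (rule facet_in_faces)
        have "face_integral e (\<lambda>x. Av v e x \<bullet> (N *v outer_normal T e))
            = face_integral e (\<lambda>x. side_trace T v x \<bullet> (N *v outer_normal T e))"
          by (rule face_integral_avg_eq_trace[OF v T e jump_zero[OF v \<nu> 0 ef]])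
        also have "\<dots> = face_integral e (\<lambda>x. (c \<bullet> outer_normal T e) * (?p \<bullet> x + b \<bullet> w))"
          using facet_of_imp_subset[OF e] by (intro face_integral_cong_face[OF ef]) (auto simp: N tr)
        finally show ?thesis by (simp add: inner_commute)
      qed
      then have "measure lebesgue T * (grad\<^sub>w v T \<bullet> N)
          = (\<Sum>e | e facet_of T. face_integral e (\<lambda>x. ?p \<bullet> x + b \<bullet> w) *\<^sub>R outer_normal T e) \<bullet> c"
        unfolding weak_grad_char[OF v T] inner_sum_left by (intro sum.cong) auto
      then show ?thesis using weak_grad_zero[OF v \<nu> 0 T] \<kappa> by simp
    qed
    from this[of ?p] show ?thesis by simp
  qed
  have "A *v x = 0" for x
    using dot_lmul_matrix[of "A *v x" A x] zero[of "A *v x"] by simp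
  then show ?thesis using Ab by auto
qed

text \<open>The jump is the constant \<open>b (Tp e) - b (Tm e)\<close> on a face of positive area,
  and the elements \<open>T\<close> and \<open>T'\<close> can only be the two labelled ones.\<close>

lemma interior_face_values_eq:
  assumes e: "e \<in> interior_face" and T: "e facet_of T" "T \<in> \<T>" "e facet_of T'" "T' \<in> \<T>"
    and 0: "face_integral e (\<lambda>x. J v e x \<bullet> J v e x) = 0"
    and b: "\<And>T x. T \<in> \<T> \<Longrightarrow> x \<in> T \<Longrightarrow> side_trace T v x = b T"
  shows "b T = b T'"
proof -
  have f: "e \<in> faces \<T>" using e by (rule interior_face_in_faces)
  have "J v e x = b (Tp e) - b (Tm e)" if "x \<in> e" for x
  proof -
    have "x \<in> Tp e" "x \<in> Tm e" using that labelled_plus(3)[OF f] labelled_minus(3)[OF e] by blast+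
    then show ?thesis using e b labelled_plus(1)[OF f] labelled_minus(1)[OF e] by (simp add: jump_def)
  qed
  then have "0 = face_integral e (\<lambda>x. (b (Tp e) - b (Tm e)) \<bullet> (b (Tp e) - b (Tm e)))"
    unfolding 0[symmetric] by (intro face_integral_cong_face[OF f]) auto
  also have "\<dots> = ((b (Tp e) - b (Tm e)) \<bullet> (b (Tp e) - b (Tm e))) * measure (face_measure e) e"
    by (rule face_integral_const_face[OF f])
  finally have "b (Tp e) = b (Tm e)" using measure_face_pos[OF f] by simp
  moreover have "T \<in> {Tp e, Tm e}" "T' \<in> {Tp e, Tm e}"
    using neighbours_interior[OF e] T by blast+
  ultimately show ?thesis by auto
qed

text \<open>Otherwise the boundary integrals of a coordinate function over all elements would cancel, although
  by the divergence theorem each of them has a positive component.\<close>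

lemma boundary_face_exists:
  obtains e where "e \<in> faces \<T>" "e \<notin> interior_face"
proof -
  have False if all: "faces \<T> \<subseteq> interior_face"
  proof -
    define i :: 'd where "i = undefined"
    define h where "h T e = face_integral e (\<lambda>x. axis i 1 \<bullet> x + 0) * (outer_normal T e $ i)" for T e
    have pos: "0 < (\<Sum>e | e facet_of T. h T e)" if T: "T \<in> \<T>" for T
    proof -
      obtain \<kappa> where \<kappa>: "\<kappa> > 0"
        "\<And>p q. (\<Sum>e | e facet_of T. face_integral e (\<lambda>x. p \<bullet> x + q) *\<^sub>R outer_normal T e) = \<kappa> *\<^sub>R p"
        using simplex_divergence[OF T] by blast
      have "(\<Sum>e | e facet_of T. h T e)
          = (\<Sum>e | e facet_of T. face_integral e (\<lambda>x. axis i 1 \<bullet> x + 0) *\<^sub>R outer_normal T e) $ i"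
        by (simp add: h_def)
      also have "\<dots> = (\<kappa> *\<^sub>R axis i 1) $ i" by (simp only: \<kappa>(2))
      finally show ?thesis using \<kappa>(1) by simp
    qed
    have "(\<Sum>T | T \<in> \<T> \<and> e facet_of T. h T e) = 0" if e: "e \<in> faces \<T>" for e
    proof -
      have i: "e \<in> interior_face" using all e by blast
      have "outer_normal (Tm e) e = - outer_normal (Tp e) e"
        using labelled_plus[OF e] labelled_minus[OF i] by (intro outer_normal_opposite)
      then show ?thesis
        unfolding neighbours_interior[OF i] using labelled_minus(4)[OF i] by (simp add: h_def)
    qed
    then have "(\<Sum>T\<in>\<T>. \<Sum>e | e facet_of T. h T e) = 0"
      unfolding sum_facets_swap by simp
    moreover have "\<T> \<noteq> {}" using nonempty_\<Omega> Union_mesh closure_subset[of \<Omega>] by auto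
    then have "0 < (\<Sum>T\<in>\<T>. \<Sum>e | e facet_of T. h T e)"
      by (intro sum_pos finite_mesh pos)
    ultimately show False by simp
  qed
  then show thesis using that by blast
qed

lemma energy_zero_imp_zero:
  assumes v: "v \<in> V" and \<nu>: "\<nu> > 0" and 0: "a_form \<nu> v v = 0"
    and T: "T \<in> \<T>" "x \<in> interior T"
  shows "v x = 0"
proof -
  obtain b where b: "\<And>T x. T \<in> \<T> \<Longrightarrow> x \<in> interior T \<Longrightarrow> v x = b T"
    "\<And>T x. T \<in> \<T> \<Longrightarrow> x \<in> T \<Longrightarrow> side_trace T v x = b T"
    using energy_zero_imp_const[OF v \<nu> 0] by metis
  obtain e where e: "e \<in> faces \<T>" "e \<notin> interior_face" by (rule boundary_face_exists)
  note p = labelled_plus[OF e(1)]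
  have "0 = face_integral e (\<lambda>x. b (Tp e) \<bullet> b (Tp e))"
    unfolding jump_zero[OF v \<nu> 0 e(1), symmetric]
    by (intro face_integral_cong_face[OF e(1)]) (use e b(2) p in \<open>auto simp: jump_def\<close>)
  also have "\<dots> = (b (Tp e) \<bullet> b (Tp e)) * measure (face_measure e) e"
    by (rule face_integral_const_face[OF e(1)])
  finally have bp: "b (Tp e) = 0" using measure_face_pos[OF e(1)] by simp
  have "{T \<in> \<T>. b T = 0} = \<T>"
  proof (rule ccontr)
    assume ne: "{T \<in> \<T>. b T = 0} \<noteq> \<T>"
    have ne': "{T \<in> \<T>. b T = 0} \<subseteq> \<T>" "{T \<in> \<T>. b T = 0} \<noteq> {}" using bp p by auto
    obtain T T' e' where *: "T \<in> {T \<in> \<T>. b T = 0}" "T' \<in> \<T> - {T \<in> \<T>. b T = 0}"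
      "e' \<in> interior_face" "e' facet_of T" "e' facet_of T'"
      by (rule common_interior_face[OF ne' ne])
    then have "b T = b T'"
      using jump_zero[OF v \<nu> 0 interior_face_in_faces] b(2)
      by (intro interior_face_values_eq[of e' T T' v b]) auto
    then show False using * by auto
  qed
  then have "b T = 0" using T(1) by auto
  then show ?thesis using b(1)[OF T] by simp
qed

section \<open>Discrete maximum principle for the pressure\<close>

lemma pressure_zero:
  assumes q: "q \<in> Q" and 0: "\<And>v. v \<in> V \<Longrightarrow> b_form v q = 0"
    and T: "T \<in> \<T>" "x \<in> interior T"
  shows "q x = 0"
proof -
  define c where "c T = q (sample T)" for T
  have ne: "\<T> \<noteq> {}" using T by blast
  define M where "M = Max (c ` \<T>)"
  have le_M: "c T \<le> M" if "T \<in> \<T>" for T using that finite_mesh by (simp add: M_def)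
  have "M \<in> c ` \<T>" unfolding M_def using finite_mesh ne by (intro Max_in) auto
  then have ne': "{T \<in> \<T>. c T = M} \<subseteq> \<T>" "{T \<in> \<T>. c T = M} \<noteq> {}" by auto
  have "{T \<in> \<T>. c T = M} = \<T>"
  proof (rule ccontr)
    assume ne: "{T \<in> \<T>. c T = M} \<noteq> \<T>"
    obtain T T' e where *: "T \<in> {T \<in> \<T>. c T = M}" "T' \<in> \<T> - {T \<in> \<T>. c T = M}"
      and e: "e \<in> interior_face" "e facet_of T" "e facet_of T'"
      by (rule common_interior_face[OF ne' ne])
    have T: "T \<in> \<T>" "c T = M" and T': "T' \<in> \<T>" "c T' \<noteq> M" using * by auto
    \<comment> \<open>The test function on \<open>T\<close>, extended by zero. Here \<open>T\<close>
      attains the maximum \<open>M\<close> while its neighbour \<open>T'\<close> across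
      \<open>e\<close> does not.\<close>
    define v where "v x = (if x \<in> interior T then x - barycenter T else 0)" for x
    have v_in: "v \<in> V"
    proof (rule D_space_subset_V_space[OF bounded_\<Omega> open_\<Omega>])
      have "\<exists>c. \<forall>x\<in>interior S. v x = c *\<^sub>R (x - barycenter S)" if S: "S \<in> \<T>" for S
      proof (cases "S = T")
        case True
        then show ?thesis by (intro exI[of _ 1]) (simp add: v_def)
      next
        case False
        then have "interior S \<inter> interior T = {}"
          using interior_disjoint[OF S T(1)] interior_subset[of T] by blast
        then show ?thesis by (intro exI[of _ 0]) (auto simp: v_def)
      qed
      then show "v \<in> D_space \<T>" by (simp add: D_space_def)
    qed
    have tr_T: "side_trace T v x = x - barycenter T" if "x \<in> T" for x
      by (rule side_trace_eq[OF T(1) that]) (auto simp: v_def intro!: continuous_intros)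
    have tr_S: "side_trace S v x = 0" if "S \<in> \<T>" "S \<noteq> T" "x \<in> S" for S x
    proof (rule side_trace_zero[OF that(1,3)])
      fix y assume "y \<in> interior S"
      then show "v y = 0" using interior_disjoint[OF that(1) T(1) that(2)] interior_subset[of T]
        by (auto simp: v_def)
    qed
    \<comment> \<open>The sum \<open>\<Sigma> f\<close> below collects what the elements at the face
      \<open>f\<close> contribute to \<open>b_form v q\<close>.\<close>
    define g where "g S f = face_integral f (\<lambda>x. Av v f x \<bullet> outer_normal S f) * c S" for S f
    define \<Sigma> where "\<Sigma> f = (\<Sum>S | S \<in> \<T> \<and> f facet_of S. g S f)" for f
    \<comment> \<open>A face that is not a facet of \<open>T\<close> sees only zero traces of
      \<open>v\<close>, and on boundary faces \<open>avg0\<close> is zero by definition.\<close>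
    have away: "\<Sigma> f = 0" if f: "f \<in> faces \<T>" and no: "\<not> (f facet_of T \<and> f \<in> interior_face)" for f
    proof -
      have "Av v f x = 0" if x: "x \<in> f" for x
      proof (cases "f \<in> interior_face")
        case True
        then have "Tp f \<noteq> T" "Tm f \<noteq> T" using no labelled_plus[OF f] labelled_minus[OF True] by auto
        moreover have "x \<in> Tp f" "x \<in> Tm f"
          using x labelled_plus(3)[OF f] labelled_minus(3)[OF True] by blast+
        ultimately show ?thesis
          using True tr_S labelled_plus(1)[OF f] labelled_minus(1)[OF True] by (simp add: avg0_def)
      qed (simp add: avg0_def)
      then have "face_integral f (\<lambda>x. Av v f x \<bullet> n) = 0" for n
        by (intro face_integral_zero[OF f]) auto
      then show ?thesis by (simp add: \<Sigma>_def g_def)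
    qed
    \<comment> \<open>Both elements at \<open>f\<close> see the same average, half of
      \<open>x - barycenter T\<close>, but opposite normals; so the values of \<open>q\<close> enter
      through their difference. Its weight \<open>I\<close> is positive, being the integral of the
      constant \<open>k / 2\<close>.\<close>
    have at: "\<exists>I>0. \<forall>S. S \<in> \<T> \<and> f facet_of S \<and> S \<noteq> T \<longrightarrow> \<Sigma> f = I * (M - c S)"
      if f: "f facet_of T" "f \<in> interior_face" for f
    proof -
      have ff: "f \<in> faces \<T>" using f(2) by (rule interior_face_in_faces)
      obtain \<beta> r k where "flat_face f (outer_normal T f) \<beta>" "barycenter f \<in> f" "0 < r"
        "\<forall>z\<in>ball (barycenter f) r. outer_normal T f \<bullet> z \<le> \<beta> \<longrightarrow> z \<in> T"
        and k: "0 < k" "\<forall>x\<in>f. outer_normal T f \<bullet> (x - barycenter T) = k"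
        by (rule facet_of_simplex[OF simplex[OF T(1)] f(1)])
      have av: "Av v f x = (1/2) *\<^sub>R (x - barycenter T)" if x: "x \<in> f" for x
      proof -
        have "T = Tp f \<or> T = Tm f" using neighbours_interior[OF f(2)] f(1) T(1) by blast
        moreover have "x \<in> Tp f" "x \<in> Tm f"
          using x labelled_plus(3)[OF ff] labelled_minus(3)[OF f(2)] by blast+
        ultimately show ?thesis
          using f(2) tr_T[of x] tr_S[of "Tp f" x] tr_S[of "Tm f" x] labelled_plus(1)[OF ff] labelled_minus(1,4)[OF f(2)]
          by (cases "T = Tp f") (simp_all add: avg0_def)
      qed
      define I where "I = face_integral f (\<lambda>x. Av v f x \<bullet> outer_normal T f)"
      obtain n \<beta> where "flat_face f n \<beta>" using face_flat[OF ff] .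
      then have "0 < I" unfolding I_def
        by (rule flat_face.face_integral_pos[OF _ face_convex[OF ff] face_nonempty[OF ff], of _ _ _ "k / 2"])
          (use k av in \<open>auto simp: inner_commute\<close>)
      moreover have "\<Sigma> f = I * (M - c S)" if S: "S \<in> \<T>" "f facet_of S" "S \<noteq> T" for S
      proof -
        have two: "{S \<in> \<T>. f facet_of S} = {T, S}"
        proof -
          have "T \<in> {Tp f, Tm f}" "S \<in> {Tp f, Tm f}"
            unfolding neighbours_interior[OF f(2), symmetric] using S f(1) T(1) by auto
          then show ?thesis unfolding neighbours_interior[OF f(2)] using S(3) by auto
        qed
        have "outer_normal S f = - outer_normal T f"
          using S f(1) T(1) by (intro outer_normal_opposite) auto
        moreover have "face_integral f (\<lambda>x. Av v f x \<bullet> - outer_normal T f) = (-1) * I"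
          unfolding I_def set_integral_mult_right[symmetric] by simp
        ultimately show ?thesis
          unfolding \<Sigma>_def two using S(3) T(2) by (simp add: g_def I_def algebra_simps)
      qed
      ultimately show ?thesis by blast
    qed
    \<comment> \<open>No contribution is negative since \<open>c S \<le> M\<close>, and together
      they give \<open>b_form v q\<close>, which is zero; hence the contribution of \<open>e\<close>
      vanishes.\<close>
    have nonneg: "0 \<le> \<Sigma> f" if f: "f \<in> faces \<T>" for f
    proof (cases "f facet_of T \<and> f \<in> interior_face")
      case True
      then obtain I where I: "I > 0" "\<And>S. S \<in> \<T> \<and> f facet_of S \<and> S \<noteq> T \<Longrightarrow> \<Sigma> f = I * (M - c S)"
        using at by blast
      have "\<exists>S. S \<in> \<T> \<and> f facet_of S \<and> S \<noteq> T"
        using labelled_plus[OF f] labelled_minus[of f] True by metis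
      then show ?thesis using I le_M by fastforce
    qed (use away f in auto)
    have "0 = (\<Sum>S\<in>\<T>. \<Sum>f | f facet_of S. g S f)"
      using 0[OF v_in] unfolding b_w_eq[OF q] g_def c_def by (simp add: sum_distrib_right)
    also have "\<dots> = sum \<Sigma> (faces \<T>)" unfolding sum_facets_swap \<Sigma>_def ..
    finally have "sum \<Sigma> (faces \<T>) = 0" ..
    then have "\<Sigma> e = 0"
      using sum_nonneg_eq_0_iff[OF finite_faces, of \<Sigma>] nonneg interior_face_in_faces[OF e(1)] by blast
    moreover obtain I where "I > 0" "\<Sigma> e = I * (M - c T')"
      using at[OF e(2,1)] T' e(3) T(2) by metis
    ultimately show False using T'(2) by simp
  qed
  then have const: "q y = M" if "S \<in> \<T>" "y \<in> interior S" for S y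
    using that Q_sample[OF q that] by (auto simp: c_def)
  have q0: "(LINT x|lebesgue_on \<Omega>. q x) = 0" "q \<in> L2 \<Omega>"
    using q by (auto simp: Q_space_def L2_zero_mean_def)
  have "(LINT x|lebesgue_on \<Omega>. q x) = (LINT x|lebesgue_on \<Omega>. M)"
  proof (rule integral_cong_AE)
    show "q \<in> borel_measurable (lebesgue_on \<Omega>)" using q0(2) by (simp add: L2_def)
    show "AE x in lebesgue_on \<Omega>. q x = M" by (rule AE_mesh) (rule const)
  qed simp
  also have "\<dots> = M * measure lebesgue \<Omega>"
    using open_\<Omega> by (simp add: measure_restrict_space)
  finally have "M * measure lebesgue \<Omega> = 0" unfolding q0(1) ..
  moreover have "0 < measure lebesgue \<Omega>"
    using open_not_negligible[OF open_\<Omega> nonempty_\<Omega>] negligible_iff_measure0[OF lmeasurable_open[OF bounded_\<Omega> open_\<Omega>]]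
    by (simp add: zero_less_measure_iff)
  ultimately have "M = 0" by simp
  then show ?thesis using const[OF T] by simp
qed

section \<open>Existence and uniqueness of the discrete solution\<close>

lemma determining_points:
  obtains P where "finite P" "P \<subseteq> (\<Union>T\<in>\<T>. interior T)"
    "\<And>v T x. v \<in> V \<Longrightarrow> (\<And>x. x \<in> P \<Longrightarrow> v x = 0) \<Longrightarrow> T \<in> \<T> \<Longrightarrow> x \<in> interior T \<Longrightarrow> v x = 0"
    "\<And>q T x. q \<in> Q \<Longrightarrow> (\<And>x. x \<in> P \<Longrightarrow> q x = 0) \<Longrightarrow> T \<in> \<T> \<Longrightarrow> x \<in> interior T \<Longrightarrow> q x = 0"
proof -
  have "\<exists>P. finite P \<and> P \<subseteq> interior T \<and> P \<noteq> {} \<and>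
      (\<forall>(A::real^'d^'d) b. (\<forall>x\<in>P. A *v x + b = 0) \<longrightarrow> (\<forall>x. A *v x + b = 0))" if "T \<in> \<T>" for T
    by (rule affine_determining_points[OF open_interior interior_nonempty[OF that]])
  then obtain P where P: "\<And>T. T \<in> \<T> \<Longrightarrow> finite (P T)" "\<And>T. T \<in> \<T> \<Longrightarrow> P T \<subseteq> interior T"
    "\<And>T. T \<in> \<T> \<Longrightarrow> P T \<noteq> {}"
    "\<And>T (A::real^'d^'d) b x. T \<in> \<T> \<Longrightarrow> \<forall>x\<in>P T. A *v x + b = 0 \<Longrightarrow> A *v x + b = 0"
    by metis
  show thesis
  proof (rule that[of "\<Union>T\<in>\<T>. P T"])
    show "finite (\<Union>T\<in>\<T>. P T)" using finite_mesh P(1) by blast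
    show "(\<Union>T\<in>\<T>. P T) \<subseteq> (\<Union>T\<in>\<T>. interior T)" using P(2) by blast
    fix T x assume T: "T \<in> \<T>" "x \<in> interior T"
    { fix v assume v: "v \<in> V" "\<And>x. x \<in> (\<Union>T\<in>\<T>. P T) \<Longrightarrow> v x = 0"
      obtain A :: "real^'d^'d" and b where Ab: "\<And>x. x \<in> interior T \<Longrightarrow> v x = A *v x + b"
        using V_space_affine[OF v(1) T(1)] by blast
      have "A *v x + b = 0"
      proof (rule P(4)[OF T(1)], rule ballI)
        fix y assume "y \<in> P T"
        then have "v y = 0" "y \<in> interior T" using v(2)[of y] P(2)[OF T(1)] T(1) by blast+
        then show "A *v y + b = 0" using Ab[of y] by simp
      qed
      then show "v x = 0" using Ab[OF T(2)] by simp }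
    { fix q assume q: "q \<in> Q" "\<And>x. x \<in> (\<Union>T\<in>\<T>. P T) \<Longrightarrow> q x = 0"
      obtain y where "y \<in> P T" using P(3)[OF T(1)] by blast
      then have "q y = 0" "y \<in> interior T" using q(2)[of y] P(2)[OF T(1)] T(1) by blast+
      then show "q x = 0" using Q_sample[OF q(1) T(1)] T(2) by metis }
  qed
qed

lemma mEG_solution_exists:
  assumes \<nu>: "\<nu> > 0" and f: "f \<in> L2 \<Omega>"
  shows "\<exists>u p. mEG_solution \<Omega> \<T> Tp Tm \<nu> f u p"
proof -
  obtain P where P: "finite P"
    "\<And>v T x. v \<in> V \<Longrightarrow> (\<And>x. x \<in> P \<Longrightarrow> v x = 0) \<Longrightarrow> T \<in> \<T> \<Longrightarrow> x \<in> interior T \<Longrightarrow> v x = 0"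
    "\<And>q T x. q \<in> Q \<Longrightarrow> (\<And>x. x \<in> P \<Longrightarrow> q x = 0) \<Longrightarrow> T \<in> \<T> \<Longrightarrow> x \<in> interior T \<Longrightarrow> q x = 0"
    by (rule determining_points) blast
  \<comment> \<open>Velocity and pressure are combined into one function with values in a product,
    so that the solvability lemma deals with a single space.\<close>
  define X :: "(real^'d \<Rightarrow> (real^'d) \<times> real) set" where
    "X = {h. (\<lambda>x. fst (h x)) \<in> V \<and> (\<lambda>x. snd (h x)) \<in> Q}"
  \<comment> \<open>The two equations are added. With this sign of the last term both
    \<open>b_form\<close> terms cancel for \<open>h = k\<close>, and the energy of the velocity
    remains.\<close>
  define B where "B h k = a_form \<nu> (\<lambda>x. fst (h x)) (\<lambda>x. fst (k x))
      - b_form (\<lambda>x. fst (k x)) (\<lambda>x. snd (h x))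
      + b_form (\<lambda>x. fst (h x)) (\<lambda>x. snd (k x))" for h k :: "real^'d \<Rightarrow> (real^'d) \<times> real"
  define F where "F k = (LINT x|lebesgue_on \<Omega>. f x \<bullet> fst (k x))" for k :: "real^'d \<Rightarrow> (real^'d) \<times> real"
  have X: "linear_space X"
    using linear_V linear_Q by (auto simp: X_def linear_space_def)
  have a_right: "a_form \<nu> z (\<lambda>x. a *\<^sub>R v x + b *\<^sub>R w x)
      = a * a_form \<nu> z v + b * a_form \<nu> z w"
    if "v \<in> V" "w \<in> V" "z \<in> V" for v w z a b
    using a_w_comb[OF that] by (simp only: a_w_commute[of \<nu> z])
  have mem: "(\<lambda>x. fst (h x)) \<in> V" "(\<lambda>x. snd (h x)) \<in> Q" if "h \<in> X" for h
    using that by (simp_all add: X_def)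
  have B1: "linear_form X (\<lambda>h. B h k)" if k: "k \<in> X" for k
  proof -
    have "B (\<lambda>x. a *\<^sub>R h x + b *\<^sub>R h' x) k = a * B h k + b * B h' k"
      if h: "h \<in> X" "h' \<in> X" for h h' a b
    proof -
      note H = mem[OF h(1)] mem[OF h(2)] mem[OF k]
      show ?thesis
        unfolding B_def fst_add fst_scaleR snd_add snd_scaleR
          a_w_comb[OF H(1,3,5)] b_w_comb_right[OF H(2,4)] b_w_comb_left[OF H(1,3,6)]
        by (simp add: algebra_simps)
    qed
    then show ?thesis unfolding linear_form_def by blast
  qed
  have B2: "linear_form X (B h)" if h: "h \<in> X" for h
  proof -
    have "B h (\<lambda>x. a *\<^sub>R k x + b *\<^sub>R k' x) = a * B h k + b * B h k'"
      if k: "k \<in> X" "k' \<in> X" for k k' a b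
    proof -
      note H = mem[OF k(1)] mem[OF k(2)] mem[OF h]
      show ?thesis
        unfolding B_def fst_add fst_scaleR snd_add snd_scaleR
          a_right[OF H(1,3,5)] b_w_comb_right[OF H(2,4)] b_w_comb_left[OF H(1,3,6)]
        by (simp add: algebra_simps)
    qed
    then show ?thesis unfolding linear_form_def by blast
  qed
  have int: "integrable (lebesgue_on \<Omega>) (\<lambda>x. f x \<bullet> v x)" if "v \<in> V" for v
  proof (rule integrable_L2_inner_piecewise_affine[OF f])
    show "\<exists>(A::real^'d^'d) b. \<forall>x\<in>interior T. v x = A *v x + b" if "T \<in> \<T>" for T
      using V_trace[OF \<open>v \<in> V\<close> that] by blast
  qed
  have FX: "linear_form X F"
    unfolding linear_form_def F_def fst_add fst_scaleR inner_add_right inner_scaleR_right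
    using int[OF mem(1)] by simp
  have null: "B h k = 0" if h: "h \<in> X" and k: "k \<in> X" and 0: "\<And>p. p \<in> P \<Longrightarrow> h p = 0" for h k
  proof -
    have h1: "fst (h x) = 0" "snd (h x) = 0" if "T \<in> \<T>" "x \<in> interior T" for T x
      using P(2)[OF mem(1)[OF h] _ that] P(3)[OF mem(2)[OF h] _ that] 0 by simp_all
    have "b_form (\<lambda>x. fst (k x)) (\<lambda>x. snd (h x)) = 0"
      unfolding b_w_eq[OF mem(2)[OF h]]
      by (rule sum.neutral) (simp add: h1(2)[OF _ sample_in])
    moreover have "a_form \<nu> (\<lambda>x. fst (h x)) (\<lambda>x. fst (k x)) = 0"
      by (rule a_w_zero_left[OF mem(1)[OF h] h1(1)])
    moreover have "b_form (\<lambda>x. fst (h x)) (\<lambda>x. snd (k x)) = 0"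
      by (rule b_w_zero_left[OF mem(2)[OF k] h1(1)])
    ultimately show ?thesis by (simp add: B_def)
  qed
  \<comment> \<open>\<open>F\<close> sees only the velocity of \<open>k\<close>. Testing with
    \<open>h = k\<close> gives it zero energy, so it vanishes almost everywhere.\<close>
  have nondeg: "F k = 0" if k: "k \<in> X" and 0: "\<And>h. h \<in> X \<Longrightarrow> B h k = 0" for k
  proof -
    have a0: "a_form \<nu> (\<lambda>x. fst (k x)) (\<lambda>x. fst (k x)) = 0"
      using 0[OF k] by (simp add: B_def)
    have "fst (k x) = 0" if "T \<in> \<T>" "x \<in> interior T" for T x
      by (rule energy_zero_imp_zero[OF mem(1)[OF k] \<nu> a0 that])
    then have "AE x in lebesgue_on \<Omega>. f x \<bullet> fst (k x) = 0" by (intro AE_mesh) simp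
    then show ?thesis unfolding F_def by (rule integral_eq_zero_AE)
  qed
  obtain h where h: "h \<in> X" "\<And>k. k \<in> X \<Longrightarrow> B h k = F k"
    using bilinear_form_solvable[OF X P(1) B1 B2 FX null nondeg] by blast
  define u p where "u x = fst (h x)" and "p x = snd (h x)" for x
  have up: "u \<in> V" "p \<in> Q" using h(1) by (auto simp: X_def u_def[abs_def] p_def[abs_def])
  have zero: "(\<lambda>_. 0) \<in> V" "(\<lambda>_. 0) \<in> Q"
    using linear_V linear_Q by (auto simp: linear_space_def)
  have b0: "b_form v (\<lambda>_. 0) = 0" for v
    by (simp add: b_w_eq[OF zero(2)])
  \<comment> \<open>Testing with \<open>(v, 0)\<close> here and with \<open>(0, q)\<close> below
    separates the two equations again.\<close>
  have "a_form \<nu> u v - b_form v p = (LINT x|lebesgue_on \<Omega>. f x \<bullet> v x)" if "v \<in> V" for v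
    using h(2)[of "\<lambda>x. (v x, 0)"] that zero b0
    by (simp add: X_def B_def F_def u_def[abs_def] p_def[abs_def])
  moreover have "b_form u q = 0" if q: "q \<in> Q" for q
  proof -
    have "a_form \<nu> u (\<lambda>_. 0) = 0"
      unfolding a_w_commute[of \<nu> u] by (rule a_w_zero_left[OF zero(1)]) simp
    moreover have "b_form (\<lambda>_. 0) p = 0" by (rule b_w_zero_left[OF up(2)]) simp
    ultimately show ?thesis
      using h(2)[of "\<lambda>x. (0, q x)"] q zero by (simp add: X_def B_def F_def u_def[abs_def] p_def[abs_def])
  qed
  ultimately show ?thesis using up by (auto simp: mEG_solution_def)
qed

text \<open>The energy of the velocity difference is \<open>b_form w r\<close>, which is zero by the
  second equation tested with \<open>r\<close>. With a vanishing velocity, the first equation then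
  says that \<open>b_form v r\<close> is zero for all \<open>v\<close>, as
  \<open>pressure_zero\<close> requires. Equality holds almost everywhere, because values on the
  skeleton are arbitrary.\<close>

lemma mEG_solution_unique:
  assumes \<nu>: "\<nu> > 0" and s: "mEG_solution \<Omega> \<T> Tp Tm \<nu> f u p" and s': "mEG_solution \<Omega> \<T> Tp Tm \<nu> f u' p'"
  shows "AE x in lebesgue_on \<Omega>. u' x = u x" "AE x in lebesgue_on \<Omega>. p' x = p x"
proof -
  define w where "w x = 1 *\<^sub>R u' x + (-1) *\<^sub>R u x" for x
  define r where "r x = 1 *\<^sub>R p' x + (-1) *\<^sub>R p x" for x
  have V: "u \<in> V" "u' \<in> V" and Q: "p \<in> Q" "p' \<in> Q"
    using s s' by (auto simp: mEG_solution_def)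
  have wV: "w \<in> V" and rQ: "r \<in> Q"
    unfolding w_def[abs_def] r_def[abs_def] using V Q linear_space_comb linear_V linear_Q by blast+
  have "a_form \<nu> w v - b_form v r
      = (a_form \<nu> u' v - b_form v p') - (a_form \<nu> u v - b_form v p)"
    if v: "v \<in> V" for v
    unfolding w_def[abs_def] r_def[abs_def] a_w_comb[OF V(2,1) v] b_w_comb_right[OF Q(2,1)] by simp
  then have 1: "a_form \<nu> w v = b_form v r" if "v \<in> V" for v
    using s s' that by (simp add: mEG_solution_def)
  have "b_form w r = 0"
    unfolding w_def[abs_def] b_w_comb_left[OF V(2,1) rQ] using s s' rQ by (simp add: mEG_solution_def)
  then have "a_form \<nu> w w = 0" using 1[OF wV] by simp
  then have w0: "w x = 0" if "T \<in> \<T>" "x \<in> interior T" for T x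
    using energy_zero_imp_zero[OF wV \<nu>] that by blast
  then have "b_form v r = 0" if "v \<in> V" for v
    using 1[OF that] a_w_zero_left[OF wV w0] by simp
  then have r0: "r x = 0" if "T \<in> \<T>" "x \<in> interior T" for T x
    using pressure_zero[OF rQ] that by blast
  show "AE x in lebesgue_on \<Omega>. u' x = u x"
    by (rule AE_mesh) (use w0 in \<open>simp add: w_def\<close>)
  show "AE x in lebesgue_on \<Omega>. p' x = p x"
    by (rule AE_mesh) (use r0 in \<open>simp add: r_def\<close>)
qed

end

theorem theorem4p5:
  fixes \<Omega> :: "(real^'d) set"
    and \<F> :: "(real^'d) set set set"
    and \<T> :: "(real^'d) set set"
    and Tp Tm :: "(real^'d) set \<Rightarrow> (real^'d) set"
    and \<nu> :: real
    and f :: "real^'d \<Rightarrow> real^'d"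
  assumes "CARD('d) \<in> {2, 3}"
    and "open \<Omega>" and "connected \<Omega>" and "\<Omega> \<noteq> {}" and "bounded \<Omega>"
    and "simply_connected \<Omega>" and "lipschitz_boundary \<Omega>"
    and "\<forall>\<T>'\<in>\<F>. triangulation_of \<Omega> \<T>'" and "shape_regular \<F>" and "\<T> \<in> \<F>"
    and "face_labelling \<Omega> \<T> Tp Tm"
    and "\<nu> > 0"
    and "f \<in> L2 \<Omega>"
  shows "\<exists>u p. mEG_solution \<Omega> \<T> Tp Tm \<nu> f u p \<and>
           (\<forall>u' p'. mEG_solution \<Omega> \<T> Tp Tm \<nu> f u' p' \<longrightarrow>
              (AE x in lebesgue_on \<Omega>. u' x = u x) \<and> (AE x in lebesgue_on \<Omega>. p' x = p x))"
proof -
  interpret labelled_mesh \<Omega> \<T> Tp Tm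
    using assms by unfold_locales auto
  obtain u p where "mEG_solution \<Omega> \<T> Tp Tm \<nu> f u p"
    using mEG_solution_exists[OF \<open>\<nu> > 0\<close> \<open>f \<in> L2 \<Omega>\<close>] by blast
  then show ?thesis using mEG_solution_unique[OF \<open>\<nu> > 0\<close>] by blast
qed

end
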